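(* Let $n\ge1$ and let $\mathbb H=\mathbb R^{2n+1}$ be the Heisenberg group with its standard sub-Riemannian distance $d_{CC}$ and Lebesgue measure $\mathcal L^{2n+1}$. Fix $x_0\in\mathbb H$, let $\mathfrak f(x)=-\frac12d_{CC}^2(x,x_0)$, and let $\varphi_t$, $t\in[0,1]$, be the contraction maps towards $x_0$ along minimizing geodesics. Then for every Borel set $U$ and every $t\in[0,1]$, $$\mathcal L^{2n+1}(\varphi_t(U))=\int_U\frac{(1-t)^{2n+3}\,\mathcal M_1(\mathbf k_1(x),t)\,\mathcal M_2^{2n-2}(\mathbf k_2(x),t)}{\mathcal M_1(\mathbf k_1(x),0)\,\mathcal M_2^{2n-2}(\mathbf k_2(x),0)}\,d\mathcal L^{2n+1}(x),$$ where $\mathbf k_1(x)=(v_0\mathfrak f(x))^2$ and $\mathbf k_2(x)=\frac{(v_0\mathfrak f(x))^2}{4}$. In particular, $(\mathbb H,d_{CC},\mathcal L^{2n+1})$ satisfies $\mathcal{MCP}(0,0;2n,2n+1)=\mathcal{MCP}(0,2n+3)$.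
   Context: **Heisenberg group.** $\mathbb R^{2n+1}$ has coordinates $x_1,\dots,x_n,y_1,\dots,y_n,z$; $v_0=\partial_z$, $\alpha_0=dz-\frac12\sum_i x_idy_i+\frac12\sum_i y_idx_i$, $X_i=\partial_{x_i}-\frac12y_i\partial_z$, $Y_i=\partial_{y_i}+\frac12x_i\partial_z$. The distribution is $\mathcal D=\ker\alpha_0=\mathrm{span}\{X_i,Y_i\}$, and the Riemannian metric makes $X_1,\dots,X_n,Y_1,\dots,Y_n,\partial_z$ orthonormal (its volume is $\mathcal L^{2n+1}$). The sub-Riemannian metric is its restriction to $\mathcal D$. **Sub-Riemannian distance and contraction maps.** $d_{CC}(x_0,x_1)$ is the infimum of the lengths $\int_0^1|\dot\gamma(t)|\,dt$ over Lipschitz curves $\gamma:[0,1]\to M$ (here $M=\mathbb H$) with $\dot\gamma(t)\in\mathcal D$ for a.e. $t$, $\gamma(0)=x_0$, $\gamma(1)=x_1$. Minimizers, parametrized with constant speed on $[0,1]$, are called minimizing geodesics. For each $x_0$, almost every $x$ is joined to $x_0$ by a unique minimizing geodesic $t\mapsto\varphi_t(x)$, $t\in[0,1]$, with $\varphi_0(x)=x$, $\varphi_1(x)=x_0$; this defines $\varphi_t$ almost everywhere. The function $\mathfrak f$ is differentiable almost everywhere. **Functions and conditions.** With $\mathfrak D=\mathfrak D(k,t)=\sqrt{|k|}(1-t)$, $$\mathcal M_1(k,t)=\begin{cases}\frac{2-2\cos\mathfrak D-\mathfrak D\sin\mathfrak D}{\mathfrak D^4}&k>0\\ \frac1{12}&k=0\\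 \frac{2-2\cosh\mathfrak D+\mathfrak D\sinh\mathfrak D}{\mathfrak D^4}&k<0\end{cases},\qquad \mathcal M_2(k,t)=\begin{cases}\frac{\sin\mathfrak D}{\mathfrak D}&k>0\\1&k=0\\ \frac{\sinh\mathfrak D}{\mathfrak D}&k<0\end{cases}$$ (extended continuously to $\mathfrak D=0$). $(M,d,\mu)$ satisfies $\mathcal{MCP}(0,N)$ if $\mu(\varphi_t(U))\ge(1-t)^N\mu(U)$ for each $x_0$, each Borel $U$ and each $t\in[0,1]$. It satisfies $\mathcal{MCP}(k_1,k_2;N-1,N)$ if for each $x_0\in M$, each Borel $U$ and each $t\in[0,1]$, $\mu(\varphi_t(U))\ge\int_U\frac{(1-t)^{N+2}\mathcal M_1(k_1d^2(x,x_0),t)\mathcal M_2^{N-3}(k_2d^2(x,x_0),t)}{\mathcal M_1(k_1d^2(x,x_0),0)\mathcal M_2^{N-3}(k_2d^2(x,x_0),0)}d\mu(x)$; for $k_1=k_2=0$ this is $\mathcal{MCP}(0,N+2)$. *)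

theory Defs
  imports "HOL-Analysis.Analysis"
begin

section \<open>Sub-Riemannian structures on a Euclidean space\<close>

text \<open>
  A sub-Riemannian structure on the manifold \<open>'a\<close> is given by a distribution
  \<open>\<Delta> p \<subseteq> T\<^sub>p 'a = 'a\<close> and a Riemannian metric \<open>g p\<close>, of which only the restriction to
  \<open>\<Delta> p\<close> matters. Curves are functions on the whole real line, but only their restriction to
  \<open>{0..1}\<close> plays a role.
\<close>

type_synonym 'a distribution = "'a \<Rightarrow> 'a set"
type_synonym 'a metric = "'a \<Rightarrow> 'a \<Rightarrow> 'a \<Rightarrow> real"

definition velocity :: "(real \<Rightarrow> 'a::euclidean_space) \<Rightarrow> real \<Rightarrow> 'a" where
  "velocity \<gamma> t = vector_derivative \<gamma> (at t within {0..1})"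

definition speed :: "'a::euclidean_space metric \<Rightarrow> (real \<Rightarrow> 'a) \<Rightarrow> real \<Rightarrow> real" where
  "speed g \<gamma> t = sqrt (g (\<gamma> t) (velocity \<gamma> t) (velocity \<gamma> t))"

text \<open>
  On the compact image of a curve, being Lipschitz for the Euclidean distance and for the distance
  of a Riemannian metric is the same. Differentiability almost everywhere is automatic by
  Rademacher's theorem; it is spelled out because \<^const>\<open>vector_derivative\<close> is total.
\<close>

definition admissible ::
    "'a::euclidean_space distribution \<Rightarrow> (real \<Rightarrow> 'a) \<Rightarrow> 'a \<Rightarrow> 'a \<Rightarrow> bool" where
  "admissible \<Delta> \<gamma> p q \<longleftrightarrow>
     (\<exists>L. L-lipschitz_on {0..1} \<gamma>) \<and>
     (AE t in lebesgue. t \<in> {0..1} \<longrightarrow>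
        \<gamma> differentiable (at t within {0..1}) \<and> velocity \<gamma> t \<in> \<Delta> (\<gamma> t)) \<and>
     \<gamma> 0 = p \<and> \<gamma> 1 = q"

definition curve_length :: "'a::euclidean_space metric \<Rightarrow> (real \<Rightarrow> 'a) \<Rightarrow> real" where
  "curve_length g \<gamma> = integral {0..1} (speed g \<gamma>)"

text \<open>The infimum is meaningful only if \<open>p\<close> and \<open>q\<close> can be joined by an admissible curve.\<close>

definition cc_dist ::
    "'a::euclidean_space distribution \<Rightarrow> 'a metric \<Rightarrow> 'a \<Rightarrow> 'a \<Rightarrow> real" where
  "cc_dist \<Delta> g p q = (INF \<gamma> \<in> {\<gamma>. admissible \<Delta> \<gamma> p q}. curve_length g \<gamma>)"

definition minimizing_geodesic ::
    "'a::euclidean_space distribution \<Rightarrow> 'a metric \<Rightarrow> (real \<Rightarrow> 'a) \<Rightarrow> 'a \<Rightarrow> 'a \<Rightarrow> bool" where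
  "minimizing_geodesic \<Delta> g \<gamma> p q \<longleftrightarrow>
     admissible \<Delta> \<gamma> p q \<and>
     curve_length g \<gamma> = cc_dist \<Delta> g p q \<and>
     (\<exists>c. AE t in lebesgue. t \<in> {0..1} \<longrightarrow> speed g \<gamma> t = c)"

text \<open>
  The contraction maps towards \<open>x\<^sub>0\<close> are only defined on the set of points joined to \<open>x\<^sub>0\<close>
  by a unique minimizing geodesic. Accordingly, \<open>contraction_image\<close> is the image of a set under
  this partially defined map; outside of its domain \<open>contraction\<close> has no meaning.
\<close>

definition contraction_dom ::
    "'a::euclidean_space distribution \<Rightarrow> 'a metric \<Rightarrow> 'a \<Rightarrow> 'a set" where
  "contraction_dom \<Delta> g x\<^sub>0 =
     {x. (\<exists>\<gamma>. minimizing_geodesic \<Delta> g \<gamma> x x\<^sub>0) \<and>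
         (\<forall>\<gamma> \<gamma>'. minimizing_geodesic \<Delta> g \<gamma> x x\<^sub>0 \<and> minimizing_geodesic \<Delta> g \<gamma>' x x\<^sub>0 \<longrightarrow>
            (\<forall>t\<in>{0..1}. \<gamma> t = \<gamma>' t))}"

definition contraction ::
    "'a::euclidean_space distribution \<Rightarrow> 'a metric \<Rightarrow> 'a \<Rightarrow> real \<Rightarrow> 'a \<Rightarrow> 'a" where
  "contraction \<Delta> g x\<^sub>0 t x = (SOME \<gamma>. minimizing_geodesic \<Delta> g \<gamma> x x\<^sub>0) t"

definition contraction_image ::
    "'a::euclidean_space distribution \<Rightarrow> 'a metric \<Rightarrow> 'a \<Rightarrow> real \<Rightarrow> 'a set \<Rightarrow> 'a set" where
  "contraction_image \<Delta> g x\<^sub>0 t U = contraction \<Delta> g x\<^sub>0 t ` (U \<inter> contraction_dom \<Delta> g x\<^sub>0)"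

section \<open>Measure contraction properties\<close>

definition DD :: "real \<Rightarrow> real \<Rightarrow> real" where
  "DD k t = sqrt \<bar>k\<bar> * (1 - t)"

text \<open>
  The first case is the value at \<open>k = 0\<close> and also the continuous extension to \<open>t = 1\<close>.
\<close>

definition M1 :: "real \<Rightarrow> real \<Rightarrow> real" where
  "M1 k t =
    (if DD k t = 0 then 1 / 12
     else if k > 0 then (2 - 2 * cos (DD k t) - DD k t * sin (DD k t)) / DD k t ^ 4
     else (2 - 2 * cosh (DD k t) + DD k t * sinh (DD k t)) / DD k t ^ 4)"

definition M2 :: "real \<Rightarrow> real \<Rightarrow> real" where
  "M2 k t =
    (if DD k t = 0 then 1
     else if k > 0 then sin (DD k t) / DD k t
     else sinh (DD k t) / DD k t)"

text \<open>
  The measure of a non-measurable set is \<open>0\<close> by convention, so the inequalities below are not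
  weakened by leaving the measurability of the contracted sets implicit.
\<close>

definition MCP0 ::
    "'a::euclidean_space distribution \<Rightarrow> 'a metric \<Rightarrow> 'a measure \<Rightarrow> real \<Rightarrow> bool" where
  "MCP0 \<Delta> g \<mu> N \<longleftrightarrow>
     (\<forall>x\<^sub>0. \<forall>U\<in>sets borel. \<forall>t\<in>{0..1}.
        emeasure \<mu> (contraction_image \<Delta> g x\<^sub>0 t U) \<ge> ennreal ((1 - t) powr N) * emeasure \<mu> U)"

text \<open>
  \<open>MCP \<Delta> g \<mu> k\<^sub>1 k\<^sub>2 N\<close> is the property with parameters \<open>(k\<^sub>1, k\<^sub>2; N - 1, N)\<close>. Here \<open>N\<close> is a
  natural number because \<^const>\<open>M2\<close> takes negative values; the integer power avoids truncating
  \<open>N - 3\<close>.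
\<close>

definition MCP ::
    "'a::euclidean_space distribution \<Rightarrow> 'a metric \<Rightarrow> 'a measure \<Rightarrow> real \<Rightarrow> real \<Rightarrow> nat \<Rightarrow> bool" where
  "MCP \<Delta> g \<mu> k\<^sub>1 k\<^sub>2 N \<longleftrightarrow>
     (\<forall>x\<^sub>0. \<forall>U\<in>sets borel. \<forall>t\<in>{0..1}.
        emeasure \<mu> (contraction_image \<Delta> g x\<^sub>0 t U) \<ge>
        (\<integral>\<^sup>+x\<in>U. ennreal
            ((1 - t) ^ (N + 2) * M1 (k\<^sub>1 * (cc_dist \<Delta> g x x\<^sub>0)\<^sup>2) t
                * M2 (k\<^sub>2 * (cc_dist \<Delta> g x x\<^sub>0)\<^sup>2) t powi (int N - 3)
             / (M1 (k\<^sub>1 * (cc_dist \<Delta> g x x\<^sub>0)\<^sup>2) 0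
                * M2 (k\<^sub>2 * (cc_dist \<Delta> g x x\<^sub>0)\<^sup>2) 0 powi (int N - 3))) \<partial>\<mu>))"

section \<open>The Heisenberg group\<close>

text \<open>Points and tangent vectors are triples \<open>(x, y, z)\<close>, and \<open>n\<close> is \<open>CARD('n)\<close>.\<close>

type_synonym 'n heis = "(real ^ 'n) \<times> (real ^ 'n) \<times> real"

definition v0 :: "'n::finite heis" where
  "v0 = (0, 0, 1)"

definition hX :: "'n::finite \<Rightarrow> 'n heis \<Rightarrow> 'n heis" where
  "hX i = (\<lambda>(x, y, z). (axis i 1, 0, - (y $ i) / 2))"

definition hY :: "'n::finite \<Rightarrow> 'n heis \<Rightarrow> 'n heis" where
  "hY i = (\<lambda>(x, y, z). (0, axis i 1, (x $ i) / 2))"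

definition alpha0 :: "'n::finite heis \<Rightarrow> 'n heis \<Rightarrow> real" where
  "alpha0 = (\<lambda>(x, y, z) (a, b, c).
     c - (\<Sum>i\<in>UNIV. x $ i * b $ i) / 2 + (\<Sum>i\<in>UNIV. y $ i * a $ i) / 2)"

definition heis_horizontal :: "'n::finite heis distribution" where
  "heis_horizontal p = {v. alpha0 p v = 0}"

text \<open>
  The coframe dual to the frame \<open>X\<^sub>i, Y\<^sub>i, \<partial>\<^sub>z\<close> is \<open>dx\<^sub>i, dy\<^sub>i, \<alpha>\<^sub>0\<close>, so the metric
  that makes the frame orthonormal is the sum of the squares of these one-forms.
\<close>

definition heis_metric :: "'n::finite heis metric" where
  "heis_metric p = (\<lambda>v w.
     (\<Sum>i\<in>UNIV. fst v $ i * fst w $ i) + (\<Sum>i\<in>UNIV. fst (snd v) $ i * fst (snd w) $ i)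
     + alpha0 p v * alpha0 p w)"

lemma frame_expansion:
  "v = (\<Sum>i\<in>UNIV. (fst v $ i) *\<^sub>R hX i p) + (\<Sum>i\<in>UNIV. (fst (snd v) $ i) *\<^sub>R hY i p)
       + alpha0 p v *\<^sub>R v0"
proof -
  obtain x y z where p: "p = (x, y, z)" by (cases p) auto
  obtain a b c where v: "v = (a, b, c)" by (cases v) auto
  have 1: "(\<Sum>i\<in>UNIV. (u $ i) *\<^sub>R axis i 1) = u" for u :: "real ^ 'a"
    by (simp add: vec_eq_iff axis_def if_distrib cong: if_cong)
  have X: "(\<Sum>i\<in>UNIV. (a $ i) *\<^sub>R hX i p) = (a, 0, - (\<Sum>i\<in>UNIV. y $ i * a $ i) / 2)"
    by (simp add: p hX_def prod_eq_iff fst_sum snd_sum 1 sum_negf sum_divide_distrib mult.commute)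
  have Y: "(\<Sum>i\<in>UNIV. (b $ i) *\<^sub>R hY i p) = (0, b, (\<Sum>i\<in>UNIV. x $ i * b $ i) / 2)"
    by (simp add: p hY_def prod_eq_iff fst_sum snd_sum 1 sum_divide_distrib mult.commute)
  show ?thesis
    unfolding v fst_conv snd_conv X Y by (simp add: p v0_def alpha0_def)
qed

lemma sum_mult_axis: "(\<Sum>k\<in>UNIV. u $ k * axis i (1::real) $ k) = u $ i"
proof -
  have "(\<Sum>k\<in>UNIV. u $ k * axis i (1::real) $ k) = (\<Sum>k\<in>UNIV. if k = i then u $ k else 0)"
    by (rule sum.cong) (auto simp: axis_def)
  then show ?thesis by simp
qed

lemma sum_axis_axis:
  "(\<Sum>k\<in>UNIV. axis i (1::real) $ k * axis j 1 $ k) = (if i = j then 1 else 0)"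
  by (simp add: sum_mult_axis) (simp add: axis_def)

lemma fst_hX: "fst (hX i p) = axis i 1" and snd_hX: "fst (snd (hX i p)) = 0"
  and fst_hY: "fst (hY i p) = 0" and snd_hY: "fst (snd (hY i p)) = axis i 1"
  and fst_v0: "fst v0 = 0" and snd_v0: "fst (snd v0) = 0"
  by (simp_all add: hX_def hY_def v0_def split_beta)

lemma alpha0_hX: "alpha0 p (hX i p) = 0" and alpha0_hY: "alpha0 p (hY i p) = 0"
  and alpha0_v0: "alpha0 p v0 = 1"
  by (simp_all add: alpha0_def hX_def hY_def v0_def split_beta sum_mult_axis)

lemma heis_metric_orthonormal:
  "heis_metric p (hX i p) (hX j p) = (if i = j then 1 else 0)"
  "heis_metric p (hY i p) (hY j p) = (if i = j then 1 else 0)"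
  "heis_metric p (hX i p) (hY j p) = 0" "heis_metric p (hY i p) (hX j p) = 0"
  "heis_metric p (hX i p) v0 = 0" "heis_metric p v0 (hX i p) = 0"
  "heis_metric p (hY i p) v0 = 0" "heis_metric p v0 (hY i p) = 0"
  "heis_metric p v0 v0 = 1"
  by (simp_all add: heis_metric_def alpha0_hX alpha0_hY alpha0_v0 fst_hX snd_hX fst_hY snd_hY
      fst_v0 snd_v0 sum_axis_axis)

lemma heis_horizontal_eq_span: "heis_horizontal p = span (range (\<lambda>i. hX i p) \<union> range (\<lambda>i. hY i p))"
proof
  show "heis_horizontal p \<subseteq> span (range (\<lambda>i. hX i p) \<union> range (\<lambda>i. hY i p))"
  proof
    fix v assume "v \<in> heis_horizontal p"
    then have "v = (\<Sum>i\<in>UNIV. (fst v $ i) *\<^sub>R hX i p) + (\<Sum>i\<in>UNIV. (fst (snd v) $ i) *\<^sub>R hY i p)"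
      using frame_expansion[of v p] by (simp add: heis_horizontal_def)
    also have "\<dots> \<in> span (range (\<lambda>i. hX i p) \<union> range (\<lambda>i. hY i p))"
      by (intro span_add span_sum span_scale span_base) auto
    finally show "v \<in> span (range (\<lambda>i. hX i p) \<union> range (\<lambda>i. hY i p))" .
  qed
  have "subspace (heis_horizontal p)"
    unfolding subspace_def heis_horizontal_def
  proof (intro conjI ballI allI)
    show "0 \<in> {v. alpha0 p v = 0}"
      by (simp add: alpha0_def split_beta)
  next
    fix v w assume "v \<in> {v. alpha0 p v = 0}" "w \<in> {v. alpha0 p v = 0}"
    then show "v + w \<in> {v. alpha0 p v = 0}"
      by (simp add: alpha0_def split_beta distrib_left sum.distrib add_divide_distrib)
  next
    fix c v assume v: "v \<in> {v. alpha0 p v = 0}"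
    have "alpha0 p (c *\<^sub>R v) = c * alpha0 p v"
      by (simp add: alpha0_def split_beta sum_distrib_left algebra_simps sum_divide_distrib)
    then show "c *\<^sub>R v \<in> {v. alpha0 p v = 0}" using v by simp
  qed
  moreover have "range (\<lambda>i. hX i p) \<union> range (\<lambda>i. hY i p) \<subseteq> heis_horizontal p"
    by (auto simp: heis_horizontal_def alpha0_hX alpha0_hY)
  ultimately show "span (range (\<lambda>i. hX i p) \<union> range (\<lambda>i. hY i p)) \<subseteq> heis_horizontal p"
    by (rule span_minimal[rotated])
qed

abbreviation d_CC :: "'n::finite heis \<Rightarrow> 'n heis \<Rightarrow> real" where
  "d_CC \<equiv> cc_dist heis_horizontal heis_metric"

text \<open>The derivative \<open>v\<^sub>0 f(x) = \<partial>f/\<partial>z(x)\<close>.\<close>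

definition v0_deriv :: "('n::finite heis \<Rightarrow> real) \<Rightarrow> 'n heis \<Rightarrow> real" where
  "v0_deriv f x = deriv (\<lambda>s. f (x + s *\<^sub>R v0)) 0"

definition ff :: "'n::finite heis \<Rightarrow> 'n heis \<Rightarrow> real" where
  "ff x\<^sub>0 x = - (1 / 2) * (d_CC x x\<^sub>0)\<^sup>2"

definition kk1 :: "'n::finite heis \<Rightarrow> 'n heis \<Rightarrow> real" where
  "kk1 x\<^sub>0 x = (v0_deriv (ff x\<^sub>0) x)\<^sup>2"

definition kk2 :: "'n::finite heis \<Rightarrow> 'n heis \<Rightarrow> real" where
  "kk2 x\<^sub>0 x = (v0_deriv (ff x\<^sub>0) x)\<^sup>2 / 4"

end

theory Submission
  imports Defs "HOL-Real_Asymp.Real_Asymp"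
begin

text \<open>
  Identify \<open>\<real>\<^sup>n \<times> \<real>\<^sup>n\<close> with \<open>\<complex>\<^sup>n\<close>, let \<open>rot\<close> be multiplication by \<open>i\<close> and write points as
  \<open>(\<zeta>, z)\<close>. A horizontal curve is a curve \<open>\<zeta>\<close> together with the height \<open>z\<close> given by the area \<open>z' = \<langle>i \<zeta>, \<zeta>'\<rangle> / 2\<close> that
  it sweeps out, and its length is the Euclidean length of \<open>\<zeta>\<close>. Minimizing length is therefore
  Dido's problem, and the solutions are circular arcs: from the base point, an initial velocity
  \<open>h\<close> and a turning angle \<open>\<theta>\<close> determine a lifted arc of length \<open>|h|\<close>, and following it up to time
  \<open>1\<close> gives the exponential map \<open>(h, \<theta>) \<mapsto> geo x\<^sub>0 (h, \<theta>) 1\<close>.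

  For \<open>|\<theta>| < 2\<pi>\<close> the lifted arc is the unique shortest curve of constant speed between its
  endpoints.
  This is shown by a calibration. If a competitor differs from the arc by \<open>\<eta>\<close>, then its energy
  density minus that of the arc is an exact derivative plus the square of
  \<open>\<eta>' - i c \<eta> + T \<eta>\<close>, where \<open>c\<close> is half the angular velocity and \<open>T\<close> solves the Riccati equation
  \<open>T' = c\<^sup>2 + T\<^sup>2\<close> on \<open>[0, 1]\<close>; a solution exists because \<open>|c| < \<pi>\<close> (\<open>weighted_energy\<close>). The exact
  part integrates to zero. The remainder of the argument works with Lipschitz curves: it only
  needs the fundamental theorem of calculus for Lipschitz functions, and no reparametrization,
  since the identity holds for the arc run along an arbitrary \<open>C\<^sup>1\<close> clock \<open>\<sigma>\<close> and the clock
  can be adapted to the competitor (\<open>length_ge\<close>). If the square vanishes, then \<open>\<eta> = 0\<close>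
  (\<open>constant_speed_unique\<close>).

  For an arc, \<open>z / |\<zeta>|\<^sup>2\<close> is a function \<open>height\<close> of \<open>\<theta>\<close> alone, and it is an increasing
  bijection from \<open>(-2\<pi>, 2\<pi>)\<close> onto \<open>\<real>\<close>. Hence each point off the vertical line through \<open>x\<^sub>0\<close> is the
  image of exactly one \<open>(h, \<theta>)\<close> with \<open>h \<noteq> 0\<close> and \<open>|\<theta>| < 2\<pi>\<close>, and in these coordinates the contraction map is
  multiplication by \<open>1 - t\<close>. On the vertical line minimizers are not unique, because a half
  turn about the line yields another one (\<open>contraction_dom_eq\<close>). Differentiating
  \<open>d\<^sup>2 = |\<zeta>|\<^sup>2 / hsinc \<theta>\<^sup>2\<close> along \<open>\<theta> = height\<^sup>-\<^sup>1 (z / |\<zeta>|\<^sup>2)\<close> gives \<open>v\<^sub>0 f = -\<theta>\<close> (\<open>v0_deriv_ff\<close>), so that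
  \<open>k\<^sub>1 = \<theta>\<^sup>2\<close> and \<open>k\<^sub>2 = \<theta>\<^sup>2 / 4\<close>.

  The exponential map has Jacobian \<open>|h|\<^sup>2 M\<^sub>1(\<theta>\<^sup>2, 0) M\<^sub>2(\<theta>\<^sup>2 / 4, 0)\<^bsup>2n - 2\<^esup>\<close>. No
  determinant has to be computed: for fixed \<open>\<zeta>\<close> the substitution \<open>z = |\<zeta>|\<^sup>2 height \<theta>\<close> is one-dimensional,
  and for fixed \<open>\<theta>\<close> the map \<open>h \<mapsto> \<zeta>\<close> is multiplication by a complex number, so Fubini's theorem
  suffices (\<open>nn_integral_exp\<close>). Since contraction is a dilation in the coordinates \<open>(h, \<theta>)\<close>, the
  volume of the contracted set is the integral of \<open>(1 - t)\<^bsup>2n + 1\<^esup>\<close> times a quotient of two Jacobians,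
  which is the integrand of the theorem. The factors \<open>M\<^sub>1\<close> and \<open>M\<^sub>2\<close> decrease in \<open>|\<theta>|\<close>, which bounds the
  integrand from below by \<open>(1 - t)\<^bsup>2n + 3\<^esup>\<close> and yields both contraction properties.
\<close>

section \<open>The functions of the turning angle\<close>

text \<open>
  The next two functions are \<open>M2 (\<theta>\<^sup>2 / 4) 0\<close> and \<open>M1 (\<theta>\<^sup>2) 0\<close>, written as even functions of a
  signed angle. Their values at \<open>\<theta> = 0\<close> are the limits there and belong to straight lines. Geometrically, \<open>hsinc \<theta>\<close> is the ratio of
  chord to arc length for an arc that turns by \<open>\<theta>\<close>.
\<close>
definition hsinc :: "real \<Rightarrow> real" where
  "hsinc \<theta> = (if \<theta> = 0 then 1 else sin (\<theta> / 2) / (\<theta> / 2))"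

definition jac :: "real \<Rightarrow> real" where
  "jac \<theta> = (if \<theta> = 0 then 1 / 12 else (2 - 2 * cos \<theta> - \<theta> * sin \<theta>) / \<theta> ^ 4)"

text \<open>
  The height gained along an arc turning by \<open>\<theta>\<close> (the signed area between arc and chord) divided by the
  square of the chord. The value at \<open>\<theta> = 0\<close> is the limit \<open>0\<close> by the convention on division.
\<close>
definition height :: "real \<Rightarrow> real" where
  "height \<theta> = (\<theta> - sin \<theta>) / (8 * (sin (\<theta> / 2))\<^sup>2)"

lemma M1_square: "M1 (\<theta>\<^sup>2) t = jac (\<theta> * (1 - t))"
proof -
  have *: "DD (\<theta>\<^sup>2) t = \<bar>\<theta>\<bar> * (1 - t)" by (simp add: DD_def)
  show ?thesis
    unfolding M1_def * jac_def by (cases "\<theta> \<ge> 0") (auto simp: power_mult_distrib)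
qed

lemma M2_square: "M2 (\<theta>\<^sup>2 / 4) t = hsinc (\<theta> * (1 - t))"
proof -
  have *: "DD (\<theta>\<^sup>2 / 4) t = \<bar>\<theta>\<bar> / 2 * (1 - t)" by (simp add: DD_def real_sqrt_divide)
  show ?thesis
    unfolding M2_def * hsinc_def by (cases "\<theta> \<ge> 0") (auto simp: field_simps)
qed

lemma sin_minus_mult_cos_pos:
  fixes a :: real assumes "0 < a" "a < pi" shows "0 < sin a - a * cos a"
proof -
  have "(\<lambda>x. sin x - x * cos x) 0 < (\<lambda>x. sin x - x * cos x) a"
  proof (rule DERIV_pos_imp_increasing_open[OF \<open>0 < a\<close>])
    fix x :: real assume x: "0 < x" "x < a"
    have "((\<lambda>x. sin x - x * cos x) has_real_derivative x * sin x) (at x)"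
      by (auto intro!: derivative_eq_intros simp: algebra_simps)
    moreover have "0 < x * sin x" using x assms by (intro mult_pos_pos sin_gt_zero) auto
    ultimately show "\<exists>y. ((\<lambda>x. sin x - x * cos x) has_real_derivative y) (at x) \<and> 0 < y" by blast
  qed (auto intro!: continuous_intros)
  then show ?thesis by simp
qed

lemma sin_minus_mult_cos_le:
  fixes a :: real assumes "0 \<le> a" shows "sin a - a * cos a \<le> a ^ 3 / 3"
proof -
  have "(\<lambda>x. sin x - x * cos x - x ^ 3 / 3) a \<le> (\<lambda>x. sin x - x * cos x - x ^ 3 / 3) 0"
  proof (rule DERIV_nonpos_imp_nonincreasing[OF assms])
    fix x :: real assume x: "0 \<le> x" "x \<le> a"
    have "((\<lambda>x. sin x - x * cos x - x ^ 3 / 3) has_real_derivative x * sin x - x\<^sup>2) (at x)"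
      by (auto intro!: derivative_eq_intros simp: algebra_simps power2_eq_square)
    moreover have "x * sin x \<le> x * x" using x by (intro mult_left_mono sin_x_le_x) auto
    ultimately show "\<exists>y. ((\<lambda>x. sin x - x * cos x - x ^ 3 / 3) has_real_derivative y) (at x) \<and> y \<le> 0" 
      by (auto simp: power2_eq_square)
  qed
  then show ?thesis by simp
qed

lemma hsinc_minus [simp]: "hsinc (- \<theta>) = hsinc \<theta>" by (simp add: hsinc_def)
lemma jac_minus [simp]: "jac (- \<theta>) = jac \<theta>" by (simp add: jac_def)
lemma height_minus [simp]: "height (- \<theta>) = - height \<theta>"
  by (simp add: height_def diff_divide_distrib)
lemma height_0 [simp]: "height 0 = 0" by (simp add: height_def)

lemma hsinc_abs [simp]: "hsinc \<bar>\<theta>\<bar> = hsinc \<theta>" and jac_abs [simp]: "jac \<bar>\<theta>\<bar> = jac \<theta>"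
  by (simp_all add: abs_if)

lemma sin_half_nonzero: "\<theta> \<noteq> 0 \<Longrightarrow> \<bar>\<theta>\<bar> < 2 * pi \<Longrightarrow> sin (\<theta> / 2) \<noteq> 0"
  using sin_gt_zero[of "\<bar>\<theta>\<bar> / 2"] by (cases "\<theta> > 0") auto

lemma hsinc_pos: assumes "\<bar>\<theta>\<bar> < 2 * pi" shows "0 < hsinc \<theta>"
proof -
  have "0 < hsinc \<bar>\<theta>\<bar>" using assms sin_gt_zero[of "\<bar>\<theta>\<bar> / 2"]
    by (auto simp: hsinc_def simp del: hsinc_abs)
  then show ?thesis by simp
qed

lemma hsinc_le_1: "hsinc \<theta> \<le> 1"
proof -
  have "hsinc \<bar>\<theta>\<bar> \<le> 1" using sin_x_le_x[of "\<bar>\<theta>\<bar> / 2"]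
    by (auto simp: hsinc_def field_simps simp del: hsinc_abs)
  then show ?thesis by simp
qed

text \<open>
  Through half-angle formulas, \<open>jac\<close> splits into two positive decreasing factors. Both its
  positivity and its monotonicity are read off from this product.
\<close>
lemma jac_factor: assumes "\<theta> \<noteq> 0"
  shows "jac \<theta> = hsinc \<theta> * ((sin (\<theta> / 2) - \<theta> / 2 * cos (\<theta> / 2)) / (\<theta> / 2) ^ 3) / 4"
proof -
  have c: "cos \<theta> = 1 - 2 * (sin (\<theta> / 2))\<^sup>2" using cos_double_sin[of "\<theta> / 2"] by simp
  have s: "sin \<theta> = 2 * sin (\<theta> / 2) * cos (\<theta> / 2)" using sin_double[of "\<theta> / 2"] by simp
  show ?thesis using assms unfolding jac_def hsinc_def c s
    by (simp add: field_simps power2_eq_square eval_nat_numeral)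
qed

lemma hsinc_antimono:
  assumes "0 < a" "a \<le> b" "b < 2 * pi" shows "hsinc b \<le> hsinc a"
proof -
  have "(\<lambda>x. sin (x / 2) / (x / 2)) b \<le> (\<lambda>x. sin (x / 2) / (x / 2)) a"
  proof (rule DERIV_nonpos_imp_nonincreasing[OF \<open>a \<le> b\<close>])
    fix x assume x: "a \<le> x" "x \<le> b"
    have "((\<lambda>x. sin (x / 2) / (x / 2)) has_real_derivative
            - (sin (x / 2) - x / 2 * cos (x / 2)) / (2 * (x / 2)\<^sup>2)) (at x)"
      using x assms by (auto intro!: derivative_eq_intros simp: field_simps power2_eq_square)
    moreover have "0 < sin (x / 2) - x / 2 * cos (x / 2)"
      using x assms by (intro sin_minus_mult_cos_pos) auto
    then have "- (sin (x / 2) - x / 2 * cos (x / 2)) / (2 * (x / 2)\<^sup>2) \<le> 0"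
      by (intro divide_nonpos_nonneg) auto
    ultimately show "\<exists>y. ((\<lambda>x. sin (x / 2) / (x / 2)) has_real_derivative y) (at x) \<and> y \<le> 0" by blast
  qed
  then show ?thesis using assms by (simp add: hsinc_def)
qed

lemma sin_minus_mult_cos_quotient_antimono:
  fixes a b :: real
  assumes "0 < a" "a \<le> b" "b < pi"
  shows "(sin b - b * cos b) / b ^ 3 \<le> (sin a - a * cos a) / a ^ 3"
proof -
  have "(\<lambda>x. (sin x - x * cos x) / x ^ 3) b \<le> (\<lambda>x. (sin x - x * cos x) / x ^ 3) a"
  proof (rule DERIV_nonpos_imp_nonincreasing[OF \<open>a \<le> b\<close>])
    fix x :: real assume x: "a \<le> x" "x \<le> b"
    let ?g = "\<lambda>x::real. 3 * sin x - 3 * x * cos x - x\<^sup>2 * sin x"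
    have "?g 0 \<le> ?g x"
    proof (rule DERIV_nonneg_imp_nondecreasing[of 0 x ?g])
      fix y assume y: "0 \<le> y" "y \<le> x"
      have "(?g has_real_derivative y * (sin y - y * cos y)) (at y)"
        by (auto intro!: derivative_eq_intros simp: algebra_simps power2_eq_square)
      moreover have "0 \<le> y * (sin y - y * cos y)"
        using sin_minus_mult_cos_pos[of y] y x assms
        by (cases "y = 0") (auto intro!: mult_nonneg_nonneg)
      ultimately show "\<exists>z. (?g has_real_derivative z) (at y) \<and> 0 \<le> z" by blast
    qed (use x assms in auto)
    then have "0 \<le> ?g x" by simp
    moreover have "((\<lambda>x. (sin x - x * cos x) / x ^ 3) has_real_derivative - ?g x / x ^ 4) (at x)"
      using x assms by (auto intro!: derivative_eq_intros simp: field_simps eval_nat_numeral)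
    moreover have "- ?g x / x ^ 4 \<le> 0" using \<open>0 \<le> ?g x\<close> by (intro divide_nonpos_nonneg) auto
    ultimately show "\<exists>y. ((\<lambda>x. (sin x - x * cos x) / x ^ 3) has_real_derivative y) (at x) \<and> y \<le> 0"
      by blast
  qed
  then show ?thesis by simp
qed

lemma jac_pos: assumes "\<bar>\<theta>\<bar> < 2 * pi" shows "0 < jac \<theta>"
proof (cases "\<theta> = 0")
  case False
  have "0 < jac \<bar>\<theta>\<bar>"
    using False assms hsinc_pos[OF assms] sin_minus_mult_cos_pos[of "\<bar>\<theta>\<bar> / 2"]
    by (subst jac_factor) (auto intro!: divide_pos_pos mult_pos_pos simp del: jac_abs)
  then show ?thesis by simp
qed (simp add: jac_def)

lemma contract_less_two_pi:
  assumes "\<bar>\<theta>\<bar> < 2 * pi" "0 \<le> c" "c \<le> 1"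
  shows "\<bar>c * \<theta>\<bar> < 2 * pi"
  using mult_right_mono[of c 1 "\<bar>\<theta>\<bar>"] assms by (simp add: abs_mult)

text \<open>
  The monotonicity used for the contraction property: shrinking the angle towards \<open>0\<close> increases both
  factors of the Jacobian.
\<close>
lemma hsinc_contract:
  assumes "\<bar>\<theta>\<bar> < 2 * pi" "0 \<le> c" "c \<le> 1"
  shows "hsinc \<theta> \<le> hsinc (c * \<theta>)"
proof (cases "c * \<theta> = 0")
  case True then show ?thesis using hsinc_le_1[of \<theta>] by (simp only: True) (simp add: hsinc_def)
next
  case False
  have "hsinc \<bar>\<theta>\<bar> \<le> hsinc \<bar>c * \<theta>\<bar>"
    using False assms by (intro hsinc_antimono) (auto simp: abs_mult intro: mult_left_le_one_le)
  then show ?thesis by simp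
qed

lemma jac_contract:
  assumes "\<bar>\<theta>\<bar> < 2 * pi" "0 \<le> c" "c \<le> 1"
  shows "jac \<theta> \<le> jac (c * \<theta>)"
proof (cases "\<theta> = 0")
  case nz: False
  define a where "a = \<bar>\<theta>\<bar> / 2"
  have a: "0 < a" "a < pi" using nz assms by (auto simp: a_def)
  have J: "jac \<theta> = hsinc \<theta> * ((sin a - a * cos a) / a ^ 3) / 4"
    using jac_factor[of "\<bar>\<theta>\<bar>"] nz by (simp add: a_def)
  show ?thesis
  proof (cases "c = 0")
    case True
    have "(sin a - a * cos a) / a ^ 3 \<le> 1 / 3"
      using sin_minus_mult_cos_le[of a] a by (simp add: field_simps)
    then have "hsinc \<theta> * ((sin a - a * cos a) / a ^ 3) \<le> 1 * (1 / 3)"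
      using hsinc_le_1[of \<theta>] hsinc_pos[OF assms(1)] a sin_minus_mult_cos_pos[of a]
      by (intro mult_mono) auto
    then have "jac \<theta> \<le> 1 / 12" using J by argo
    then show ?thesis using True by (simp add: jac_def[of 0])
  next
    case False
    then have c: "0 < c * a" "c * a \<le> a" using assms a by (auto intro: mult_left_le_one_le)
    have "\<bar>c * \<theta>\<bar> \<noteq> 0" using False nz by simp
    from jac_factor[OF this] assms
    have "jac \<bar>c * \<theta>\<bar> = hsinc \<bar>c * \<theta>\<bar> * ((sin (c * a) - (c * a) * cos (c * a)) / (c * a) ^ 3) / 4"
      by (simp add: a_def abs_mult del: jac_abs hsinc_abs)
    then have J': "jac (c * \<theta>) = hsinc (c * \<theta>) * ((sin (c * a) - (c * a) * cos (c * a)) / (c * a) ^ 3) / 4"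
      by simp
    have "hsinc \<theta> * ((sin a - a * cos a) / a ^ 3)
        \<le> hsinc (c * \<theta>) * ((sin (c * a) - (c * a) * cos (c * a)) / (c * a) ^ 3)"
      using c a hsinc_contract[OF assms] hsinc_pos[OF assms(1)] sin_minus_mult_cos_pos[of a]
        sin_minus_mult_cos_quotient_antimono[of "c * a" a] hsinc_pos[OF contract_less_two_pi[OF assms]]
      by (intro mult_mono) auto
    then show ?thesis unfolding J J' by argo
  qed
qed simp

lemma inverse_hsinc_square: assumes "\<theta> \<noteq> 0"
  shows "1 / (hsinc \<theta>)\<^sup>2 = \<theta>\<^sup>2 / (4 * (sin (\<theta> / 2))\<^sup>2)"
proof -
  have "hsinc \<theta> = 2 * sin (\<theta> / 2) / \<theta>" using assms by (simp add: hsinc_def)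
  then show ?thesis by (simp only:) (simp add: power_divide power_mult_distrib)
qed

text \<open>
  The derivative of \<open>height\<close> is where the first factor of the Jacobian comes from. At \<open>\<theta> = 0\<close> the
  closed formula is singular, and the derivative is a limit of difference quotients.
\<close>
lemma DERIV_height:
  assumes "\<bar>\<theta>\<bar> < 2 * pi"
  shows "(height has_real_derivative jac \<theta> / (hsinc \<theta>) ^ 4) (at \<theta>)"
proof (cases "\<theta> = 0")
  case True
  have "((\<lambda>x::real. (x - sin x) / (8 * (sin (x/2))^2) / x) \<longlongrightarrow> 1/12) (at 0)"
    by (real_asymp simp: power2_eq_square)
  then show ?thesis unfolding True by (simp add: DERIV_def height_def jac_def hsinc_def)
next
  case False
  define S C where "S = sin (\<theta> / 2)" and "C = cos (\<theta> / 2)"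
  have S: "S \<noteq> 0" using sin_half_nonzero[OF False assms] by (simp add: S_def)
  have c: "cos \<theta> = 1 - 2 * S\<^sup>2" using cos_double_sin[of "\<theta> / 2"] by (simp add: S_def)
  have s: "sin \<theta> = 2 * S * C" using sin_double[of "\<theta> / 2"] by (simp add: S_def C_def)
  have J: "jac \<theta> = (4 * S\<^sup>2 - 2 * \<theta> * S * C) / \<theta> ^ 4" using False by (simp add: jac_def c s)
  have sinc4: "hsinc \<theta> ^ 4 = 16 * S ^ 4 / \<theta> ^ 4"
    using False by (simp add: hsinc_def S_def power_divide power_mult_distrib)
  have SC: "C\<^sup>2 = 1 - S\<^sup>2" using sin_cos_squared_add[of "\<theta> / 2"] by (simp only: S_def C_def)
  have "(height has_real_derivative
      ((1 - cos \<theta>) * (8 * S\<^sup>2) - (\<theta> - sin \<theta>) * (8 * S * C)) / (8 * S\<^sup>2)\<^sup>2) (at \<theta>)"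
  proof -
    have num: "((\<lambda>\<theta>. \<theta> - sin \<theta>) has_real_derivative 1 - cos \<theta>) (at \<theta>)"
      by (auto intro!: derivative_eq_intros)
    have den: "((\<lambda>\<theta>. 8 * (sin (\<theta> / 2))\<^sup>2) has_real_derivative 8 * S * C) (at \<theta>)"
      by (auto intro!: derivative_eq_intros simp: S_def C_def)
    have "8 * (sin (\<theta> / 2))\<^sup>2 \<noteq> 0" using S by (simp add: S_def)
    from DERIV_divide[OF num den this] show ?thesis
      unfolding height_def by (simp only: S_def power2_eq_square)
  qed
  also have "((1 - cos \<theta>) * (8 * S\<^sup>2) - (\<theta> - sin \<theta>) * (8 * S * C)) / (8 * S\<^sup>2)\<^sup>2
      = (16 * S\<^sup>2 * (S\<^sup>2 + C\<^sup>2) - 8 * \<theta> * S * C) / (64 * S ^ 4)"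
    unfolding c s by (rule arg_cong2[where f = "(/)"]) algebra+
  also have "\<dots> = jac \<theta> / (hsinc \<theta>) ^ 4"
    using False S unfolding J sinc4 SC by (simp add: divide_simps)
  finally show ?thesis .
qed

text \<open>
  The function \<open>1 / hsinc\<^sup>2\<close> is the squared distance of a point at chord length \<open>1\<close>. That its derivative
  is \<open>2 \<theta>\<close> times the derivative of \<open>height\<close> is the identity behind \<open>v\<^sub>0 f = -\<theta>\<close>.
\<close>
lemma DERIV_inverse_hsinc_square:
  assumes "\<bar>\<theta>\<bar> < 2 * pi"
  shows "((\<lambda>\<theta>. 1 / (hsinc \<theta>)\<^sup>2) has_real_derivative 2 * \<theta> * (jac \<theta> / (hsinc \<theta>) ^ 4)) (at \<theta>)"
proof (cases "\<theta> = 0")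
  case True
  \<comment> \<open>\<open>x\<^sup>2 - 4 sin\<^sup>2 (x / 2)\<close> is factored as a difference of squares.\<close>
  have "((\<lambda>x::real. (x/2 - sin (x/2)) / x^2) \<longlongrightarrow> 0) (at 0)" by real_asymp
  moreover have "((\<lambda>x::real. (x/2 + sin (x/2)) * x / (sin (x/2))^2) \<longlongrightarrow> 4) (at 0)"
    by (real_asymp simp: power2_eq_square)
  ultimately have "((\<lambda>x::real. (x/2 - sin (x/2)) / x^2 * ((x/2 + sin (x/2)) * x / (sin (x/2))^2))
      \<longlongrightarrow> 0 * 4) (at 0)"
    by (rule tendsto_mult)
  then have "((\<lambda>x::real. (1 / (hsinc x)\<^sup>2 - 1) / x) \<longlongrightarrow> 0 * 4) (at 0)"
  proof (rule Lim_transform_eventually)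
    have "eventually (\<lambda>x::real. x \<noteq> 0 \<and> \<bar>x\<bar> < 2 * pi) (at 0)"
      unfolding eventually_at by (rule exI[of _ "2 * pi"]) (auto simp: dist_norm)
    then show "\<forall>\<^sub>F x::real in at 0. (x/2 - sin (x/2)) / x^2 * ((x/2 + sin (x/2)) * x / (sin (x/2))^2)
         = (1 / (hsinc x)\<^sup>2 - 1) / x"
    proof eventually_elim
      case (elim x)
      have "sin (x / 2) \<noteq> 0" using elim sin_half_nonzero by blast
      with elim show ?case
        by (subst inverse_hsinc_square) (simp_all add: divide_simps, algebra)
    qed
  qed
  then show ?thesis unfolding True by (simp add: DERIV_def hsinc_def[of 0])
next
  case False
  define S C where "S = sin (\<theta> / 2)" and "C = cos (\<theta> / 2)"
  have S: "S \<noteq> 0" using sin_half_nonzero[OF False assms] by (simp add: S_def)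
  have c: "cos \<theta> = 1 - 2 * S\<^sup>2" using cos_double_sin[of "\<theta> / 2"] by (simp add: S_def)
  have s: "sin \<theta> = 2 * S * C" using sin_double[of "\<theta> / 2"] by (simp add: S_def C_def)
  have J: "jac \<theta> = (4 * S\<^sup>2 - 2 * \<theta> * S * C) / \<theta> ^ 4" using False by (simp add: jac_def c s)
  have sinc4: "hsinc \<theta> ^ 4 = 16 * S ^ 4 / \<theta> ^ 4"
    using False by (simp add: hsinc_def S_def power_divide power_mult_distrib)
  have D: "((\<lambda>\<theta>. \<theta>\<^sup>2 / (4 * (sin (\<theta> / 2))\<^sup>2)) has_real_derivative
      (2 * \<theta> * (4 * S\<^sup>2) - \<theta>\<^sup>2 * (4 * S * C)) / (4 * S\<^sup>2)\<^sup>2) (at \<theta>)"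
    by (rule derivative_eq_intros refl | use S in \<open>simp add: S_def C_def power2_eq_square\<close>)+
  have "(2 * \<theta> * (4 * S\<^sup>2) - \<theta>\<^sup>2 * (4 * S * C)) / (4 * S\<^sup>2)\<^sup>2 = 2 * \<theta> * (jac \<theta> / (hsinc \<theta>) ^ 4)"
    using False S unfolding J sinc4
    by (simp add: divide_simps) algebra
  with D have D: "((\<lambda>\<theta>. \<theta>\<^sup>2 / (4 * (sin (\<theta> / 2))\<^sup>2)) has_real_derivative
      2 * \<theta> * (jac \<theta> / (hsinc \<theta>) ^ 4)) (at \<theta>)" by simp
  show ?thesis
    by (rule has_field_derivative_transform_within_open[OF D, of "- {0}"])
       (use False in \<open>auto simp: inverse_hsinc_square\<close>)
qed

lemma height_less_iff:
  assumes "\<bar>a\<bar> < 2 * pi" "\<bar>b\<bar> < 2 * pi"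
  shows "height a < height b \<longleftrightarrow> a < b"
proof -
  have *: "height a < height b" if "a < b" "\<bar>a\<bar> < 2 * pi" "\<bar>b\<bar> < 2 * pi" for a b
  proof (rule DERIV_pos_imp_increasing[OF \<open>a < b\<close>])
    fix x assume "a \<le> x" "x \<le> b"
    then have "\<bar>x\<bar> < 2 * pi" using that by auto
    then show "\<exists>y. (height has_real_derivative y) (at x) \<and> 0 < y"
      using DERIV_height[of x] jac_pos[of x] hsinc_pos[of x] by (auto intro!: divide_pos_pos exI)
  qed
  show ?thesis using *[of a b] *[of b a] assms by (cases a b rule: linorder_cases) auto
qed

text \<open>As the arc closes up to a full circle, the chord shrinks to \<open>0\<close> while the area does not.\<close>
lemma height_surj_nonneg:
  assumes "0 \<le> w" shows "\<exists>\<theta>. \<bar>\<theta>\<bar> < 2 * pi \<and> height \<theta> = w"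
proof -
  have "filterlim height at_top (at_left (2*pi))" unfolding height_def by real_asymp
  then have "eventually (\<lambda>x. w \<le> height x) (at_left (2*pi))" by (simp add: filterlim_at_top)
  moreover have "eventually (\<lambda>x. x \<in> {0<..<2*pi}) (at_left (2*pi))"
    by (rule eventually_at_left_real) simp
  ultimately have "eventually (\<lambda>x. w \<le> height x \<and> x \<in> {0<..<2*pi}) (at_left (2*pi))"
    by eventually_elim auto
  then obtain b where b: "w \<le> height b" "0 < b" "b < 2 * pi"
    using eventually_happens[of _ "at_left (2*pi)"] by (auto simp: trivial_limit_at_left_real)
  have "\<exists>x. 0 \<le> x \<and> x \<le> b \<and> height x = w"
  proof (rule IVT)
    show "\<forall>x. 0 \<le> x \<and> x \<le> b \<longrightarrow> isCont height x"
      using b by (auto intro!: DERIV_isCont[OF DERIV_height])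
  qed (use b assms in auto)
  then show ?thesis using b by force
qed

lemma height_surj: "\<exists>\<theta>. \<bar>\<theta>\<bar> < 2 * pi \<and> height \<theta> = w"
proof (cases "0 \<le> w")
  case False
  then obtain \<theta> where "\<bar>\<theta>\<bar> < 2 * pi" "height \<theta> = - w" using height_surj_nonneg[of "- w"] by auto
  then show ?thesis by (intro exI[of _ "- \<theta>"]) auto
qed (rule height_surj_nonneg)

definition angle :: "real \<Rightarrow> real" where
  "angle w = (THE \<theta>. \<bar>\<theta>\<bar> < 2 * pi \<and> height \<theta> = w)"

lemma angle_height: "\<bar>\<theta>\<bar> < 2 * pi \<Longrightarrow> angle (height \<theta>) = \<theta>"
  unfolding angle_def
proof (rule the_equality)
  fix \<theta>' assume \<theta>: "\<bar>\<theta>\<bar> < 2 * pi" and "\<bar>\<theta>'\<bar> < 2 * pi \<and> height \<theta>' = height \<theta>"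
  then show "\<theta>' = \<theta>"
    using height_less_iff[of \<theta> \<theta>'] height_less_iff[of \<theta>' \<theta>] by auto
qed simp

lemma abs_angle: "\<bar>angle w\<bar> < 2 * pi" and height_angle: "height (angle w) = w"
proof -
  obtain \<theta> where "\<bar>\<theta>\<bar> < 2 * pi" "height \<theta> = w" using height_surj by blast
  then show "\<bar>angle w\<bar> < 2 * pi" "height (angle w) = w" using angle_height[of \<theta>] by auto
qed

lemma angle_less_iff: "angle v < angle w \<longleftrightarrow> v < w"
  using height_less_iff[OF abs_angle abs_angle, of v w] by (simp add: height_angle)

lemma DERIV_angle: "(angle has_real_derivative (hsinc (angle w)) ^ 4 / jac (angle w)) (at w)"
proof -
  let ?\<theta> = "angle w"
  have nz: "jac ?\<theta> / hsinc ?\<theta> ^ 4 \<noteq> 0"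
    using jac_pos[OF abs_angle, of w] hsinc_pos[OF abs_angle, of w] by simp
  have "(angle has_derivative (*) (hsinc ?\<theta> ^ 4 / jac ?\<theta>)) (at w)"
  proof (rule has_derivative_inverse_strong_x[where f = height and S = "{-2*pi<..<2*pi}" and f' = "(*) (jac ?\<theta> / hsinc ?\<theta> ^ 4)"])
    show "continuous_on {- 2 * pi<..<2 * pi} height"
      by (intro continuous_at_imp_continuous_on ballI DERIV_isCont[OF DERIV_height]) auto
    show "(height has_derivative (*) (jac ?\<theta> / hsinc ?\<theta> ^ 4)) (at ?\<theta>)"
      using DERIV_height[OF abs_angle] by (simp add: has_field_derivative_def)
    show "(*) (jac ?\<theta> / hsinc ?\<theta> ^ 4) \<circ> (*) (hsinc ?\<theta> ^ 4 / jac ?\<theta>) = id"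
      using nz by (auto simp: fun_eq_iff)
  qed (use abs_angle[of w] in \<open>auto simp: angle_height height_angle\<close>)
  then show ?thesis by (simp add: has_field_derivative_def)
qed

lemma continuous_on_angle: "continuous_on A angle"
  by (intro continuous_at_imp_continuous_on ballI DERIV_isCont[OF DERIV_angle])

lemma borel_measurable_angle [measurable]: "angle \<in> borel_measurable borel"
  by (intro borel_measurable_continuous_onI continuous_on_angle)


section \<open>Calculus of Lipschitz functions on the unit interval\<close>

text \<open>
  The argument is cut off at \<open>1\<close> so that the quotients are defined and continuous on the whole unit
  interval and inherit the bound by the Lipschitz constant.
\<close>
definition diff_quot :: "(real \<Rightarrow> 'a::real_normed_vector) \<Rightarrow> nat \<Rightarrow> real \<Rightarrow> 'a" where
  "diff_quot f k t = real (Suc k) *\<^sub>R (f (min 1 (t + inverse (real (Suc k)))) - f t)"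

lemma forward_difference_tendsto:
  fixes F :: "real \<Rightarrow> 'a::real_normed_vector"
  assumes "(F has_vector_derivative D) (at x within S)"
    and "eventually (\<lambda>k. x + inverse (real (Suc k)) \<in> S) sequentially"
  shows "(\<lambda>k. real (Suc k) *\<^sub>R (F (x + inverse (real (Suc k))) - F x)) \<longlonglongrightarrow> D"
proof -
  have "((\<lambda>y. (1 / norm (y - x)) *\<^sub>R (F y - (F x + (y - x) *\<^sub>R D))) \<longlongrightarrow> 0) (at x within S)"
    using assms(1) by (simp add: has_vector_derivative_def has_derivative_within)
  moreover have "filterlim (\<lambda>k. x + inverse (real (Suc k))) (at x within S) sequentially"
    unfolding filterlim_at
  proof
    show "\<forall>\<^sub>F k in sequentially. x + inverse (real (Suc k)) \<in> S \<and> x + inverse (real (Suc k)) \<noteq> x"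
      using assms(2) by eventually_elim simp
    show "(\<lambda>k. x + inverse (real (Suc k))) \<longlonglongrightarrow> x"
      using tendsto_add[OF tendsto_const[of x] LIMSEQ_inverse_real_of_nat] by simp
  qed
  ultimately have "(\<lambda>k. (1 / norm (x + inverse (real (Suc k)) - x)) *\<^sub>R
      (F (x + inverse (real (Suc k))) - (F x + (x + inverse (real (Suc k)) - x) *\<^sub>R D))) \<longlonglongrightarrow> 0"
    by (rule filterlim_compose)
  then have "(\<lambda>k. real (Suc k) *\<^sub>R (F (x + inverse (real (Suc k))) - F x) - D) \<longlonglongrightarrow> 0"
    by (simp add: algebra_simps inverse_eq_divide[symmetric] del: of_nat_Suc)
  then show ?thesis by (simp add: LIM_zero_iff)
qed

lemma diff_quot_tendsto:
  fixes f :: "real \<Rightarrow> 'a::real_normed_vector"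
  assumes "(f has_vector_derivative D) (at t within {0..1})" "0 \<le> t" "t < 1"
  shows "(\<lambda>k. diff_quot f k t) \<longlonglongrightarrow> D"
proof -
  have "eventually (\<lambda>k. inverse (real (Suc k)) < 1 - t) sequentially"
    using assms LIMSEQ_inverse_real_of_nat by (intro order_tendstoD) auto
  then have ev: "eventually (\<lambda>k. t + inverse (real (Suc k)) \<le> 1) sequentially"
    by eventually_elim auto
  then have "(\<lambda>k. real (Suc k) *\<^sub>R (f (t + inverse (real (Suc k))) - f t)) \<longlonglongrightarrow> D"
    using assms(1,2) by (intro forward_difference_tendsto) (auto elim!: eventually_mono)
  then show ?thesis
  proof (rule Lim_transform_eventually)
    show "\<forall>\<^sub>F k in sequentially. real (Suc k) *\<^sub>R (f (t + inverse (real (Suc k))) - f t) = diff_quot f k t"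
      using ev by eventually_elim (simp add: diff_quot_def min_absorb2)
  qed
qed

lemma norm_diff_quot_le:
  fixes f :: "real \<Rightarrow> 'a::real_normed_vector"
  assumes "L-lipschitz_on {0..1} f" "t \<in> {0..1}"
  shows "norm (diff_quot f k t) \<le> L"
proof -
  let ?h = "inverse (real (Suc k))"
  have h: "0 < ?h" by simp
  have L: "0 \<le> L" using assms(1) by (rule lipschitz_on_nonneg)
  have m: "min 1 (t + ?h) \<in> {0..1}" using assms(2) h by (auto simp: min_def simp del: of_nat_Suc)
  have "norm (f (min 1 (t + ?h)) - f t) \<le> L * norm (min 1 (t + ?h) - t)"
    using lipschitz_on_normD[OF assms(1) m assms(2)] .
  also have "\<dots> \<le> L * ?h"
  proof (rule mult_left_mono[OF _ L])
    show "norm (min 1 (t + ?h) - t) \<le> ?h" using assms(2) h by (auto simp: min_def abs_if simp del: of_nat_Suc)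
  qed
  finally have "norm (f (min 1 (t + ?h)) - f t) \<le> L * ?h" .
  then have "real (Suc k) * norm (f (min 1 (t + ?h)) - f t) \<le> real (Suc k) * (L * ?h)"
    by (rule mult_left_mono) simp
  moreover have "real (Suc k) * (L * ?h) = L" by simp
  ultimately show ?thesis unfolding diff_quot_def by (simp del: of_nat_Suc)
qed

lemma continuous_on_diff_quot:
  fixes f :: "real \<Rightarrow> 'a::real_normed_vector"
  assumes "continuous_on {0..1} f"
  shows "continuous_on {0..1} (diff_quot f k)"
  unfolding diff_quot_def
  by (intro continuous_intros continuous_on_compose2[OF assms])
    (auto simp: min_def intro: order_trans[OF _ less_imp_le])

text \<open>
  The difference quotients are bounded by the Lipschitz constant and converge almost everywhere to
  \<open>f'\<close>, so their integrals converge to that of \<open>f'\<close>. On the other hand, the integral of a difference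
  quotient of \<open>f\<close> is a difference of difference quotients of a primitive of \<open>f\<close>, and tends to
  \<open>f 1 - f 0\<close>.
\<close>
theorem lipschitz_fundamental_theorem:
  fixes f :: "real \<Rightarrow> 'a::euclidean_space"
  assumes lip: "L-lipschitz_on {0..1} f" and N: "negligible N"
    and der: "\<And>t. t \<in> {0..1} - N \<Longrightarrow> (f has_vector_derivative f' t) (at t within {0..1})"
  shows "(f' has_integral (f 1 - f 0)) {0..1}"
proof -
  define N' where "N' = insert 1 N"
  have negl: "negligible N'" using N by (simp add: N'_def)
  have contf: "continuous_on {0..1} f" using lip by (rule lipschitz_on_continuous_on)
  \<comment> \<open>A primitive beyond \<open>1\<close> is needed for the shifted integrals, hence the constant extension.\<close>
  define g where "g t = f (min 1 t)" for t
  have contg: "continuous_on {0..2} g" unfolding g_def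
    by (intro continuous_on_compose2[OF contf] continuous_intros) auto
  obtain G where G: "\<And>x. x \<in> {0..2} \<Longrightarrow> (G has_vector_derivative g x) (at x within {0..2})"
    using antiderivative_continuous[OF contg] by blast
  let ?h = "\<lambda>k. inverse (real (Suc k))"
  have h: "0 < ?h k" "?h k \<le> 1" for k by (auto simp: field_simps)
  have I: "(g has_integral G b - G a) {a..b}" if "0 \<le> a" "a \<le> b" "b \<le> 2" for a b
    using that by (intro fundamental_theorem_of_calculus has_vector_derivative_within_subset[OF G]) auto
  have Ik: "((\<lambda>t. diff_quot f k t) has_integral
      real (Suc k) *\<^sub>R ((G (1 + ?h k) - G (?h k)) - (G 1 - G 0))) {0..1}" for k
  proof -
    have sh: "((\<lambda>t. g (t + ?h k)) has_integral G (1 + ?h k) - G (?h k)) {0..1}"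
    proof -
      have "(g has_integral G (1 + ?h k) - G (?h k)) (cbox (?h k) (1 + ?h k))"
        using I[of "?h k" "1 + ?h k"] h[of k] by (simp del: of_nat_Suc)
      from has_integral_affinity[OF this, of 1 "?h k"] show ?thesis
        by (simp del: of_nat_Suc)
    qed
    have "((\<lambda>t. real (Suc k) *\<^sub>R (g (t + ?h k) - g t)) has_integral
        real (Suc k) *\<^sub>R ((G (1 + ?h k) - G (?h k)) - (G 1 - G 0))) {0..1}"
      by (intro has_integral_cmul has_integral_diff sh I) auto
    then show ?thesis
      by (rule has_integral_eq[rotated]) (auto simp: diff_quot_def g_def)
  qed
  have lim: "(\<lambda>k. real (Suc k) *\<^sub>R ((G (1 + ?h k) - G (?h k)) - (G 1 - G 0))) \<longlonglongrightarrow> f 1 - f 0"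
  proof -
    have "(\<lambda>k. real (Suc k) *\<^sub>R (G (1 + ?h k) - G 1)) \<longlonglongrightarrow> g 1"
      using h by (intro forward_difference_tendsto[OF G] always_eventually) (auto simp del: of_nat_Suc)
    moreover have "(\<lambda>k. real (Suc k) *\<^sub>R (G (0 + ?h k) - G 0)) \<longlonglongrightarrow> g 0"
    proof (intro forward_difference_tendsto[OF G] always_eventually allI)
      show "0 + ?h k \<in> {0..2}" for k
        using h(1)[of k] h(2)[of k] by (auto simp del: of_nat_Suc)
    qed simp
    ultimately have "(\<lambda>k. real (Suc k) *\<^sub>R (G (1 + ?h k) - G 1) - real (Suc k) *\<^sub>R (G (0 + ?h k) - G 0))
        \<longlonglongrightarrow> g 1 - g 0" by (rule tendsto_diff)
    moreover have "real (Suc k) *\<^sub>R (G (1 + ?h k) - G 1) - real (Suc k) *\<^sub>R (G (0 + ?h k) - G 0)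
        = real (Suc k) *\<^sub>R ((G (1 + ?h k) - G (?h k)) - (G 1 - G 0))" for k
      by (simp add: scaleR_diff_right del: of_nat_Suc)
    ultimately show ?thesis by (simp add: g_def del: of_nat_Suc)
  qed
  have "(f' has_integral f 1 - f 0) ({0..1} - N')"
  proof (rule has_integral_dominated_convergence[OF _ _ _ _ lim])
    show "(diff_quot f k has_integral real (Suc k) *\<^sub>R ((G (1 + ?h k) - G (?h k)) - (G 1 - G 0))) ({0..1} - N')" for k
      by (subst has_integral_spike_set_eq[of _ "{0..1}"]) (rule negligible_subset[OF negl], auto simp del: of_nat_Suc intro: negligible_subset[OF negl] Ik)
    have "(\<lambda>_. L) integrable_on {0..1::real}" by (intro integrable_const_ivl)
    then show "(\<lambda>_. L) integrable_on {0..1} - N'"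
      by (rule integrable_spike_set) (auto intro: negligible_subset[OF negl])
    show "\<forall>x\<in>{0..1} - N'. norm (diff_quot f k x) \<le> L" for k
      using norm_diff_quot_le[OF lip] by auto
    show "\<forall>x\<in>{0..1} - N'. (\<lambda>k. diff_quot f k x) \<longlonglongrightarrow> f' x"
      by (auto intro!: diff_quot_tendsto der simp: N'_def)
  qed
  then show ?thesis
    by (subst has_integral_spike_set_eq[of _ "{0..1} - N'"]) (auto intro: negligible_subset[OF negl])
qed

text \<open>Hiding the constant lets Lipschitz continuity of composite expressions be proved by rules.\<close>
definition lip :: "(real \<Rightarrow> 'a::metric_space) \<Rightarrow> bool" where
  "lip f \<longleftrightarrow> (\<exists>L. L-lipschitz_on {0..1} f)"

lemma lipI: "L-lipschitz_on {0..1} f \<Longrightarrow> lip f" by (auto simp: lip_def)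

lemma lip_continuous: "lip f \<Longrightarrow> continuous_on {0..1} f"
  by (auto simp: lip_def intro: lipschitz_on_continuous_on)

lemma lip_add: "lip f \<Longrightarrow> lip g \<Longrightarrow> lip (\<lambda>t. f t + g t)"
  for f g :: "real \<Rightarrow> 'a::real_normed_vector"
  by (auto simp: lip_def intro: lipschitz_on_add)

lemma lip_diff: "lip f \<Longrightarrow> lip g \<Longrightarrow> lip (\<lambda>t. f t - g t)"
  for f g :: "real \<Rightarrow> 'a::real_normed_vector"
  by (auto simp: lip_def intro: lipschitz_on_diff)

lemma lip_const: "lip (\<lambda>t. c)" by (auto simp: lip_def intro: lipschitz_on_constant)

lemma lip_bounded_bilinear:
  assumes "bounded_bilinear B" "lip f" "lip g"
  shows "lip (\<lambda>t. B (f t) (g t))"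
proof -
  interpret bounded_bilinear B by fact
  obtain K where K: "0 \<le> K" "\<And>a b. norm (B a b) \<le> norm a * norm b * K"
    using nonneg_bounded by blast
  obtain L M where L: "L-lipschitz_on {0..1} f" and M: "M-lipschitz_on {0..1} g"
    using assms by (auto simp: lip_def)
  have "bounded (f ` {0..1})" "bounded (g ` {0..1})"
    using assms by (auto intro!: compact_imp_bounded compact_continuous_image lip_continuous)
  then obtain P Q where P: "\<And>t. t \<in> {0..1} \<Longrightarrow> norm (f t) \<le> P" and Q: "\<And>t. t \<in> {0..1} \<Longrightarrow> norm (g t) \<le> Q"
    unfolding bounded_iff ball_simps by metis
  have PQ: "0 \<le> P" "0 \<le> Q" using P[of 0] Q[of 0] by (auto intro: order_trans[OF norm_ge_zero])
  have LM: "0 \<le> L" "0 \<le> M" using L M by (auto intro: lipschitz_on_nonneg)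
  have "((L * Q + P * M) * K)-lipschitz_on {0..1} (\<lambda>t. B (f t) (g t))"
  proof (rule lipschitz_onI)
    fix s t :: real assume st: "s \<in> {0..1}" "t \<in> {0..1}"
    have "B (f s) (g s) - B (f t) (g t) = B (f s - f t) (g s) + B (f t) (g s - g t)"
      by (simp add: diff_left diff_right)
    also have "norm \<dots> \<le> norm (f s - f t) * norm (g s) * K + norm (f t) * norm (g s - g t) * K"
      by (intro order_trans[OF norm_triangle_ineq] add_mono K)
    also have "\<dots> \<le> (L * dist s t) * Q * K + P * (M * dist s t) * K"
      using lipschitz_onD[OF L st] lipschitz_onD[OF M st] P[OF st(2)] Q[OF st(1)] K(1) PQ LM
      by (intro add_mono mult_right_mono mult_mono) (auto simp: dist_norm)
    finally show "dist (B (f s) (g s)) (B (f t) (g t)) \<le> (L * Q + P * M) * K * dist s t"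
      by (simp add: dist_norm algebra_simps)
  qed (use PQ LM K in auto)
  then show ?thesis by (rule lipI)
qed

lemmas lip_inner = lip_bounded_bilinear[OF bounded_bilinear_inner]
lemmas lip_mult = lip_bounded_bilinear[OF bounded_bilinear_mult]

lemma lip_bounded_linear:
  assumes "bounded_linear B" "lip f" shows "lip (\<lambda>t. B (f t))"
proof -
  obtain K where K: "K-lipschitz_on UNIV B"
    using bounded_linear.lipschitz_boundE[OF assms(1)] by blast
  obtain L where L: "L-lipschitz_on {0..1} f" using assms by (auto simp: lip_def)
  have "(K * L)-lipschitz_on {0..1} (\<lambda>t. B (f t))"
    using lipschitz_on_compose2[OF L, of K B] K by (auto intro: lipschitz_on_subset)
  then show ?thesis by (rule lipI)
qed

lemma lip_C1:
  fixes f :: "real \<Rightarrow> 'a::real_normed_vector"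
  assumes "\<And>t. t \<in> {0..1} \<Longrightarrow> (f has_vector_derivative f' t) (at t within {0..1})"
    and "continuous_on {0..1} f'"
  shows "lip f"
proof -
  have "bounded (f' ` {0..1})"
    using assms by (auto intro!: compact_imp_bounded compact_continuous_image)
  then obtain B where B: "\<And>t. t \<in> {0..1} \<Longrightarrow> norm (f' t) \<le> B" unfolding bounded_iff ball_simps by metis
  have "0 \<le> B" using B[of 0] by (auto intro: order_trans[OF norm_ge_zero])
  have "B-lipschitz_on {0..1} f"
  proof (rule lipschitz_onI[OF _ \<open>0 \<le> B\<close>])
    fix s t :: real assume st: "s \<in> {0..1}" "t \<in> {0..1}"
    show "dist (f s) (f t) \<le> B * dist s t" unfolding dist_norm
    proof (rule differentiable_bound[of "{0..1}" f "\<lambda>t h. h *\<^sub>R f' t"])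
      show "onorm (\<lambda>h. h *\<^sub>R f' x) \<le> B" if "x \<in> {0..1}" for x
        using mult_right_mono[OF B[OF that] abs_ge_zero] by (intro onorm_le) (simp add: mult.commute)
    qed (use assms st in \<open>auto simp: has_vector_derivative_def\<close>)
  qed
  then show ?thesis by (rule lipI)
qed


text \<open>
  The fundamental theorem applied to \<open>t \<mapsto> h (s t)\<close>. Its exceptional set is the preimage of \<open>N\<close> under
  a dilation, hence negligible.
\<close>
lemma lip_zero_derivative_imp_constant:
  fixes h :: "real \<Rightarrow> real"
  assumes h: "lip h" and N: "negligible N"
    and der: "\<And>t. t \<in> {0..1} - N \<Longrightarrow> (h has_vector_derivative 0) (at t within {0..1})"
    and s: "s \<in> {0..1}"
  shows "h s = h 0"
proof -
  obtain K where K: "K-lipschitz_on {0..1} h" using h by (auto simp: lip_def)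
  define p where "p t = h (s * t)" for t
  have range: "s * t \<in> {0..1}" if "t \<in> {0..1}" for t using that s by (auto intro: mult_le_one)
  show ?thesis
  proof (cases "s = 0")
    case False
    have "(K * s)-lipschitz_on {0..1} p"
    proof (rule lipschitz_onI)
      fix x y :: real assume xy: "x \<in> {0..1}" "y \<in> {0..1}"
      have "dist (h (s * x)) (h (s * y)) \<le> K * dist (s * x) (s * y)"
        using lipschitz_onD[OF K range[OF xy(1)] range[OF xy(2)]] .
      also have "dist (s * x) (s * y) = s * dist x y"
        using s by (simp add: dist_norm right_diff_distrib[symmetric] abs_mult)
      finally show "dist (p x) (p y) \<le> K * s * dist x y" by (simp add: p_def mult.assoc)
    qed (use s lipschitz_on_nonneg[OF K] in auto)
    moreover have "negligible ((\<lambda>x. (1 / s) *\<^sub>R x) ` N)"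
      by (rule negligible_differentiable_image_negligible[OF _ N bounded_linear_imp_differentiable_on])
        (simp, rule bounded_linear_scaleR_right)
    ultimately have "((\<lambda>_. 0) has_integral p 1 - p 0) {0..1::real}"
    proof (rule lipschitz_fundamental_theorem[where f = p and f' = "\<lambda>_. 0"])
      fix t assume t: "t \<in> {0..1} - (\<lambda>x. (1 / s) *\<^sub>R x) ` N"
      have "s * t \<notin> N"
      proof
        assume "s * t \<in> N"
        then have "(1 / s) *\<^sub>R (s * t) \<in> (\<lambda>x. (1 / s) *\<^sub>R x) ` N" by (rule imageI)
        then show False using t False by simp
      qed
      then have hd: "(h has_vector_derivative 0) (at (s * t) within {0..1})"
        using t range[of t] by (intro der) auto
      have "((\<lambda>t. s * t) has_vector_derivative s) (at t within {0..1})"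
        by (auto intro!: derivative_eq_intros simp: has_real_derivative_iff_has_vector_derivative[symmetric])
      moreover have "(*) s ` {0..1} \<subseteq> {0..1}" using range by blast
      then have "(h has_vector_derivative 0) (at (s * t) within (*) s ` {0..1})"
        by (rule has_vector_derivative_within_subset[OF hd])
      ultimately show "(p has_vector_derivative 0) (at t within {0..1})"
        using vector_diff_chain_within[of "(*) s" s t "{0..1}" h 0] by (simp add: o_def p_def[abs_def])
    qed
    then show ?thesis by (simp add: p_def)
  qed simp
qed

section \<open>The calibration of a circular arc\<close>

text \<open>Multiplication by \<open>i\<close> on \<open>\<complex>\<^sup>n\<close>, with real and imaginary parts as the two components.\<close>
definition rot :: "'a::real_inner \<times> 'a \<Rightarrow> 'a \<times> 'a" where
  "rot u = (- snd u, fst u)"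

lemma rot_add: "rot (u + v) = rot u + rot v" and rot_scaleR: "rot (c *\<^sub>R u) = c *\<^sub>R rot u"
  and rot_minus: "rot (- u) = - rot u" and rot_diff: "rot (u - v) = rot u - rot v"
  and rot_zero [simp]: "rot 0 = 0"
  and rot_rot [simp]: "rot (rot u) = - u"
  by (simp_all add: rot_def prod_eq_iff)

lemma inner_rot_self [simp]: "inner (rot u) u = 0" "inner u (rot u) = 0"
  and inner_rot_rot [simp]: "inner (rot u) (rot v) = inner u v"
  by (simp_all add: rot_def inner_prod_def inner_commute)

lemma inner_rot_right: "inner u (rot v) = - inner (rot u) v"
  by (simp add: rot_def inner_prod_def inner_commute)

lemma norm_rot [simp]: "norm (rot u) = norm u" by (simp add: norm_eq_sqrt_inner)

lemma bounded_linear_rot: "bounded_linear rot"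
  by (rule bounded_linear_intro[where K = 1]) (simp_all add: rot_add rot_scaleR)

lemmas rot_has_vector_derivative [derivative_intros] =
  bounded_linear.has_vector_derivative[OF bounded_linear_rot]
lemmas continuous_on_rot [continuous_intros] = bounded_linear.continuous_on[OF bounded_linear_rot]
lemmas lip_rot = lip_bounded_linear[OF bounded_linear_rot]
lemmas inner_has_vector_derivative =
  bounded_bilinear.has_vector_derivative[OF bounded_bilinear_inner]

text \<open>
  The pointwise form of the calibration. Here \<open>v\<close> is the velocity of the competitor, \<open>\<zeta>\<^sub>0\<close> and
  \<open>w V\<close> are position and velocity of the arc and \<open>\<eta>\<close> is their difference in position. The
  three groups on the right are the derivatives of
  \<open>2 \<langle>\<eta>, V\<rangle>\<close>, of \<open>2 c (2 (z - z\<^sub>0) - \<langle>i \<zeta>\<^sub>0, \<eta>\<rangle>)\<close> and of \<open>- T |\<eta>|\<^sup>2\<close>, once \<open>V' = 2 c w i V\<close> and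
  \<open>T' = w (c\<^sup>2 + T\<^sup>2)\<close>. The second group carries the constraint on the swept area, with
  \<open>2 c\<close> as Lagrange multiplier. The third completes the square.
\<close>
lemma calibration_identity:
  fixes \<eta> v V \<zeta>\<^sub>0 :: "'a::real_inner \<times> 'a" and w c T :: real
  assumes "w \<noteq> 0"
  shows "(norm v)\<^sup>2 / w - (norm (v - w *\<^sub>R V - (w * c) *\<^sub>R rot \<eta> + (w * T) *\<^sub>R \<eta>))\<^sup>2 / w
    = w * (norm V)\<^sup>2
      + (2 * (inner \<eta> ((2 * c * w) *\<^sub>R rot V) + inner (v - w *\<^sub>R V) V)
         + 2 * c * (inner (rot (\<zeta>\<^sub>0 + \<eta>)) v - w * inner (rot \<zeta>\<^sub>0) V
                   - (inner (rot \<zeta>\<^sub>0) (v - w *\<^sub>R V) + inner (rot (w *\<^sub>R V)) \<eta>))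
         - (T * (2 * inner \<eta> (v - w *\<^sub>R V)) + w * (c\<^sup>2 + T\<^sup>2) * (norm \<eta>)\<^sup>2))"
proof -
  define b where "b = v - w *\<^sub>R V"
  have v: "v = b + w *\<^sub>R V" by (simp add: b_def)
  have div_w: "(x + w * y) / w = x / w + y" for x y
    using assms by (simp add: add_divide_distrib)
  have 1: "(norm v)\<^sup>2 / w = (norm b)\<^sup>2 / w + (2 * inner b V + w * (norm V)\<^sup>2)"
  proof -
    have "(norm (b + w *\<^sub>R V))\<^sup>2 = (norm b)\<^sup>2 + w * (2 * inner b V + w * (norm V)\<^sup>2)"
      unfolding power2_norm_eq_inner by (simp add: inner_simps inner_commute algebra_simps)
    then show ?thesis unfolding v by (simp only: div_w)
  qed
  have 2: "(norm (b - (w * c) *\<^sub>R rot \<eta> + (w * T) *\<^sub>R \<eta>))\<^sup>2 / w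
      = (norm b)\<^sup>2 / w + (2 * T * inner \<eta> b - 2 * c * inner (rot \<eta>) b + w * ((c\<^sup>2 + T\<^sup>2) * (norm \<eta>)\<^sup>2))"
  proof -
    have "(norm (b - (w * c) *\<^sub>R rot \<eta> + (w * T) *\<^sub>R \<eta>))\<^sup>2
      = (norm b)\<^sup>2 + w * (2 * T * inner \<eta> b - 2 * c * inner (rot \<eta>) b + w * ((c\<^sup>2 + T\<^sup>2) * (norm \<eta>)\<^sup>2))"
      unfolding power2_norm_eq_inner
      by (simp add: inner_simps inner_commute algebra_simps power2_eq_square[of c] power2_eq_square[of T])
    then show ?thesis by (simp only: div_w)
  qed
  have 3: "inner (rot \<eta>) V = - inner \<eta> (rot V)" and 4: "inner (rot V) \<eta> = inner \<eta> (rot V)"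
    by (simp_all only: inner_rot_right minus_minus inner_commute[of "rot V" \<eta>])
  show ?thesis
    unfolding 1 b_def[symmetric] 2
    unfolding v by (simp add: rot_add rot_scaleR inner_simps 3 4 algebra_simps)
qed


text \<open>
  A lifted arc \<open>(\<zeta>\<^sub>0, z\<^sub>0)\<close> of speed \<open>l\<close>. Since its velocity \<open>V\<close> rotates with angular velocity
  \<open>2 c\<close>, the bound on \<open>c\<close> says that it turns by less than a full circle in unit time.
\<close>
locale magnetic_arc =
  fixes c l :: real and V \<zeta>\<^sub>0 :: "real \<Rightarrow> 'a::euclidean_space \<times> 'a" and z\<^sub>0 :: "real \<Rightarrow> real"
  assumes c: "\<bar>c\<bar> < pi" and l: "0 \<le> l" and norm_V: "norm (V s) = l"
    and V_deriv: "(V has_vector_derivative (2 * c) *\<^sub>R rot (V s)) (at s)"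
    and \<zeta>\<^sub>0_deriv: "(\<zeta>\<^sub>0 has_vector_derivative V s) (at s)"
    and z\<^sub>0_deriv: "(z\<^sub>0 has_vector_derivative inner (rot (\<zeta>\<^sub>0 s)) (V s) / 2) (at s)"
begin

text \<open>
  The solution of \<open>T' = c\<^sup>2 + T\<^sup>2\<close> that is odd about the midpoint of the interval. It is
  finite on \<open>[0, 1]\<close> exactly if \<open>|c| < \<pi>\<close>, so this is where the restriction to less than
  a full circle enters.
\<close>
definition riccati :: "real \<Rightarrow> real" where
  "riccati s = c * tan (c * (s - 1 / 2))"

lemma cos_pos: assumes "s \<in> {0..1}" shows "0 < cos (c * (s - 1 / 2))"
proof -
  have "\<bar>c * (s - 1 / 2)\<bar> \<le> \<bar>c\<bar> * (1 / 2)"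
    unfolding abs_mult using assms by (intro mult_left_mono) (auto simp: abs_if)
  then show ?thesis using c by (intro cos_gt_zero_pi) auto
qed

lemma riccati_deriv:
  assumes "s \<in> {0..1}"
  shows "(riccati has_vector_derivative c\<^sup>2 + (riccati s)\<^sup>2) (at s)"
proof -
  have cp: "cos (c * (s - 1 / 2)) \<noteq> 0" using cos_pos[OF assms] by simp
  have "(riccati has_real_derivative c * (c * inverse ((cos (c * (s - 1 / 2)))\<^sup>2))) (at s)"
    unfolding riccati_def using cp by (auto intro!: derivative_eq_intros)
  also have "c * (c * inverse ((cos (c * (s - 1 / 2)))\<^sup>2)) = c\<^sup>2 + (riccati s)\<^sup>2"
    unfolding riccati_def power_mult_distrib power_inverse[symmetric] tan_sec[OF cp, symmetric]
    by (simp add: power2_eq_square algebra_simps)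
  finally show ?thesis by (simp add: has_real_derivative_iff_has_vector_derivative)
qed

lemma continuous_riccati: "continuous_on {0..1} riccati"
  using has_vector_derivative_continuous[OF riccati_deriv] by (blast intro: continuous_at_imp_continuous_on)

end

text \<open>
  The exceptional set \<open>N\<close> is part of the data and \<open>v\<close> is set to \<open>0\<close> on it, so that
  \<open>v\<close> is bounded by \<open>L\<close> on the whole interval. The right endpoint is put into \<open>N\<close> because forward
  difference quotients do not converge to the velocity there.
\<close>
locale horizontal_curve =
  fixes \<zeta> v :: "real \<Rightarrow> 'a::euclidean_space \<times> 'a" and z :: "real \<Rightarrow> real" and N :: "real set" and L :: real
  assumes lipschitz: "L-lipschitz_on {0..1} \<zeta>" and lip_z: "lip z"
    and negligible: "negligible N" and end_in_N: "1 \<in> N"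
    and \<zeta>_deriv: "\<And>t. t \<in> {0..1} - N \<Longrightarrow> (\<zeta> has_vector_derivative v t) (at t within {0..1})"
    and z_deriv: "\<And>t. t \<in> {0..1} - N \<Longrightarrow>
      (z has_vector_derivative inner (rot (\<zeta> t)) (v t) / 2) (at t within {0..1})"
    and v_exceptional: "\<And>t. t \<in> N \<Longrightarrow> v t = 0"
begin

lemma lip_\<zeta>: "lip \<zeta>" using lipschitz by (rule lipI)

lemma diff_quot_tendsto_v: "t \<in> {0..1} - N \<Longrightarrow> (\<lambda>k. diff_quot \<zeta> k t) \<longlonglongrightarrow> v t"
  using diff_quot_tendsto[OF \<zeta>_deriv, of t] end_in_N by (cases "t = 1") auto

lemma norm_v_le: assumes "t \<in> {0..1}" shows "norm (v t) \<le> L"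
proof (cases "t \<in> N")
  case True then show ?thesis using lipschitz_on_nonneg[OF lipschitz] by (simp add: v_exceptional)
next
  case False
  then have "(\<lambda>k. norm (diff_quot \<zeta> k t)) \<longlonglongrightarrow> norm (v t)"
    using assms by (intro tendsto_norm diff_quot_tendsto_v) auto
  then show ?thesis
    by (rule LIMSEQ_le_const2) (use norm_diff_quot_le[OF lipschitz assms] in blast)
qed

lemma v_measurable: "v \<in> borel_measurable (lebesgue_on {0..1})"
proof (rule integrable_imp_measurable)
  show "v integrable_on {0..1}"
    using lipschitz_fundamental_theorem[OF lipschitz negligible \<zeta>_deriv] by (auto simp: integrable_on_def)
qed

lemma integrable_bounded:
  fixes f :: "real \<Rightarrow> real"
  assumes "f \<in> borel_measurable (lebesgue_on {0..1})" "\<And>t. t \<in> {0..1} \<Longrightarrow> \<bar>f t\<bar> \<le> B"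
  shows "f integrable_on {0..1}"
proof (rule measurable_bounded_by_integrable_imp_integrable[OF assms(1) integrable_const_ivl])
  show "norm (f t) \<le> B" if "t \<in> {0..1}" for t using assms(2)[OF that] by simp
qed simp

end

locale compared_curve = magnetic_arc c l V \<zeta>\<^sub>0 z\<^sub>0 + horizontal_curve \<zeta> v z N L
  for c l V \<zeta>\<^sub>0 z\<^sub>0 and \<zeta> v :: "real \<Rightarrow> 'a::euclidean_space \<times> 'a" and z N L +
  assumes endpoints: "\<zeta> 0 = \<zeta>\<^sub>0 0" "\<zeta> 1 = \<zeta>\<^sub>0 1" "z 0 = z\<^sub>0 0" "z 1 = z\<^sub>0 1"
begin

text \<open>
  The arc is run along the clock \<open>\<sigma>\<close> with \<open>\<sigma>' = w\<close>, and the identity above is integrated. The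
  calibrating function \<open>S\<close> vanishes at both ends, as the two curves agree there. The freedom in
  \<open>w\<close> replaces a reparametrization of the competitor by arc length.
\<close>
lemma weighted_energy:
  assumes w: "continuous_on {0..1} w" "\<And>t. t \<in> {0..1} \<Longrightarrow> 0 < w t" "(w has_integral 1) {0..1}"
  defines "\<sigma> \<equiv> \<lambda>t. integral {0..t} w"
  defines "defect \<equiv> \<lambda>t. v t - w t *\<^sub>R V (\<sigma> t) - (w t * c) *\<^sub>R rot (\<zeta> t - \<zeta>\<^sub>0 (\<sigma> t))
      + (w t * riccati (\<sigma> t)) *\<^sub>R (\<zeta> t - \<zeta>\<^sub>0 (\<sigma> t))"
  shows "((\<lambda>t. (norm (v t))\<^sup>2 / w t - (norm (defect t))\<^sup>2 / w t) has_integral l\<^sup>2) {0..1}"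
proof -
  have \<sigma>_deriv: "(\<sigma> has_vector_derivative w t) (at t within {0..1})" if "t \<in> {0..1}" for t
    unfolding \<sigma>_def using w(1) that by (rule integral_has_vector_derivative)
  have \<sigma>0: "\<sigma> 0 = 0" by (simp add: \<sigma>_def)
  have \<sigma>1: "\<sigma> 1 = 1" using w(3) by (simp add: \<sigma>_def integral_unique)
  have \<sigma>_range: "\<sigma> t \<in> {0..1}" if "t \<in> {0..1}" for t
  proof -
    have i: "w integrable_on {0..s}" if "s \<in> {0..1}" for s
      using that by (intro integrable_continuous_real continuous_on_subset[OF w(1)]) auto
    have "0 \<le> \<sigma> t" unfolding \<sigma>_def using w(2) that by (intro integral_nonneg i) (auto intro: less_imp_le)
    moreover have "\<sigma> t \<le> \<sigma> 1" unfolding \<sigma>_def using w(2) that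
      by (intro integral_subset_le i) (auto intro: less_imp_le)
    ultimately show ?thesis using \<sigma>1 by simp
  qed
  have chain: "((\<lambda>t. F (\<sigma> t)) has_vector_derivative w t *\<^sub>R F') (at t within {0..1})"
    if "t \<in> {0..1}" "(F has_vector_derivative F') (at (\<sigma> t))" for F F' t
    using vector_diff_chain_within[OF \<sigma>_deriv[OF that(1)] has_vector_derivative_at_within[OF that(2)]]
    by (simp add: o_def)
  have cont\<sigma>: "continuous_on {0..1} \<sigma>"
    using has_vector_derivative_continuous[OF \<sigma>_deriv] by (simp add: continuous_on_eq_continuous_within)
  have contV: "continuous_on {0..1} (\<lambda>t. V (\<sigma> t))"
    using has_vector_derivative_continuous[OF chain[OF _ V_deriv]] by (simp add: continuous_on_eq_continuous_within)
  have cont\<zeta>\<^sub>0: "continuous_on {0..1} (\<lambda>t. \<zeta>\<^sub>0 (\<sigma> t))"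
    using has_vector_derivative_continuous[OF chain[OF _ \<zeta>\<^sub>0_deriv]] by (simp add: continuous_on_eq_continuous_within)
  have contR: "continuous_on {0..1} (\<lambda>t. riccati (\<sigma> t))"
    using \<sigma>_range by (intro continuous_on_compose2[OF continuous_riccati cont\<sigma>]) auto
  have lips: "lip (\<lambda>t. V (\<sigma> t))" "lip (\<lambda>t. \<zeta>\<^sub>0 (\<sigma> t))" "lip (\<lambda>t. z\<^sub>0 (\<sigma> t))" "lip (\<lambda>t. riccati (\<sigma> t))"
  proof -
    show "lip (\<lambda>t. V (\<sigma> t))"
      by (rule lip_C1[OF chain[OF _ V_deriv]]) (auto intro!: continuous_intros contV w(1))
    show "lip (\<lambda>t. \<zeta>\<^sub>0 (\<sigma> t))"
      by (rule lip_C1[OF chain[OF _ \<zeta>\<^sub>0_deriv]]) (auto intro!: continuous_intros contV w(1))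
    show "lip (\<lambda>t. z\<^sub>0 (\<sigma> t))"
      by (rule lip_C1[OF chain[OF _ z\<^sub>0_deriv]]) (auto intro!: continuous_intros contV cont\<zeta>\<^sub>0 w(1))
    show "lip (\<lambda>t. riccati (\<sigma> t))"
      by (rule lip_C1[OF chain[OF _ riccati_deriv[OF \<sigma>_range]]])
        (auto intro!: continuous_intros contR w(1))
  qed
  let ?\<eta> = "\<lambda>t. \<zeta> t - \<zeta>\<^sub>0 (\<sigma> t)"
  define S where "S t = 2 * inner (?\<eta> t) (V (\<sigma> t))
      + 2 * c * (2 * (z t - z\<^sub>0 (\<sigma> t)) - inner (rot (\<zeta>\<^sub>0 (\<sigma> t))) (?\<eta> t))
      - riccati (\<sigma> t) * inner (?\<eta> t) (?\<eta> t)" for t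
  have "lip S" unfolding S_def
    by (intro lip_add lip_diff lip_mult lip_inner lip_rot lips lip_\<zeta> lip_z lip_const)
  then obtain K where K: "K-lipschitz_on {0..1} S" by (auto simp: lip_def)
  have S_deriv: "(S has_vector_derivative ((norm (v t))\<^sup>2 / w t - (norm (defect t))\<^sup>2 / w t - w t * l\<^sup>2))
      (at t within {0..1})" if t: "t \<in> {0..1} - N" for t
  proof -
    have t1: "t \<in> {0..1}" using t by simp
    note d = chain[OF t1 V_deriv] chain[OF t1 \<zeta>\<^sub>0_deriv] chain[OF t1 z\<^sub>0_deriv]
      chain[OF t1 riccati_deriv[OF \<sigma>_range[OF t1]]]
    note d\<eta> = has_vector_derivative_diff[OF \<zeta>_deriv[OF t] d(2)]
    have d1: "((\<lambda>t. 2 * inner (?\<eta> t) (V (\<sigma> t))) has_vector_derivative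
       2 * (inner (?\<eta> t) (w t *\<^sub>R (2 * c) *\<^sub>R rot (V (\<sigma> t))) + inner (v t - w t *\<^sub>R V (\<sigma> t)) (V (\<sigma> t)))) (at t within {0..1})"
      by (rule has_vector_derivative_mult_right[OF inner_has_vector_derivative[OF d\<eta> d(1)]])
    have d2: "((\<lambda>t. 2 * c * (2 * (z t - z\<^sub>0 (\<sigma> t)) - inner (rot (\<zeta>\<^sub>0 (\<sigma> t))) (?\<eta> t))) has_vector_derivative
       2 * c * (2 * (inner (rot (\<zeta> t)) (v t) / 2 - w t *\<^sub>R (inner (rot (\<zeta>\<^sub>0 (\<sigma> t))) (V (\<sigma> t)) / 2))
         - (inner (rot (\<zeta>\<^sub>0 (\<sigma> t))) (v t - w t *\<^sub>R V (\<sigma> t)) + inner (rot (w t *\<^sub>R V (\<sigma> t))) (?\<eta> t)))) (at t within {0..1})"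
      by (intro has_vector_derivative_mult_right has_vector_derivative_diff inner_has_vector_derivative
          d\<eta> d rot_has_vector_derivative z_deriv[OF t])
    have d3: "((\<lambda>t. riccati (\<sigma> t) * inner (?\<eta> t) (?\<eta> t)) has_vector_derivative
       riccati (\<sigma> t) * (inner (?\<eta> t) (v t - w t *\<^sub>R V (\<sigma> t)) + inner (v t - w t *\<^sub>R V (\<sigma> t)) (?\<eta> t))
        + w t *\<^sub>R (c\<^sup>2 + (riccati (\<sigma> t))\<^sup>2) * inner (?\<eta> t) (?\<eta> t)) (at t within {0..1})"
      by (intro has_vector_derivative_mult inner_has_vector_derivative d\<eta> d)
    have wt: "w t \<noteq> 0" using w(2)[OF t1] by simp
    have z: "\<zeta>\<^sub>0 (\<sigma> t) + ?\<eta> t = \<zeta> t" by simp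
    show ?thesis
      unfolding S_def
      apply (rule has_vector_derivative_eq_rhs[OF has_vector_derivative_diff[OF has_vector_derivative_add[OF d1 d2] d3]])
      unfolding defect_def calibration_identity[OF wt, of "v t" "V (\<sigma> t)" c "?\<eta> t" "riccati (\<sigma> t)" "\<zeta>\<^sub>0 (\<sigma> t)"] z norm_V
      by (simp add: power2_norm_eq_inner inner_commute algebra_simps)
  qed
  have "S 0 = 0" "S 1 = 0" by (simp_all add: S_def \<sigma>0 \<sigma>1 endpoints)
  with lipschitz_fundamental_theorem[OF K negligible S_deriv]
  have "((\<lambda>t. (norm (v t))\<^sup>2 / w t - (norm (defect t))\<^sup>2 / w t - w t * l\<^sup>2) has_integral 0) {0..1}" by simp
  from has_integral_add[OF this has_integral_mult_left[OF w(3), of "l\<^sup>2"]] show ?thesis by simp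
qed

end


section \<open>Arcs are the unique shortest curves\<close>
lemma zero_integral_imp_negligible:
  fixes f :: "'a::euclidean_space \<Rightarrow> real"
  assumes int: "(f has_integral 0) S" and nonneg: "\<And>x. x \<in> S \<Longrightarrow> 0 \<le> f x"
  shows "negligible {x \<in> S. f x \<noteq> 0}"
proof -
  have "f integrable_on S" using int by blast
  then have abs: "f absolutely_integrable_on S" using nonneg by (intro nonnegative_absolutely_integrable_1)
  then have I: "integrable lebesgue (\<lambda>x. indicator S x *\<^sub>R f x)" by (simp add: set_integrable_def)
  have "integral\<^sup>L lebesgue (\<lambda>x. indicator S x *\<^sub>R f x) = 0"
    using set_lebesgue_integral_eq_integral(2)[OF abs] int by (simp add: set_lebesgue_integral_def integral_unique)
  moreover have "AE x in lebesgue. 0 \<le> indicator S x *\<^sub>R f x"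
    using nonneg by (auto simp: indicator_def)
  ultimately have "AE x in lebesgue. indicator S x *\<^sub>R f x = 0"
    using integral_nonneg_eq_0_iff_AE[OF I] by blast
  then obtain N where N: "{x \<in> space lebesgue. \<not> indicator S x *\<^sub>R f x = 0} \<subseteq> N" "N \<in> null_sets lebesgue"
    by (auto simp: eventually_ae_filter)
  have "{x \<in> S. f x \<noteq> 0} \<subseteq> N" using N(1) by (auto simp: indicator_def)
  then show ?thesis using N(2) by (auto simp: negligible_iff_null_sets[symmetric] intro: negligible_subset)
qed

context horizontal_curve
begin

lemma integral_limit:
  fixes f :: "nat \<Rightarrow> real \<Rightarrow> real"
  assumes meas: "\<And>k. f k \<in> borel_measurable (lebesgue_on {0..1})"
    and bound: "\<And>k t. t \<in> {0..1} \<Longrightarrow> \<bar>f k t\<bar> \<le> B"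
    and lim: "\<And>t. t \<in> {0..1} - N \<Longrightarrow> (\<lambda>k. f k t) \<longlonglongrightarrow> g t"
  shows "(\<lambda>k. integral {0..1} (f k)) \<longlonglongrightarrow> integral {0..1} g"
proof -
  have spike: "integral ({0..1} - N) h = integral {0..1} h" for h :: "real \<Rightarrow> real"
    by (rule integral_spike_set) (auto intro: negligible_subset[OF negligible])
  have "(\<lambda>k. integral ({0..1} - N) (f k)) \<longlonglongrightarrow> integral ({0..1} - N) g"
  proof (rule dominated_convergence(2))
    show "f k integrable_on {0..1} - N" for k
      by (rule integrable_spike_set[OF integrable_bounded[OF meas bound]])
        (auto intro: negligible_subset[OF negligible])
    show "(\<lambda>_. B) integrable_on {0..1} - N"
      by (rule integrable_spike_set[OF integrable_const_ivl])
        (auto intro: negligible_subset[OF negligible])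
  qed (use bound lim in auto)
  then show ?thesis unfolding spike .
qed

end

context compared_curve
begin

text \<open>
  With the weight \<open>w = (|v| + \<epsilon>) / \<integral>(|v| + \<epsilon>)\<close> the inequality \<open>l\<^sup>2 \<le> \<integral>|v|\<^sup>2 / w\<close> would give
  \<open>l\<^sup>2 \<le> (len + \<epsilon>) len\<close>. Weights have to be continuous, and \<open>|v|\<close> is only measurable. Therefore \<open>|v|\<close> is
  replaced by the norms of the difference quotients, which are continuous and converge to \<open>|v|\<close>
  boundedly and almost everywhere.
\<close>
theorem length_ge: "l \<le> integral {0..1} (\<lambda>t. norm (v t))"
proof -
  let ?M = "borel_measurable (lebesgue_on {0..1::real})"
  define len where "len = integral {0..1} (\<lambda>t. norm (v t))"
  have norm_v_meas: "(\<lambda>t. norm (v t)) \<in> ?M" using v_measurable by simp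
  have int_v: "(\<lambda>t. norm (v t)) integrable_on {0..1}"
    by (rule integrable_bounded[OF norm_v_meas]) (use norm_v_le in auto)
  have len_nonneg: "0 \<le> len" unfolding len_def by (intro integral_nonneg int_v) auto
  have L: "0 \<le> L" using lipschitz by (rule lipschitz_on_nonneg)
  have key: "l\<^sup>2 \<le> (len + \<epsilon>) * len" if \<epsilon>: "0 < \<epsilon>" for \<epsilon>
  proof -
    define w where "w k t = norm (diff_quot \<zeta> k t) + \<epsilon>" for k t
    define W where "W k = integral {0..1} (w k)" for k
    have cont: "continuous_on {0..1} (w k)" for k
      unfolding w_def by (intro continuous_intros continuous_on_diff_quot lip_continuous lip_\<zeta>)
    have w_meas: "w k \<in> ?M" for k
      using cont by (intro continuous_imp_measurable_on_sets_lebesgue) auto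
    have w_ge: "\<epsilon> \<le> w k t" for k t by (simp add: w_def)
    have w_pos: "0 < w k t" for k t using w_ge[of k t] \<epsilon> by linarith
    have w_le: "w k t \<le> L + \<epsilon>" if "t \<in> {0..1}" for k t
      using norm_diff_quot_le[OF lipschitz that] by (simp add: w_def)
    have w_int: "(w k has_integral W k) {0..1}" for k
      unfolding W_def using integrable_continuous_real[OF cont] by (rule integrable_integral)
    have "((\<lambda>_. \<epsilon>) has_integral \<epsilon>) {0..1::real}" using has_integral_const_real[of \<epsilon> 0 1] by simp
    then have "\<epsilon> \<le> W k" for k using w_int w_ge by (rule has_integral_le)
    then have W: "0 < W k" for k using \<epsilon> by (meson less_le_trans)
    have q_meas: "(\<lambda>t. (norm (v t))\<^sup>2 / w k t) \<in> ?M" for k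
      using norm_v_meas w_meas by (intro borel_measurable_divide borel_measurable_power)
    have q_bound: "\<bar>(norm (v t))\<^sup>2 / w k t\<bar> \<le> L\<^sup>2 / \<epsilon>" if "t \<in> {0..1}" for k t
      using norm_v_le[OF that] w_ge[of k t] w_pos[of k t] \<epsilon> L by (auto intro!: frac_le power_mono)
    have energy: "l\<^sup>2 \<le> W k * integral {0..1} (\<lambda>t. (norm (v t))\<^sup>2 / w k t)" for k
    proof -
      have "((\<lambda>t. w k t / W k) has_integral W k / W k) {0..1}"
        using w_int by (rule has_integral_divide)
      then have 1: "((\<lambda>t. w k t / W k) has_integral 1) {0..1}" using W[of k] by simp
      have 2: "continuous_on {0..1} (\<lambda>t. w k t / W k)"
        using W[of k] by (intro continuous_intros cont) auto
      have 3: "((\<lambda>t. W k * ((norm (v t))\<^sup>2 / w k t)) has_integral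
          W k * integral {0..1} (\<lambda>t. (norm (v t))\<^sup>2 / w k t)) {0..1}"
        by (intro has_integral_mult_right integrable_integral integrable_bounded[OF q_meas q_bound])
      show ?thesis
        by (rule has_integral_le[OF weighted_energy[OF 2 _ 1] 3])
          (use W[of k] w_pos[of k] in \<open>auto simp: field_simps less_imp_le\<close>)
    qed
    have w_lim: "(\<lambda>k. w k t) \<longlonglongrightarrow> norm (v t) + \<epsilon>" if "t \<in> {0..1} - N" for t
      unfolding w_def by (intro tendsto_intros diff_quot_tendsto_v that)
    have "W \<longlonglongrightarrow> integral {0..1} (\<lambda>t. norm (v t) + \<epsilon>)"
      unfolding W_def
    proof (rule integral_limit[OF w_meas _ w_lim])
      show "\<bar>w k t\<bar> \<le> L + \<epsilon>" if "t \<in> {0..1}" for k t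
        using w_le[OF that, of k] w_pos[of k t] by simp
    qed
    moreover have "integral {0..1} (\<lambda>t. norm (v t) + \<epsilon>) = len + \<epsilon>"
      unfolding len_def using integral_add[OF int_v integrable_const_ivl[of \<epsilon>]] by simp
    moreover have "(\<lambda>k. integral {0..1} (\<lambda>t. (norm (v t))\<^sup>2 / w k t)) \<longlonglongrightarrow>
        integral {0..1} (\<lambda>t. (norm (v t))\<^sup>2 / (norm (v t) + \<epsilon>))"
    proof (rule integral_limit[OF q_meas q_bound])
      fix t assume t: "t \<in> {0..1} - N"
      have "norm (v t) + \<epsilon> \<noteq> 0" using \<epsilon> norm_ge_zero[of "v t"] by linarith
      then show "(\<lambda>k. (norm (v t))\<^sup>2 / w k t) \<longlonglongrightarrow> (norm (v t))\<^sup>2 / (norm (v t) + \<epsilon>)"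
        by (intro tendsto_divide tendsto_const w_lim t)
    qed
    ultimately have "(\<lambda>k. W k * integral {0..1} (\<lambda>t. (norm (v t))\<^sup>2 / w k t)) \<longlonglongrightarrow>
        (len + \<epsilon>) * integral {0..1} (\<lambda>t. (norm (v t))\<^sup>2 / (norm (v t) + \<epsilon>))"
      by (intro tendsto_mult) auto
    then have "l\<^sup>2 \<le> (len + \<epsilon>) * integral {0..1} (\<lambda>t. (norm (v t))\<^sup>2 / (norm (v t) + \<epsilon>))"
      by (rule LIMSEQ_le_const) (use energy in blast)
    also have "\<dots> \<le> (len + \<epsilon>) * len"
    proof (rule mult_left_mono)
      have le: "(norm (v t))\<^sup>2 / (norm (v t) + \<epsilon>) \<le> norm (v t)" for t
      proof -
        have "0 < norm (v t) + \<epsilon>" using \<epsilon> norm_ge_zero[of "v t"] by linarith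
        then show ?thesis using \<epsilon> by (simp add: divide_le_eq power2_eq_square distrib_left)
      qed
      have "(\<lambda>t. (norm (v t))\<^sup>2 / (norm (v t) + \<epsilon>)) integrable_on {0..1}"
      proof (rule integrable_bounded)
        show "(\<lambda>t. (norm (v t))\<^sup>2 / (norm (v t) + \<epsilon>)) \<in> ?M"
          using norm_v_meas by (intro borel_measurable_divide borel_measurable_power borel_measurable_add) auto
        show "\<bar>(norm (v t))\<^sup>2 / (norm (v t) + \<epsilon>)\<bar> \<le> L" if "t \<in> {0..1}" for t
          using order_trans[OF le norm_v_le[OF that]] \<epsilon> by simp
      qed
      then show "integral {0..1} (\<lambda>t. (norm (v t))\<^sup>2 / (norm (v t) + \<epsilon>)) \<le> len"
        unfolding len_def by (intro integral_le int_v le)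
    qed (use len_nonneg \<epsilon> in simp)
    finally show ?thesis .
  qed
  have "l\<^sup>2 \<le> len * len + e" if "0 < e" for e
  proof -
    have "l\<^sup>2 \<le> (len + e / (len + 1)) * len"
      using that len_nonneg by (intro key) auto
    also have "\<dots> = len * len + e * (len / (len + 1))" by (simp add: algebra_simps)
    also have "\<dots> \<le> len * len + e * 1"
      using that len_nonneg by (intro add_left_mono mult_left_mono) auto
    finally show ?thesis by simp
  qed
  then have "l\<^sup>2 \<le> len\<^sup>2" unfolding power2_eq_square[of len] by (rule field_le_epsilon)
  then show ?thesis unfolding len_def[symmetric] using len_nonneg by (rule power2_le_imp_le)
qed

text \<open>
  With \<open>w = 1\<close> the square in the calibration integrates to \<open>l\<^sup>2 - l\<^sup>2 = 0\<close>, so almost everywhere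
  \<open>\<eta>' = c i \<eta> - T \<eta>\<close>. As \<open>i \<eta>\<close> is orthogonal to \<open>\<eta>\<close>, this makes \<open>|\<eta>|\<^sup>2 / cos\<^sup>2 (c (t - 1/2))\<close> constant, and
  it starts at \<open>0\<close>.
\<close>
theorem constant_speed_unique:
  assumes speed: "\<And>t. t \<in> {0..1} - N \<Longrightarrow> norm (v t) = l" and t: "t \<in> {0..1}"
  shows "\<zeta> t = \<zeta>\<^sub>0 t" "z t = z\<^sub>0 t"
proof -
  define \<eta> where "\<eta> t = \<zeta> t - \<zeta>\<^sub>0 t" for t
  define d where "d t = v t - V t - c *\<^sub>R rot (\<eta> t) + riccati t *\<^sub>R \<eta> t" for t
  have one: "((\<lambda>_. 1::real) has_integral 1) {0..1::real}" using has_integral_const_real[of "1::real" 0 1] by simp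
  have "((\<lambda>t. (norm (v t))\<^sup>2 - (norm (d t))\<^sup>2) has_integral l\<^sup>2) {0..1}"
    using weighted_energy[OF continuous_on_const _ one]
    by (rule has_integral_eq[rotated]) (auto simp: d_def \<eta>_def)
  moreover have "((\<lambda>t. (norm (v t))\<^sup>2) has_integral l\<^sup>2) {0..1}"
    by (rule has_integral_spike[OF negligible, where f = "\<lambda>_. l\<^sup>2"])
      (use speed has_integral_const_real[of "l\<^sup>2" 0 1] in auto)
  ultimately have "((\<lambda>t. (norm (v t))\<^sup>2 - ((norm (v t))\<^sup>2 - (norm (d t))\<^sup>2)) has_integral (l\<^sup>2 - l\<^sup>2)) {0..1}"
    by (intro has_integral_diff)
  then have "((\<lambda>t. (norm (d t))\<^sup>2) has_integral 0) {0..1}" by simp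
  then have "negligible {t \<in> {0..1}. (norm (d t))\<^sup>2 \<noteq> 0}"
    by (rule zero_integral_imp_negligible) simp
  then have N': "negligible (N \<union> {t \<in> {0..1}. d t \<noteq> 0})" (is "negligible ?N")
    using negligible by (intro negligible_Un) auto
  have \<zeta>\<^sub>0_within: "(\<zeta>\<^sub>0 has_vector_derivative V t) (at t within A)" for t A
    using \<zeta>\<^sub>0_deriv by (rule has_vector_derivative_at_within)
  have z\<^sub>0_within: "(z\<^sub>0 has_vector_derivative inner (rot (\<zeta>\<^sub>0 t)) (V t) / 2) (at t within A)" for t A
    using z\<^sub>0_deriv by (rule has_vector_derivative_at_within)
  have cont: "continuous_on A V" "continuous_on A \<zeta>\<^sub>0" for A
    using has_vector_derivative_continuous[OF V_deriv] has_vector_derivative_continuous[OF \<zeta>\<^sub>0_deriv]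
    by (auto intro!: continuous_at_imp_continuous_on)
  have lip\<eta>: "lip \<eta>" unfolding \<eta>_def
    by (intro lip_diff lip_\<zeta> lip_C1[OF \<zeta>\<^sub>0_within] cont)
  define g where "g t = 1 / (cos (c * (t - 1 / 2)))\<^sup>2" for t
  have g_deriv: "(g has_vector_derivative 2 * riccati t * g t) (at t within {0..1})" if "t \<in> {0..1}" for t
  proof -
    have "cos (c * (t - 1 / 2)) \<noteq> 0" using cos_pos[OF that] by simp
    then have "(g has_real_derivative 2 * riccati t * g t) (at t within {0..1})"
      unfolding g_def riccati_def tan_def
      by (auto intro!: derivative_eq_intros simp: field_simps power2_eq_square)
    then show ?thesis by (simp add: has_real_derivative_iff_has_vector_derivative)
  qed
  have contg: "continuous_on {0..1} g"
    using has_vector_derivative_continuous[OF g_deriv] by (simp add: continuous_on_eq_continuous_within)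
  have lipg: "lip g"
    by (rule lip_C1[OF g_deriv]) (auto intro!: continuous_intros contg continuous_riccati)
  define F where "F t = g t * inner (\<eta> t) (\<eta> t)" for t
  have F_deriv: "(F has_vector_derivative 0) (at t within {0..1})" if "t \<in> {0..1} - ?N" for t
  proof -
    have t: "t \<in> {0..1} - N" "t \<in> {0..1}" and d0: "d t = 0" using that by auto
    have \<eta>': "(\<eta> has_vector_derivative v t - V t) (at t within {0..1})"
      unfolding \<eta>_def by (intro has_vector_derivative_diff \<zeta>_deriv \<zeta>\<^sub>0_within t)
    have eq: "v t - V t = c *\<^sub>R rot (\<eta> t) - riccati t *\<^sub>R \<eta> t"
      using d0 by (simp add: d_def algebra_simps)
    have "(F has_vector_derivative g t * (inner (\<eta> t) (v t - V t) + inner (v t - V t) (\<eta> t))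
        + 2 * riccati t * g t * inner (\<eta> t) (\<eta> t)) (at t within {0..1})"
      unfolding F_def by (intro has_vector_derivative_mult inner_has_vector_derivative \<eta>' g_deriv t)
    then show ?thesis unfolding eq by (simp add: inner_simps)
  qed
  have "lip F" unfolding F_def by (intro lip_mult lip_inner lip\<eta> lipg)
  have \<zeta>_eq: "\<zeta> s = \<zeta>\<^sub>0 s" if s: "s \<in> {0..1}" for s
  proof -
    have "F s = F 0" by (rule lip_zero_derivative_imp_constant[OF \<open>lip F\<close> N' F_deriv s])
    then have "g s * inner (\<eta> s) (\<eta> s) = 0" by (simp add: F_def \<eta>_def endpoints)
    moreover have "g s \<noteq> 0" using cos_pos[OF s] by (simp add: g_def)
    ultimately show ?thesis by (simp add: \<eta>_def)
  qed
  show "\<zeta> t = \<zeta>\<^sub>0 t" by (rule \<zeta>_eq[OF t])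
  have "z t - z\<^sub>0 t = z 0 - z\<^sub>0 0"
  proof (rule lip_zero_derivative_imp_constant[OF _ N' _ t, of "\<lambda>t. z t - z\<^sub>0 t"])
    show "lip (\<lambda>t. z t - z\<^sub>0 t)"
      by (intro lip_diff lip_z lip_C1[OF z\<^sub>0_within]) (auto intro!: continuous_intros cont)
    fix t assume "t \<in> {0..1} - ?N"
    then have t: "t \<in> {0..1} - N" "t \<in> {0..1}" and d0: "d t = 0" by auto
    have "v t = V t" using d0 \<zeta>_eq[OF t(2)] by (simp add: d_def \<eta>_def)
    then show "((\<lambda>t. z t - z\<^sub>0 t) has_vector_derivative 0) (at t within {0..1})"
      using has_vector_derivative_diff[OF z_deriv[OF t(1)] z\<^sub>0_within] \<zeta>_eq[OF t(2)] by simp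
  qed
  then show "z t = z\<^sub>0 t" by (simp add: endpoints)
qed

end


section \<open>Geodesics of the Heisenberg group\<close>
definition hproj :: "'n::finite heis \<Rightarrow> (real ^ 'n) \<times> (real ^ 'n)" where
  "hproj p = (fst p, fst (snd p))"

definition hz :: "'n::finite heis \<Rightarrow> real" where
  "hz p = snd (snd p)"

definition hpoint :: "(real ^ 'n) \<times> (real ^ 'n) \<Rightarrow> real \<Rightarrow> 'n::finite heis" where
  "hpoint u w = (fst u, snd u, w)"

lemma hproj_hpoint [simp]: "hproj (hpoint u w) = u" and hz_hpoint [simp]: "hz (hpoint u w) = w"
  by (simp_all add: hproj_def hz_def hpoint_def)

lemma heis_eq_iff: "p = q \<longleftrightarrow> hproj p = hproj q \<and> hz p = hz q"
  by (auto simp: hproj_def hz_def prod_eq_iff)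

lemma hpoint_eta [simp]: "hpoint (hproj p) (hz p) = p" by (simp add: heis_eq_iff)

lemma hproj_simps [simp]: "hproj (p + q) = hproj p + hproj q" "hproj (c *\<^sub>R p) = c *\<^sub>R hproj p"
    "hproj v0 = 0" "hproj 0 = 0"
  and hz_simps [simp]: "hz (p + q) = hz p + hz q" "hz (c *\<^sub>R p) = c * hz p" "hz v0 = 1" "hz 0 = 0"
  by (simp_all add: hproj_def hz_def v0_def prod_eq_iff)

lemma bounded_linear_hproj: "bounded_linear hproj" and bounded_linear_hz: "bounded_linear hz"
  unfolding hproj_def[abs_def] hz_def[abs_def]
  by (intro bounded_linear_Pair bounded_linear_fst bounded_linear_snd_comp bounded_linear_fst_comp
      bounded_linear_compose[OF bounded_linear_fst bounded_linear_snd]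
      bounded_linear_compose[OF bounded_linear_snd bounded_linear_snd])+

lemma has_vector_derivative_hpoint:
  assumes "(f has_vector_derivative f') (at x within S)" "(g has_vector_derivative g') (at x within S)"
  shows "((\<lambda>t. hpoint (f t) (g t)) has_vector_derivative hpoint f' g') (at x within S)"
proof -
  have "bounded_linear (\<lambda>x::((real ^ 'a) \<times> (real ^ 'a)) \<times> real. hpoint (fst x) (snd x) :: 'a heis)"
    unfolding hpoint_def by (intro linear_conv_bounded_linear[THEN iffD1] linearI) auto
  from bounded_linear.has_vector_derivative[OF this has_vector_derivative_Pair[OF assms]]
  show ?thesis by simp
qed

lemma alpha0_eq: "alpha0 p v = hz v - inner (rot (hproj p)) (hproj v) / 2"
  by (simp add: alpha0_def hz_def hproj_def rot_def inner_prod_def inner_vec_def split_beta sum_negf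
      diff_divide_distrib sum_distrib_left mult.commute)

lemma heis_metric_horizontal:
  assumes "v \<in> heis_horizontal p" shows "sqrt (heis_metric p v v) = norm (hproj v)"
  using assms
  by (simp add: heis_metric_def heis_horizontal_def hproj_def norm_eq_sqrt_inner inner_prod_def inner_vec_def)

text \<open>
  Passage from the almost everywhere conditions of \<open>admissible\<close> to one explicit exceptional set. The
  property \<open>Q\<close> is a parameter because the constancy of the speed of a geodesic also has to be
  absorbed into that set.
\<close>
lemma admissible_curve_cases:
  fixes \<gamma> :: "real \<Rightarrow> 'n::finite heis"
  assumes adm: "admissible heis_horizontal \<gamma> p q"
    and Q: "AE t in lebesgue. t \<in> {0..1} \<longrightarrow> Q t"
  obtains v N L where "horizontal_curve (\<lambda>t. hproj (\<gamma> t)) v (\<lambda>t. hz (\<gamma> t)) N L"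
    "\<And>t. t \<in> {0..1} - N \<Longrightarrow> speed heis_metric \<gamma> t = norm (v t)"
    "curve_length heis_metric \<gamma> = integral {0..1} (\<lambda>t. norm (v t))"
    "\<And>t. t \<in> {0..1} - N \<Longrightarrow> Q t"
proof -
  have "lip \<gamma>" using adm by (auto simp: admissible_def lip_def)
  then have lips: "lip (\<lambda>t. hproj (\<gamma> t))" "lip (\<lambda>t. hz (\<gamma> t))"
    by (auto intro: lip_bounded_linear bounded_linear_hproj bounded_linear_hz)
  then obtain L where L: "L-lipschitz_on {0..1} (\<lambda>t. hproj (\<gamma> t))" by (auto simp: lip_def)
  let ?P = "\<lambda>t. t \<in> {0..1} \<longrightarrow> (\<gamma> differentiable (at t within {0..1}) \<and> velocity \<gamma> t \<in> heis_horizontal (\<gamma> t)) \<and> Q t"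
  have "AE t in lebesgue. ?P t" using adm Q unfolding admissible_def by (auto elim: AE_mp)
  then obtain N0 where N0: "{t \<in> space lebesgue. \<not> ?P t} \<subseteq> N0" "N0 \<in> null_sets lebesgue"
    unfolding eventually_ae_filter by blast
  define N where "N = insert 1 N0"
  define v where "v t = (if t \<in> N then 0 else hproj (velocity \<gamma> t))" for t
  have P: "\<gamma> differentiable (at t within {0..1})" "velocity \<gamma> t \<in> heis_horizontal (\<gamma> t)" "Q t"
    if "t \<in> {0..1} - N" for t
  proof -
    have "t \<notin> {t \<in> space lebesgue. \<not> ?P t}" using that N0(1) by (auto simp: N_def)
    then have "?P t" by simp
    then show "\<gamma> differentiable (at t within {0..1})" "velocity \<gamma> t \<in> heis_horizontal (\<gamma> t)" "Q t"
      using that by auto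
  qed
  have negl: "negligible N" using N0(2) by (simp add: N_def negligible_iff_null_sets)
  have der: "(\<gamma> has_vector_derivative velocity \<gamma> t) (at t within {0..1})" if "t \<in> {0..1} - N" for t
    using P(1)[OF that] unfolding velocity_def by (simp add: vector_derivative_works)
  have speed: "speed heis_metric \<gamma> t = norm (v t)" if "t \<in> {0..1} - N" for t
    using heis_metric_horizontal[OF P(2)[OF that]] that by (simp add: speed_def v_def)
  show ?thesis
  proof (rule that[of v N L])
    show "horizontal_curve (\<lambda>t. hproj (\<gamma> t)) v (\<lambda>t. hz (\<gamma> t)) N L"
    proof
      fix t assume t: "t \<in> {0..1} - N"
      show "((\<lambda>t. hproj (\<gamma> t)) has_vector_derivative v t) (at t within {0..1})"
        using bounded_linear.has_vector_derivative[OF bounded_linear_hproj der[OF t]] t by (simp add: v_def)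
      have "hz (velocity \<gamma> t) = inner (rot (hproj (\<gamma> t))) (v t) / 2"
        using P(2)[OF t] t by (simp add: heis_horizontal_def alpha0_eq v_def)
      then show "((\<lambda>t. hz (\<gamma> t)) has_vector_derivative inner (rot (hproj (\<gamma> t))) (v t) / 2) (at t within {0..1})"
        using bounded_linear.has_vector_derivative[OF bounded_linear_hz der[OF t]] by (simp only:)
    qed (use L lips negl in \<open>auto simp: N_def v_def\<close>)
    show "curve_length heis_metric \<gamma> = integral {0..1} (\<lambda>t. norm (v t))"
      unfolding curve_length_def by (rule integral_spike[OF negl]) (use speed in auto)
  qed (use speed P in auto)
qed

text \<open>
  In complex notation, \<open>circ_arc h \<theta> s\<close> is the integral of \<open>exp (i \<theta> r) h\<close> over \<open>0 \<le> r \<le> s\<close>. In the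
  imaginary part the case \<open>\<theta> = 0\<close> is covered by division by zero.
\<close>
definition circ_arc :: "'a::real_inner \<times> 'a \<Rightarrow> real \<Rightarrow> real \<Rightarrow> 'a \<times> 'a" where
  "circ_arc h \<theta> s = (if \<theta> = 0 then s else sin (\<theta> * s) / \<theta>) *\<^sub>R h + ((1 - cos (\<theta> * s)) / \<theta>) *\<^sub>R rot h"

definition arc_velocity :: "'a::real_inner \<times> 'a \<Rightarrow> real \<Rightarrow> real \<Rightarrow> 'a \<times> 'a" where
  "arc_velocity h \<theta> s = cos (\<theta> * s) *\<^sub>R h + sin (\<theta> * s) *\<^sub>R rot h"

definition arc_height :: "'a::real_inner \<times> 'a \<Rightarrow> real \<Rightarrow> real \<Rightarrow> real" where
  "arc_height h \<theta> s = (norm h)\<^sup>2 * ((\<theta> * s - sin (\<theta> * s)) / (2 * \<theta>\<^sup>2))"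

lemma norm_rotation_combination: "(norm (a *\<^sub>R h + b *\<^sub>R rot h))\<^sup>2 = (a\<^sup>2 + b\<^sup>2) * (norm h)\<^sup>2"
  unfolding power2_norm_eq_inner by (simp add: inner_simps power2_eq_square[of a] power2_eq_square[of b] algebra_simps)

lemma norm_arc_velocity: "norm (arc_velocity h \<theta> s) = norm h"
proof -
  have "(norm (arc_velocity h \<theta> s))\<^sup>2 = (norm h)\<^sup>2"
    unfolding arc_velocity_def norm_rotation_combination by simp
  then show ?thesis by simp
qed

lemma arc_deriv: "(circ_arc h \<theta> has_vector_derivative arc_velocity h \<theta> s) (at s)"
proof -
  have 1: "((\<lambda>s. if \<theta> = 0 then s else sin (\<theta> * s) / \<theta>) has_real_derivative cos (\<theta> * s)) (at s)"
    by (cases "\<theta> = 0") (auto intro!: derivative_eq_intros)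
  have 2: "((\<lambda>s. (1 - cos (\<theta> * s)) / \<theta>) has_real_derivative sin (\<theta> * s)) (at s)"
    by (cases "\<theta> = 0") (auto intro!: derivative_eq_intros)
  show ?thesis unfolding circ_arc_def[abs_def] arc_velocity_def
    using has_vector_derivative_add[OF has_vector_derivative_scaleR[OF 1 has_vector_derivative_const]
        has_vector_derivative_scaleR[OF 2 has_vector_derivative_const]] by simp
qed

lemma arc_velocity_deriv: "(arc_velocity h \<theta> has_vector_derivative \<theta> *\<^sub>R rot (arc_velocity h \<theta> s)) (at s)"
proof -
  have 1: "((\<lambda>s. cos (\<theta> * s)) has_real_derivative - \<theta> * sin (\<theta> * s)) (at s)"
    by (auto intro!: derivative_eq_intros)
  have 2: "((\<lambda>s. sin (\<theta> * s)) has_real_derivative \<theta> * cos (\<theta> * s)) (at s)"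
    by (auto intro!: derivative_eq_intros)
  show ?thesis unfolding arc_velocity_def[abs_def]
    using has_vector_derivative_add[OF has_vector_derivative_scaleR[OF 1 has_vector_derivative_const]
        has_vector_derivative_scaleR[OF 2 has_vector_derivative_const], of h "rot h"]
    by (simp add: rot_add rot_scaleR scaleR_diff_right)
qed

lemma arc_height_deriv:
  "(arc_height h \<theta> has_vector_derivative inner (rot (circ_arc h \<theta> s)) (arc_velocity h \<theta> s) / 2) (at s)"
proof (cases "\<theta> = 0")
  case True
  then show ?thesis by (simp add: arc_height_def[abs_def] circ_arc_def arc_velocity_def rot_scaleR)
next
  case False
  have *: "inner (rot (circ_arc h \<theta> s)) (arc_velocity h \<theta> s) = (norm h)\<^sup>2 * ((1 - cos (\<theta> * s)) / \<theta>)"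
  proof -
    have "inner (rot (circ_arc h \<theta> s)) (arc_velocity h \<theta> s)
      = (norm h)\<^sup>2 * ((sin (\<theta> * s) * sin (\<theta> * s) - (1 - cos (\<theta> * s)) * cos (\<theta> * s)) / \<theta>)"
      using False unfolding circ_arc_def arc_velocity_def power2_norm_eq_inner
      by (simp add: rot_add rot_scaleR rot_minus inner_simps)
        (simp add: field_simps, simp add: distrib_left[symmetric] sin_cos_squared_add3)
    also have "sin (\<theta> * s) * sin (\<theta> * s) - (1 - cos (\<theta> * s)) * cos (\<theta> * s) = 1 - cos (\<theta> * s)"
      using sin_cos_squared_add[of "\<theta> * s"] by (simp add: power2_eq_square algebra_simps)
    finally show ?thesis .
  qed
  have "(arc_height h \<theta> has_real_derivative (norm h)\<^sup>2 * ((\<theta> - \<theta> * cos (\<theta> * s)) / (2 * \<theta>\<^sup>2))) (at s)"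
  proof -
    have "((\<lambda>s. \<theta> * s - sin (\<theta> * s)) has_real_derivative \<theta> - \<theta> * cos (\<theta> * s)) (at s)"
      by (auto intro!: derivative_eq_intros)
    from DERIV_cmult[OF DERIV_cdivide[OF this, of "2 * \<theta>\<^sup>2"], of "(norm h)\<^sup>2"]
    show ?thesis by (simp add: arc_height_def[abs_def])
  qed
  also have "(norm h)\<^sup>2 * ((\<theta> - \<theta> * cos (\<theta> * s)) / (2 * \<theta>\<^sup>2)) = inner (rot (circ_arc h \<theta> s)) (arc_velocity h \<theta> s) / 2"
    unfolding * using False by (simp add: power2_eq_square[of \<theta>] field_simps)
  finally show ?thesis by (simp add: has_real_derivative_iff_has_vector_derivative)
qed

text \<open>
  The geodesic from \<open>x\<^sub>0\<close> with covector \<open>p = (h, \<theta>)\<close>: the lifted arc from the origin, moved to \<open>x\<^sub>0\<close> by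
  left translation in the group. Covectors are stored as points of the same space, so that
  contraction becomes scalar multiplication of \<open>p\<close>.
\<close>
definition geo :: "'n::finite heis \<Rightarrow> 'n heis \<Rightarrow> real \<Rightarrow> 'n heis" where
  "geo x\<^sub>0 p s = hpoint (hproj x\<^sub>0 + circ_arc (hproj p) (hz p) s)
     (hz x\<^sub>0 + arc_height (hproj p) (hz p) s + inner (rot (hproj x\<^sub>0)) (circ_arc (hproj p) (hz p) s) / 2)"

lemma geo_0: "geo x\<^sub>0 p 0 = x\<^sub>0"
  by (simp add: geo_def circ_arc_def arc_height_def)

lemma geo_scale: "geo x\<^sub>0 (s *\<^sub>R p) 1 = geo x\<^sub>0 p s"
proof -
  have 1: "circ_arc (s *\<^sub>R h) (s * \<theta>) 1 = circ_arc h \<theta> s" for h :: "(real ^ 'a) \<times> (real ^ 'a)" and \<theta>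
    by (simp add: circ_arc_def rot_scaleR mult.commute)
  have 2: "arc_height (s *\<^sub>R h) (s * \<theta>) 1 = arc_height h \<theta> s" for h :: "(real ^ 'a) \<times> (real ^ 'a)" and \<theta>
    by (cases "s = 0") (simp_all add: arc_height_def power_mult_distrib mult.commute)
  show ?thesis unfolding geo_def hproj_simps hz_simps 1 2 ..
qed

text \<open>
  Minimizers run towards \<open>x\<^sub>0\<close>, whereas \<open>geo\<close> starts there. Reversing time turns angular velocity
  \<open>\<theta>\<close> into \<open>-\<theta>\<close>, which explains the parameter \<open>- hz p / 2\<close> of the arc below.
\<close>
locale heis_geodesic =
  fixes x\<^sub>0 p :: "'n::finite heis"
  assumes range: "\<bar>hz p\<bar> < 2 * pi"
begin

abbreviation "endpoint \<equiv> geo x\<^sub>0 p 1"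
abbreviation "geod \<equiv> \<lambda>t. geo x\<^sub>0 p (1 - t)"
abbreviation "path_velocity \<equiv> \<lambda>t. - arc_velocity (hproj p) (hz p) (1 - t)"

lemma backwards: "(F has_vector_derivative F') (at (1 - t)) \<Longrightarrow>
    ((\<lambda>t. F (1 - t)) has_vector_derivative - F') (at (t::real))"
proof -
  assume F: "(F has_vector_derivative F') (at (1 - t))"
  have "((\<lambda>t. 1 - t) has_vector_derivative - 1) (at t)"
    by (auto intro!: derivative_eq_intros)
  from vector_diff_chain_at[OF this F] show "((\<lambda>t. F (1 - t)) has_vector_derivative - F') (at t)"
    by (simp add: o_def)
qed

lemma path_hproj_deriv: "((\<lambda>t. hproj (geod t)) has_vector_derivative path_velocity t) (at t)"
  unfolding geo_def hproj_hpoint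
  by (rule has_vector_derivative_eq_rhs[OF has_vector_derivative_add[OF has_vector_derivative_const backwards[OF arc_deriv]]]) simp

lemma path_hz_deriv:
  "((\<lambda>t. hz (geod t)) has_vector_derivative inner (rot (hproj (geod t))) (path_velocity t) / 2) (at t)"
proof -
  let ?a = "rot (hproj x\<^sub>0)" and ?f = "circ_arc (hproj p) (hz p)"
  have "((\<lambda>t. inner ?a (?f (1 - t))) has_vector_derivative inner ?a (path_velocity t)) (at t)"
    by (rule bounded_linear.has_vector_derivative[OF bounded_linear_inner_right backwards[OF arc_deriv]])
  from has_vector_derivative_add[OF has_vector_derivative_add[OF has_vector_derivative_const[of "hz x\<^sub>0"] backwards[OF arc_height_deriv[of "hproj p" "hz p"]]]
     has_vector_derivative_divide[OF this, of 2]]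
  show ?thesis
    unfolding geo_def hz_hpoint hproj_hpoint
    by (rule has_vector_derivative_eq_rhs) (simp add: rot_add inner_simps field_simps)
qed

sublocale magnetic_arc "- hz p / 2" "norm (hproj p)" path_velocity "\<lambda>t. hproj (geod t)" "\<lambda>t. hz (geod t)"
proof
  show "\<bar>- hz p / 2\<bar> < pi" using range by simp
  show "(path_velocity has_vector_derivative (2 * (- hz p / 2)) *\<^sub>R rot (path_velocity s)) (at s)" for s
    using has_vector_derivative_minus[OF backwards[OF arc_velocity_deriv[of "hproj p" "hz p"]]]
    by (simp add: rot_minus)
qed (simp_all only: norm_arc_velocity norm_minus_cancel path_hproj_deriv path_hz_deriv norm_ge_zero)

lemma path_deriv:
  "(geod has_vector_derivative hpoint (path_velocity t) (inner (rot (hproj (geod t))) (path_velocity t) / 2)) (at t)"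
  using has_vector_derivative_hpoint[OF path_hproj_deriv path_hz_deriv, of t] by simp

lemma velocity_path:
  assumes "t \<in> {0..1}"
  shows "velocity geod t = hpoint (path_velocity t) (inner (rot (hproj (geod t))) (path_velocity t) / 2)"
  unfolding velocity_def
  by (rule vector_derivative_within_closed_interval[OF _ assms has_vector_derivative_at_within[OF path_deriv]]) simp

lemma path_horizontal:
  assumes "t \<in> {0..1}" shows "velocity geod t \<in> heis_horizontal (geod t)"
  unfolding velocity_path[OF assms] by (simp add: heis_horizontal_def alpha0_eq)

lemma path_speed: assumes "t \<in> {0..1}" shows "speed heis_metric geod t = norm (hproj p)"
  unfolding speed_def heis_metric_horizontal[OF path_horizontal[OF assms]]
  unfolding velocity_path[OF assms] by (simp add: norm_arc_velocity)

lemma path_admissible: "admissible heis_horizontal geod endpoint x\<^sub>0"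
proof -
  have "lip geod"
  proof (rule lip_C1[OF has_vector_derivative_at_within[OF path_deriv]])
    have 1: "continuous_on {0..1} path_velocity"
      using has_vector_derivative_continuous[OF V_deriv] by (intro continuous_at_imp_continuous_on) auto
    have 2: "continuous_on {0..1} (\<lambda>t. hproj (geod t))"
      using has_vector_derivative_continuous[OF path_hproj_deriv] by (intro continuous_at_imp_continuous_on) auto
    show "continuous_on {0..1} (\<lambda>t. hpoint (path_velocity t) (inner (rot (hproj (geod t))) (path_velocity t) / 2))"
      unfolding hpoint_def using continuous_on_minus[OF 1] 2 by (intro continuous_intros) auto
  qed
  moreover have "geod differentiable (at t within {0..1})" for t
    using has_vector_derivative_at_within[OF path_deriv] by (auto simp: differentiable_def has_vector_derivative_def)
  ultimately show ?thesis
    unfolding admissible_def lip_def using path_horizontal by (auto simp: geo_0)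
qed

lemma path_length: "curve_length heis_metric geod = norm (hproj p)"
proof -
  have "curve_length heis_metric geod = integral {0..1::real} (\<lambda>_. norm (hproj p))"
    unfolding curve_length_def by (rule integral_cong) (rule path_speed)
  then show ?thesis by simp
qed

lemma compared_curveI:
  assumes "admissible heis_horizontal \<gamma> endpoint x\<^sub>0"
    and "horizontal_curve (\<lambda>t. hproj (\<gamma> t)) v (\<lambda>t. hz (\<gamma> t)) N L"
  shows "compared_curve (- hz p / 2) (norm (hproj p)) path_velocity (\<lambda>t. hproj (geod t)) (\<lambda>t. hz (geod t))
     (\<lambda>t. hproj (\<gamma> t)) v (\<lambda>t. hz (\<gamma> t)) N L"
proof -
  interpret horizontal_curve "\<lambda>t. hproj (\<gamma> t)" v "\<lambda>t. hz (\<gamma> t)" N L by fact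
  show ?thesis by unfold_locales (use assms(1) in \<open>auto simp: admissible_def geo_0\<close>)
qed

lemma curve_length_ge:
  assumes adm: "admissible heis_horizontal \<gamma> endpoint x\<^sub>0"
  shows "norm (hproj p) \<le> curve_length heis_metric \<gamma>"
proof -
  obtain v N L where H: "horizontal_curve (\<lambda>t. hproj (\<gamma> t)) v (\<lambda>t. hz (\<gamma> t)) N L"
    "curve_length heis_metric \<gamma> = integral {0..1} (\<lambda>t. norm (v t))"
    by (rule admissible_curve_cases[OF adm, of "\<lambda>_. True"]) auto
  show ?thesis using compared_curve.length_ge[OF compared_curveI[OF adm H(1)]] H(2) by simp
qed

lemma dist_endpoint: "d_CC endpoint x\<^sub>0 = norm (hproj p)"
proof (rule antisym)
  show "d_CC endpoint x\<^sub>0 \<le> norm (hproj p)"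
    unfolding cc_dist_def path_length[symmetric]
    by (rule cINF_lower) (use curve_length_ge path_admissible in \<open>auto intro!: bdd_belowI2\<close>)
  show "norm (hproj p) \<le> d_CC endpoint x\<^sub>0"
    unfolding cc_dist_def
    by (rule cINF_greatest) (use curve_length_ge path_admissible in auto)
qed

lemma path_minimizing: "minimizing_geodesic heis_horizontal heis_metric geod endpoint x\<^sub>0"
  unfolding minimizing_geodesic_def
  using path_admissible path_length dist_endpoint path_speed by auto

lemma path_unique:
  assumes min: "minimizing_geodesic heis_horizontal heis_metric \<gamma> endpoint x\<^sub>0" and t: "t \<in> {0..1}"
  shows "\<gamma> t = geod t"
proof -
  from min obtain k where adm: "admissible heis_horizontal \<gamma> endpoint x\<^sub>0"
    and len: "curve_length heis_metric \<gamma> = norm (hproj p)"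
    and k: "AE t in lebesgue. t \<in> {0..1} \<longrightarrow> speed heis_metric \<gamma> t = k"
    unfolding minimizing_geodesic_def dist_endpoint by auto
  obtain v N L where H: "horizontal_curve (\<lambda>t. hproj (\<gamma> t)) v (\<lambda>t. hz (\<gamma> t)) N L"
    and speed: "\<And>t. t \<in> {0..1} - N \<Longrightarrow> speed heis_metric \<gamma> t = norm (v t)"
    and length: "curve_length heis_metric \<gamma> = integral {0..1} (\<lambda>t. norm (v t))"
    and const: "\<And>t. t \<in> {0..1} - N \<Longrightarrow> speed heis_metric \<gamma> t = k"
    using admissible_curve_cases[OF adm k] by metis
  have "integral {0..1} (\<lambda>t. norm (v t)) = integral {0..1::real} (\<lambda>_. k)"
    by (rule integral_spike[OF horizontal_curve.negligible[OF H]]) (use speed const in auto)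
  then have "k = norm (hproj p)" using len length by simp
  then have n: "norm (v t) = norm (hproj p)" if "t \<in> {0..1} - N" for t
    using speed[OF that] const[OF that] by simp
  show ?thesis
    unfolding heis_eq_iff
    using compared_curve.constant_speed_unique[OF compared_curveI[OF adm H] n t] by auto
qed

lemma endpoint_in_dom: "endpoint \<in> contraction_dom heis_horizontal heis_metric x\<^sub>0"
proof -
  have "\<gamma> t = \<gamma>' t" if "minimizing_geodesic heis_horizontal heis_metric \<gamma> endpoint x\<^sub>0 \<and>
      minimizing_geodesic heis_horizontal heis_metric \<gamma>' endpoint x\<^sub>0" "t \<in> {0..1}" for \<gamma> \<gamma>' t
    using path_unique[OF conjunct1[OF that(1)] that(2)] path_unique[OF conjunct2[OF that(1)] that(2)]
    by (rule trans[OF _ sym])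
  then show ?thesis
    unfolding contraction_dom_def using path_minimizing by blast
qed

lemma contraction_endpoint:
  assumes "t \<in> {0..1}"
  shows "contraction heis_horizontal heis_metric x\<^sub>0 t endpoint = geo x\<^sub>0 p (1 - t)"
  unfolding contraction_def
  using path_unique[OF someI[of "\<lambda>\<gamma>. minimizing_geodesic heis_horizontal heis_metric \<gamma> endpoint x\<^sub>0", OF path_minimizing] assms] .

end


section \<open>The inverse of the exponential map\<close>

text \<open>Real and imaginary part of \<open>(exp (i \<theta>) - 1) / (i \<theta>)\<close>, the quotient of chord and initial velocity.\<close>
definition chord_re :: "real \<Rightarrow> real" where
  "chord_re \<theta> = (if \<theta> = 0 then 1 else sin \<theta> / \<theta>)"

definition chord_im :: "real \<Rightarrow> real" where
  "chord_im \<theta> = (1 - cos \<theta>) / \<theta>"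

lemma circ_arc_1: "circ_arc h \<theta> 1 = chord_re \<theta> *\<^sub>R h + chord_im \<theta> *\<^sub>R rot h"
  by (simp add: circ_arc_def chord_re_def chord_im_def)

lemma chord_sum_squares: "(chord_re \<theta>)\<^sup>2 + (chord_im \<theta>)\<^sup>2 = (hsinc \<theta>)\<^sup>2"
proof (cases "\<theta> = 0")
  case False
  have "(sin \<theta>)\<^sup>2 + (1 - cos \<theta>)\<^sup>2 = 2 - 2 * cos \<theta>"
    using sin_cos_squared_add[of \<theta>] by (simp add: power2_diff)
  also have "\<dots> = 4 * (sin (\<theta> / 2))\<^sup>2" using cos_double_sin[of "\<theta> / 2"] by simp
  finally have "(chord_re \<theta>)\<^sup>2 + (chord_im \<theta>)\<^sup>2 = 4 * (sin (\<theta> / 2))\<^sup>2 / \<theta>\<^sup>2"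
    using False by (simp add: chord_re_def chord_im_def power_divide add_divide_distrib[symmetric])
  then show ?thesis using False by (simp add: hsinc_def power_divide)
qed (simp add: chord_re_def chord_im_def hsinc_def)

lemma norm_circ_arc: "(norm (circ_arc h \<theta> 1))\<^sup>2 = (hsinc \<theta>)\<^sup>2 * (norm h)\<^sup>2"
  unfolding circ_arc_1 norm_rotation_combination chord_sum_squares ..

lemma arc_height_1:
  assumes "\<bar>\<theta>\<bar> < 2 * pi"
  shows "arc_height h \<theta> 1 = (norm (circ_arc h \<theta> 1))\<^sup>2 * height \<theta>"
proof (cases "\<theta> = 0")
  case False
  then show ?thesis
    using sin_half_nonzero[OF False assms] unfolding norm_circ_arc
    by (simp add: arc_height_def height_def hsinc_def power_divide)
qed (simp add: arc_height_def)

text \<open>The coordinates of \<open>x\<close> after the left translation that moves \<open>x\<^sub>0\<close> to the origin.\<close>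
definition rel_chord :: "'n::finite heis \<Rightarrow> 'n heis \<Rightarrow> (real ^ 'n) \<times> (real ^ 'n)" where
  "rel_chord x\<^sub>0 x = hproj x - hproj x\<^sub>0"

definition rel_height :: "'n::finite heis \<Rightarrow> 'n heis \<Rightarrow> real" where
  "rel_height x\<^sub>0 x = hz x - hz x\<^sub>0 - inner (rot (hproj x\<^sub>0)) (hproj x - hproj x\<^sub>0) / 2"

text \<open>
  The angle is recovered from the ratio of height and squared chord, and the initial velocity from
  the chord by complex division, as \<open>chord_re\<^sup>2 + chord_im\<^sup>2 = hsinc\<^sup>2\<close>. The result is
  meaningful off the vertical line through \<open>x\<^sub>0\<close>.
\<close>
definition heis_log :: "'n::finite heis \<Rightarrow> 'n heis \<Rightarrow> 'n heis" where
  "heis_log x\<^sub>0 x = (let u = rel_chord x\<^sub>0 x; \<theta> = angle (rel_height x\<^sub>0 x / (norm u)\<^sup>2) in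
     hpoint (inverse ((hsinc \<theta>)\<^sup>2) *\<^sub>R (chord_re \<theta> *\<^sub>R u - chord_im \<theta> *\<^sub>R rot u)) \<theta>)"

lemma rel_geo: "rel_chord x\<^sub>0 (geo x\<^sub>0 p s) = circ_arc (hproj p) (hz p) s"
    "rel_height x\<^sub>0 (geo x\<^sub>0 p s) = arc_height (hproj p) (hz p) s"
  by (simp_all add: rel_chord_def rel_height_def geo_def)

lemma rel_eqD: "rel_chord x\<^sub>0 x = rel_chord x\<^sub>0 y \<Longrightarrow> rel_height x\<^sub>0 x = rel_height x\<^sub>0 y \<Longrightarrow> x = y"
  by (auto simp: rel_chord_def rel_height_def heis_eq_iff)

lemma hz_heis_log: "hz (heis_log x\<^sub>0 x) = angle (rel_height x\<^sub>0 x / (norm (rel_chord x\<^sub>0 x))\<^sup>2)"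
  by (simp add: heis_log_def Let_def)

lemma abs_hz_heis_log: "\<bar>hz (heis_log x\<^sub>0 x)\<bar> < 2 * pi"
  unfolding hz_heis_log by (rule abs_angle)

lemma complex_inverse:
  assumes "a\<^sup>2 + b\<^sup>2 \<noteq> 0"
  shows "a *\<^sub>R (inverse (a\<^sup>2 + b\<^sup>2) *\<^sub>R (a *\<^sub>R u - b *\<^sub>R rot u)) + b *\<^sub>R rot (inverse (a\<^sup>2 + b\<^sup>2) *\<^sub>R (a *\<^sub>R u - b *\<^sub>R rot u)) = u"
    "inverse (a\<^sup>2 + b\<^sup>2) *\<^sub>R (a *\<^sub>R (a *\<^sub>R h + b *\<^sub>R rot h) - b *\<^sub>R rot (a *\<^sub>R h + b *\<^sub>R rot h)) = h"
proof -
  have *: "a * (inverse (a\<^sup>2 + b\<^sup>2) * a) + b * (inverse (a\<^sup>2 + b\<^sup>2) * b) = 1"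
  proof -
    have "a * (i * a) + b * (i * b) = i * (a\<^sup>2 + b\<^sup>2)" for i
      by (simp add: power2_eq_square algebra_simps)
    then show ?thesis using assms by simp
  qed
  have "a *\<^sub>R (inverse (a\<^sup>2 + b\<^sup>2) *\<^sub>R (a *\<^sub>R u - b *\<^sub>R rot u)) + b *\<^sub>R rot (inverse (a\<^sup>2 + b\<^sup>2) *\<^sub>R (a *\<^sub>R u - b *\<^sub>R rot u))
     = (a * (inverse (a\<^sup>2 + b\<^sup>2) * a) + b * (inverse (a\<^sup>2 + b\<^sup>2) * b)) *\<^sub>R u"
    by (simp add: rot_scaleR rot_diff scaleR_diff_right scaleR_add_right scaleR_add_left mult_ac)
  then show "a *\<^sub>R (inverse (a\<^sup>2 + b\<^sup>2) *\<^sub>R (a *\<^sub>R u - b *\<^sub>R rot u)) + b *\<^sub>R rot (inverse (a\<^sup>2 + b\<^sup>2) *\<^sub>R (a *\<^sub>R u - b *\<^sub>R rot u)) = u"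
    unfolding * by simp
  have "inverse (a\<^sup>2 + b\<^sup>2) *\<^sub>R (a *\<^sub>R (a *\<^sub>R h + b *\<^sub>R rot h) - b *\<^sub>R rot (a *\<^sub>R h + b *\<^sub>R rot h))
     = (a * (inverse (a\<^sup>2 + b\<^sup>2) * a) + b * (inverse (a\<^sup>2 + b\<^sup>2) * b)) *\<^sub>R h"
    by (simp add: rot_scaleR rot_add scaleR_diff_right scaleR_add_left scaleR_add_right mult_ac)
  then show "inverse (a\<^sup>2 + b\<^sup>2) *\<^sub>R (a *\<^sub>R (a *\<^sub>R h + b *\<^sub>R rot h) - b *\<^sub>R rot (a *\<^sub>R h + b *\<^sub>R rot h)) = h"
    unfolding * by simp
qed

lemma hproj_heis_log:
  assumes "\<theta> = hz (heis_log x\<^sub>0 x)"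
  shows "hproj (heis_log x\<^sub>0 x) = inverse ((chord_re \<theta>)\<^sup>2 + (chord_im \<theta>)\<^sup>2) *\<^sub>R
      (chord_re \<theta> *\<^sub>R rel_chord x\<^sub>0 x - chord_im \<theta> *\<^sub>R rot (rel_chord x\<^sub>0 x))"
  unfolding chord_sum_squares assms hz_heis_log by (simp add: heis_log_def Let_def)

lemma geo_heis_log:
  assumes "hproj x \<noteq> hproj x\<^sub>0"
  shows "geo x\<^sub>0 (heis_log x\<^sub>0 x) 1 = x"
proof (rule rel_eqD[of x\<^sub>0])
  let ?\<theta> = "hz (heis_log x\<^sub>0 x)" and ?u = "rel_chord x\<^sub>0 x"
  have nz: "(chord_re ?\<theta>)\<^sup>2 + (chord_im ?\<theta>)\<^sup>2 \<noteq> 0"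
    using hsinc_pos[OF abs_hz_heis_log, of x\<^sub>0 x] by (simp add: chord_sum_squares)
  have arc: "circ_arc (hproj (heis_log x\<^sub>0 x)) ?\<theta> 1 = ?u"
    unfolding circ_arc_1 hproj_heis_log[OF refl] by (rule complex_inverse(1)[OF nz])
  then show "rel_chord x\<^sub>0 (geo x\<^sub>0 (heis_log x\<^sub>0 x) 1) = ?u" by (simp only: rel_geo)
  have "?u \<noteq> 0" using assms by (simp add: rel_chord_def)
  then show "rel_height x\<^sub>0 (geo x\<^sub>0 (heis_log x\<^sub>0 x) 1) = rel_height x\<^sub>0 x"
    unfolding rel_geo arc_height_1[OF abs_hz_heis_log] arc
    unfolding hz_heis_log height_angle by simp
qed

lemma hproj_geo_eq_iff:
  assumes "\<bar>hz p\<bar> < 2 * pi" shows "hproj (geo x\<^sub>0 p 1) = hproj x\<^sub>0 \<longleftrightarrow> hproj p = 0"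
proof -
  have "hproj (geo x\<^sub>0 p 1) = hproj x\<^sub>0 \<longleftrightarrow> rel_chord x\<^sub>0 (geo x\<^sub>0 p 1) = 0"
    by (auto simp: rel_chord_def)
  also have "\<dots> \<longleftrightarrow> (norm (circ_arc (hproj p) (hz p) 1))\<^sup>2 = 0" by (simp add: rel_geo)
  also have "\<dots> \<longleftrightarrow> hproj p = 0"
    unfolding norm_circ_arc using hsinc_pos[OF assms] by simp
  finally show ?thesis .
qed

lemma heis_log_geo:
  assumes "\<bar>hz p\<bar> < 2 * pi" "hproj p \<noteq> 0"
  shows "heis_log x\<^sub>0 (geo x\<^sub>0 p 1) = p"
proof -
  have nz: "norm (circ_arc (hproj p) (hz p) 1) \<noteq> 0"
    using hproj_geo_eq_iff[OF assms(1), of x\<^sub>0] assms(2) rel_geo(1)[of x\<^sub>0 p 1] by (auto simp: rel_chord_def)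
  have \<theta>: "hz (heis_log x\<^sub>0 (geo x\<^sub>0 p 1)) = hz p"
    unfolding hz_heis_log rel_geo arc_height_1[OF assms(1)] using nz by (simp add: angle_height assms(1))
  have nz2: "(chord_re (hz p))\<^sup>2 + (chord_im (hz p))\<^sup>2 \<noteq> 0"
    using hsinc_pos[OF assms(1)] by (simp add: chord_sum_squares)
  have "hproj (heis_log x\<^sub>0 (geo x\<^sub>0 p 1)) = hproj p"
    unfolding hproj_heis_log[OF \<theta>[symmetric]] rel_geo circ_arc_1 by (rule complex_inverse(2)[OF nz2])
  with \<theta> show ?thesis by (simp add: heis_eq_iff)
qed

lemma dist_square:
  assumes "hproj x \<noteq> hproj x\<^sub>0"
  shows "(d_CC x x\<^sub>0)\<^sup>2 = (norm (rel_chord x\<^sub>0 x))\<^sup>2 * (1 / (hsinc (angle (rel_height x\<^sub>0 x / (norm (rel_chord x\<^sub>0 x))\<^sup>2)))\<^sup>2)"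
proof -
  let ?p = "heis_log x\<^sub>0 x"
  interpret heis_geodesic x\<^sub>0 ?p by unfold_locales (rule abs_hz_heis_log)
  have "d_CC x x\<^sub>0 = norm (hproj ?p)" using dist_endpoint unfolding geo_heis_log[OF assms] .
  moreover have "(norm (rel_chord x\<^sub>0 x))\<^sup>2 = (hsinc (hz ?p))\<^sup>2 * (norm (hproj ?p))\<^sup>2"
    using norm_circ_arc[of "hproj ?p" "hz ?p"] rel_geo(1)[of x\<^sub>0 ?p 1] unfolding geo_heis_log[OF assms] by simp
  ultimately show ?thesis using hsinc_pos[OF abs_hz_heis_log, of x\<^sub>0 x] unfolding hz_heis_log by (simp add: field_simps)
qed

text \<open>
  Moving along \<open>v\<^sub>0\<close> changes only the relative height. Hence \<open>f\<close> is a function of the angle alone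
  along that line, and the derivatives of \<open>1 / hsinc\<^sup>2\<close> and of the inverse of \<open>height\<close> combine
  to \<open>2 \<theta>\<close>.
\<close>
lemma v0_deriv_ff:
  assumes p: "\<bar>hz p\<bar> < 2 * pi" "hproj p \<noteq> 0"
  shows "v0_deriv (ff x\<^sub>0) (geo x\<^sub>0 p 1) = - hz p"
proof -
  let ?x = "geo x\<^sub>0 p 1"
  define \<theta> r w where "\<theta> = hz p" and "r = (norm (rel_chord x\<^sub>0 ?x))\<^sup>2" and "w = rel_height x\<^sub>0 ?x"
  have nz: "hproj ?x \<noteq> hproj x\<^sub>0" using p hproj_geo_eq_iff by blast
  then have r: "r > 0" by (simp add: r_def rel_chord_def)
  have ff: "ff x\<^sub>0 (?x + s *\<^sub>R v0) = - (1 / 2) * (r * (1 / (hsinc (angle ((w + s) / r)))\<^sup>2))" for s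
  proof -
    have "rel_chord x\<^sub>0 (?x + s *\<^sub>R v0) = rel_chord x\<^sub>0 ?x" "rel_height x\<^sub>0 (?x + s *\<^sub>R v0) = w + s"
      by (simp_all add: rel_chord_def rel_height_def w_def)
    moreover have "hproj (?x + s *\<^sub>R v0) \<noteq> hproj x\<^sub>0" using nz by simp
    ultimately show ?thesis unfolding ff_def using dist_square[of "?x + s *\<^sub>R v0" x\<^sub>0] by (simp add: r_def)
  qed
  have \<theta>: "angle (w / r) = \<theta>"
    using heis_log_geo[OF p, of x\<^sub>0] hz_heis_log[of x\<^sub>0 ?x] by (simp add: \<theta>_def w_def r_def)
  have R: "\<bar>\<theta>\<bar> < 2 * pi" using p by (simp add: \<theta>_def)
  have 1: "((\<lambda>s. (w + s) / r) has_real_derivative 1 / r) (at 0)"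
    using r by (auto intro!: derivative_eq_intros)
  have 2: "((\<lambda>s. angle ((w + s) / r)) has_real_derivative (hsinc \<theta>) ^ 4 / jac \<theta> * (1 / r)) (at 0)"
    using DERIV_chain2[OF DERIV_angle 1] by (simp add: \<theta>)
  have D: "((\<lambda>\<theta>. 1 / (hsinc \<theta>)\<^sup>2) has_real_derivative 2 * \<theta> * (jac \<theta> / (hsinc \<theta>) ^ 4)) (at (angle ((w + 0) / r)))"
    using DERIV_inverse_hsinc_square[OF R] by (simp only: add_0_right \<theta>)
  have 3: "((\<lambda>s. 1 / (hsinc (angle ((w + s) / r)))\<^sup>2) has_real_derivative
      2 * \<theta> * (jac \<theta> / (hsinc \<theta>) ^ 4) * ((hsinc \<theta>) ^ 4 / jac \<theta> * (1 / r))) (at 0)"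
    by (rule DERIV_chain2[of "\<lambda>\<theta>. 1 / (hsinc \<theta>)\<^sup>2" _ "\<lambda>s. angle ((w + s) / r)" 0, OF D 2])
  have "2 * \<theta> * (jac \<theta> / (hsinc \<theta>) ^ 4) * ((hsinc \<theta>) ^ 4 / jac \<theta> * (1 / r)) = 2 * \<theta> / r"
    using jac_pos[OF R] hsinc_pos[OF R] by simp
  then have "((\<lambda>s. ff x\<^sub>0 (?x + s *\<^sub>R v0)) has_real_derivative - (1 / 2) * (r * (2 * \<theta> / r))) (at 0)"
    unfolding ff using DERIV_cmult[OF DERIV_cmult[OF 3, of r], of "- (1 / 2)"] by simp
  then have "((\<lambda>s. ff x\<^sub>0 (?x + s *\<^sub>R v0)) has_real_derivative - \<theta>) (at 0)" using r by simp
  then show ?thesis unfolding v0_deriv_def \<theta>_def by (rule DERIV_imp_deriv)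
qed

section \<open>The domain of the contraction maps\<close>

text \<open>
  The half turn \<open>(\<zeta>, z) \<mapsto> (-\<zeta>, z)\<close> about the vertical line through \<open>a\<close>. First its linear part is
  given, in coordinates that are not centred at \<open>a\<close>, and then the affine map.
\<close>

definition half_turn :: "'n::finite heis \<Rightarrow> 'n heis \<Rightarrow> 'n heis" where
  "half_turn a u = hpoint (- hproj u) (hz u - inner (rot (hproj a)) (hproj u))"

lemma bounded_linear_half_turn: "bounded_linear (half_turn a)"
  unfolding half_turn_def[abs_def] hpoint_def hproj_def hz_def
  by (intro linear_conv_bounded_linear[THEN iffD1] linearI)
    (auto simp: inner_simps rot_def inner_prod_def algebra_simps)

definition reflect :: "'n::finite heis \<Rightarrow> 'n heis \<Rightarrow> 'n heis" where
  "reflect a q = hpoint (2 *\<^sub>R hproj a) 0 + half_turn a q"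

lemma reflect_vertical: "hproj q = hproj a \<Longrightarrow> reflect a q = q"
  by (simp add: reflect_def half_turn_def heis_eq_iff scaleR_2)

lemma velocity_reflect:
  assumes "\<gamma> differentiable (at t within {0..1})" "t \<in> {0..1}"
  shows "(\<lambda>t. reflect a (\<gamma> t)) differentiable (at t within {0..1})"
    "velocity (\<lambda>t. reflect a (\<gamma> t)) t = half_turn a (velocity \<gamma> t)"
proof -
  have "(\<gamma> has_vector_derivative velocity \<gamma> t) (at t within {0..1})"
    using assms by (simp add: velocity_def vector_derivative_works)
  from has_vector_derivative_add[OF has_vector_derivative_const[of "hpoint (2 *\<^sub>R hproj a) 0"]
      bounded_linear.has_vector_derivative[OF bounded_linear_half_turn this]]
  have *: "((\<lambda>t. reflect a (\<gamma> t)) has_vector_derivative half_turn a (velocity \<gamma> t)) (at t within {0..1})"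
    unfolding reflect_def by simp
  then show "(\<lambda>t. reflect a (\<gamma> t)) differentiable (at t within {0..1})"
    by (auto simp: differentiable_def has_vector_derivative_def)
  show "velocity (\<lambda>t. reflect a (\<gamma> t)) t = half_turn a (velocity \<gamma> t)"
    unfolding velocity_def[of "\<lambda>t. reflect a (\<gamma> t)"]
    by (rule vector_derivative_within_closed_interval[OF _ assms(2) *]) simp
qed

lemma half_turn_horizontal: "v \<in> heis_horizontal q \<Longrightarrow> half_turn a v \<in> heis_horizontal (reflect a q)"
  by (simp add: heis_horizontal_def alpha0_eq reflect_def half_turn_def rot_add rot_scaleR rot_minus rot_diff inner_simps)

lemma minimizing_reflect:
  assumes min: "minimizing_geodesic heis_horizontal heis_metric \<gamma> x a" and x: "hproj x = hproj a"
  shows "minimizing_geodesic heis_horizontal heis_metric (\<lambda>t. reflect a (\<gamma> t)) x a"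
proof -
  have adm: "admissible heis_horizontal \<gamma> x a" using min by (simp add: minimizing_geodesic_def)
  let ?\<gamma>' = "\<lambda>t. reflect a (\<gamma> t)"
  have ae: "AE t in lebesgue. t \<in> {0..1} \<longrightarrow> \<gamma> differentiable (at t within {0..1}) \<and> velocity \<gamma> t \<in> heis_horizontal (\<gamma> t)"
    using adm by (simp add: admissible_def)
  have eq: "speed heis_metric ?\<gamma>' t = speed heis_metric \<gamma> t"
    if "t \<in> {0..1}" "\<gamma> differentiable (at t within {0..1})" "velocity \<gamma> t \<in> heis_horizontal (\<gamma> t)" for t
    unfolding speed_def heis_metric_horizontal[OF that(3)] velocity_reflect(2)[OF that(2,1)]
      heis_metric_horizontal[OF half_turn_horizontal[OF that(3)]] by (simp add: half_turn_def)
  have "lip \<gamma>" using adm by (auto simp: admissible_def lip_def)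
  then have "lip ?\<gamma>'" unfolding reflect_def
    by (intro lip_add lip_const lip_bounded_linear[OF bounded_linear_half_turn])
  moreover have "AE t in lebesgue. t \<in> {0..1} \<longrightarrow>
      ?\<gamma>' differentiable (at t within {0..1}) \<and> velocity ?\<gamma>' t \<in> heis_horizontal (?\<gamma>' t)"
    using ae
  proof eventually_elim
    case (elim t)
    then show ?case
      using velocity_reflect[of \<gamma> t a] half_turn_horizontal[of "velocity \<gamma> t" "\<gamma> t" a] by simp
  qed
  ultimately have adm': "admissible heis_horizontal ?\<gamma>' x a"
    using adm x by (auto simp: admissible_def lip_def reflect_vertical)
  have speed: "AE t in lebesgue. t \<in> {0..1} \<longrightarrow> speed heis_metric ?\<gamma>' t = speed heis_metric \<gamma> t"
    using ae by eventually_elim (use eq in blast)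
  have "curve_length heis_metric ?\<gamma>' = curve_length heis_metric \<gamma>"
  proof -
    obtain N where N: "{t \<in> space lebesgue. \<not> (t \<in> {0..1} \<longrightarrow> speed heis_metric ?\<gamma>' t = speed heis_metric \<gamma> t)} \<subseteq> N"
      "N \<in> null_sets lebesgue" using speed unfolding eventually_ae_filter by blast
    show ?thesis unfolding curve_length_def
      by (rule integral_spike[of N]) (use N in \<open>auto simp: negligible_iff_null_sets\<close>)
  qed
  moreover obtain c where "AE t in lebesgue. t \<in> {0..1} \<longrightarrow> speed heis_metric \<gamma> t = c"
    using min by (auto simp: minimizing_geodesic_def)
  then have "AE t in lebesgue. t \<in> {0..1} \<longrightarrow> speed heis_metric ?\<gamma>' t = c"
    using speed by eventually_elim auto
  ultimately show ?thesis using min adm' by (auto simp: minimizing_geodesic_def)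
qed

text \<open>
  A unique minimizer between two points of the vertical line would be invariant under the half
  turn. Then it stays on the line, where horizontal curves are constant.
\<close>
lemma vertical_not_in_dom:
  assumes "x \<in> contraction_dom heis_horizontal heis_metric x\<^sub>0" "hproj x = hproj x\<^sub>0"
  shows "x = x\<^sub>0"
proof -
  obtain \<gamma> where min: "minimizing_geodesic heis_horizontal heis_metric \<gamma> x x\<^sub>0"
    using assms by (auto simp: contraction_dom_def)
  have inv: "\<gamma> t = reflect x\<^sub>0 (\<gamma> t)" if "t \<in> {0..1}" for t
    using assms(1) min minimizing_reflect[OF min assms(2)] that unfolding contraction_dom_def by blast
  have const: "hproj (\<gamma> t) = hproj x\<^sub>0" if "t \<in> {0..1}" for t
  proof -
    have "hproj (\<gamma> t) = 2 *\<^sub>R hproj x\<^sub>0 - hproj (\<gamma> t)"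
      using arg_cong[OF inv[OF that], of hproj] by (simp add: reflect_def half_turn_def)
    then have "2 *\<^sub>R hproj (\<gamma> t) = 2 *\<^sub>R hproj x\<^sub>0" by (simp add: scaleR_2 algebra_simps)
    then show ?thesis by simp
  qed
  have adm: "admissible heis_horizontal \<gamma> x x\<^sub>0" using min by (simp add: minimizing_geodesic_def)
  obtain v N L where "horizontal_curve (\<lambda>t. hproj (\<gamma> t)) v (\<lambda>t. hz (\<gamma> t)) N L"
    by (rule admissible_curve_cases[OF adm, of "\<lambda>_. True"]) auto
  then interpret horizontal_curve "\<lambda>t. hproj (\<gamma> t)" v "\<lambda>t. hz (\<gamma> t)" N L .
  have "hz (\<gamma> 1) = hz (\<gamma> 0)"
  proof (rule lip_zero_derivative_imp_constant[OF lip_z negligible])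
    fix t assume t: "t \<in> {0..1} - N"
    then have "((\<lambda>t. hproj x\<^sub>0) has_vector_derivative v t) (at t within {0..1})"
      using const by (intro has_vector_derivative_transform[OF _ _ \<zeta>_deriv[OF t]]) auto
    then have "v t = 0"
      using t vector_derivative_unique_within[of t "{0..1}" "\<lambda>t. hproj x\<^sub>0" "v t" 0]
      by (auto simp: trivial_limit_within islimpt_Icc)
    then show "((\<lambda>t. hz (\<gamma> t)) has_vector_derivative 0) (at t within {0..1})"
      using z_deriv[OF t] by simp
  qed simp
  then show ?thesis using adm assms(2) by (auto simp: admissible_def heis_eq_iff)
qed

lemma geo_covector_0 [simp]: "geo x\<^sub>0 0 s = x\<^sub>0"
  using geo_scale[of x\<^sub>0 0 "0 :: 'a heis"] geo_scale[of x\<^sub>0 s "0 :: 'a heis"] by (simp add: geo_0)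

theorem contraction_dom_eq:
  "contraction_dom heis_horizontal heis_metric x\<^sub>0 = insert x\<^sub>0 {x. hproj x \<noteq> hproj x\<^sub>0}"
proof
  show "contraction_dom heis_horizontal heis_metric x\<^sub>0 \<subseteq> insert x\<^sub>0 {x. hproj x \<noteq> hproj x\<^sub>0}"
    using vertical_not_in_dom by blast
  show "insert x\<^sub>0 {x. hproj x \<noteq> hproj x\<^sub>0} \<subseteq> contraction_dom heis_horizontal heis_metric x\<^sub>0"
  proof
    fix x assume "x \<in> insert x\<^sub>0 {x. hproj x \<noteq> hproj x\<^sub>0}"
    then consider "x = x\<^sub>0" | "hproj x \<noteq> hproj x\<^sub>0" by blast
    then show "x \<in> contraction_dom heis_horizontal heis_metric x\<^sub>0"
    proof cases
      case 1
      interpret heis_geodesic x\<^sub>0 0 by unfold_locales simp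
      show ?thesis using endpoint_in_dom by (simp add: 1)
    next
      case 2
      interpret heis_geodesic x\<^sub>0 "heis_log x\<^sub>0 x" by unfold_locales (rule abs_hz_heis_log)
      show ?thesis using endpoint_in_dom unfolding geo_heis_log[OF 2] .
    qed
  qed
qed

lemma contraction_eq:
  assumes "hproj x \<noteq> hproj x\<^sub>0" "t \<in> {0..1}"
  shows "contraction heis_horizontal heis_metric x\<^sub>0 t x = geo x\<^sub>0 ((1 - t) *\<^sub>R heis_log x\<^sub>0 x) 1"
proof -
  interpret heis_geodesic x\<^sub>0 "heis_log x\<^sub>0 x" by unfold_locales (rule abs_hz_heis_log)
  show ?thesis using contraction_endpoint[OF assms(2)] unfolding geo_heis_log[OF assms(1)] geo_scale .
qed

lemma contraction_basepoint:
  assumes "t \<in> {0..1}" shows "contraction heis_horizontal heis_metric x\<^sub>0 t x\<^sub>0 = x\<^sub>0"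
proof -
  interpret heis_geodesic x\<^sub>0 0 by unfold_locales simp
  show ?thesis using contraction_endpoint[OF assms] by simp
qed


section \<open>Volume in exponential coordinates\<close>
lemma hproj_measurable [measurable]: "hproj \<in> borel_measurable borel"
  and hz_measurable [measurable]: "hz \<in> borel_measurable borel"
  by (auto intro!: borel_measurable_continuous_onI linear_continuous_on bounded_linear_hproj bounded_linear_hz)

lemma rot_measurable [measurable]:
  "(rot :: ('a::euclidean_space) \<times> 'a \<Rightarrow> 'a \<times> 'a) \<in> borel_measurable borel"
  by (intro borel_measurable_continuous_onI linear_continuous_on bounded_linear_rot)

lemma hpoint_measurable [measurable (raw)]:
  assumes "f \<in> borel_measurable M" "g \<in> borel_measurable M"
  shows "(\<lambda>x. hpoint (f x) (g x)) \<in> borel_measurable M"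
  using assms
  by (rule borel_measurable_continuous_Pair) (auto simp: hpoint_def intro!: continuous_intros)

lemma hsinc_measurable [measurable]: "hsinc \<in> borel_measurable borel"
  and jac_measurable [measurable]: "jac \<in> borel_measurable borel"
  and height_measurable [measurable]: "height \<in> borel_measurable borel"
  and chord_re_measurable [measurable]: "chord_re \<in> borel_measurable borel"
  and chord_im_measurable [measurable]: "chord_im \<in> borel_measurable borel"
  unfolding hsinc_def[abs_def] jac_def[abs_def] height_def[abs_def] chord_re_def[abs_def] chord_im_def[abs_def]
  by measurable

lemma nn_integral_affine:
  fixes f :: "'a::euclidean_space \<Rightarrow> ennreal"
  assumes [measurable]: "f \<in> borel_measurable borel" and c: "c \<noteq> 0"
  shows "(\<integral>\<^sup>+x. f x \<partial>lborel) = ennreal (\<bar>c\<bar> ^ DIM('a)) * (\<integral>\<^sup>+x. f (t + c *\<^sub>R x) \<partial>lborel)"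
  by (subst lborel_affine[OF c, of t])
     (simp add: nn_integral_density nn_integral_distr nn_integral_cmult)

lemma nn_integral_translate:
  fixes f :: "'a::euclidean_space \<Rightarrow> ennreal"
  assumes "f \<in> borel_measurable borel"
  shows "(\<integral>\<^sup>+x. f (t + x) \<partial>lborel) = (\<integral>\<^sup>+x. f x \<partial>lborel)"
  using nn_integral_affine[OF assms, of 1 t] by simp

lemma nn_integral_lborel_prod:
  fixes f :: "'a::euclidean_space \<times> 'b::euclidean_space \<Rightarrow> ennreal"
  assumes f: "f \<in> borel_measurable borel"
  shows "(\<integral>\<^sup>+p. f p \<partial>lborel) = (\<integral>\<^sup>+x. \<integral>\<^sup>+y. f (x, y) \<partial>lborel \<partial>lborel)"
    and "(\<integral>\<^sup>+p. f p \<partial>lborel) = (\<integral>\<^sup>+y. \<integral>\<^sup>+x. f (x, y) \<partial>lborel \<partial>lborel)"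
proof -
  have m: "f \<in> borel_measurable (lborel \<Otimes>\<^sub>M lborel)" using f by (simp add: lborel_prod)
  show "(\<integral>\<^sup>+p. f p \<partial>lborel) = (\<integral>\<^sup>+x. \<integral>\<^sup>+y. f (x, y) \<partial>lborel \<partial>lborel)"
    using lborel.nn_integral_fst[OF m] by (simp add: lborel_prod)
  show "(\<integral>\<^sup>+p. f p \<partial>lborel) = (\<integral>\<^sup>+y. \<integral>\<^sup>+x. f (x, y) \<partial>lborel \<partial>lborel)"
    using lborel_pair.nn_integral_snd[OF m] by (simp add: lborel_prod)
qed

lemma nn_integral_heis:
  fixes f :: "'n::finite heis \<Rightarrow> ennreal"
  assumes [measurable]: "f \<in> borel_measurable borel"
  shows "(\<integral>\<^sup>+p. f p \<partial>lborel) = (\<integral>\<^sup>+\<zeta>. \<integral>\<^sup>+z. f (hpoint \<zeta> z) \<partial>lborel \<partial>lborel)"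
    and "(\<integral>\<^sup>+p. f p \<partial>lborel) = (\<integral>\<^sup>+z. \<integral>\<^sup>+\<zeta>. f (hpoint \<zeta> z) \<partial>lborel \<partial>lborel)"
proof -
  have 1: "(\<lambda>yz. f (x, yz)) \<in> borel_measurable borel" for x
    by (rule measurable_compose[of _ _ borel]) (auto intro!: borel_measurable_continuous_onI continuous_intros)
  have "(\<lambda>\<zeta>. \<integral>\<^sup>+z. f (hpoint \<zeta> z) \<partial>lborel) \<in> borel_measurable borel" by measurable
  from nn_integral_lborel_prod(1)[OF this]
  show *: "(\<integral>\<^sup>+p. f p \<partial>lborel) = (\<integral>\<^sup>+\<zeta>. \<integral>\<^sup>+z. f (hpoint \<zeta> z) \<partial>lborel \<partial>lborel)"
    by (simp add: nn_integral_lborel_prod(1)[of f] nn_integral_lborel_prod(1)[OF 1] hpoint_def)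
  show "(\<integral>\<^sup>+p. f p \<partial>lborel) = (\<integral>\<^sup>+z. \<integral>\<^sup>+\<zeta>. f (hpoint \<zeta> z) \<partial>lborel \<partial>lborel)"
    unfolding * by (rule lborel_pair.Fubini'[symmetric]) measurable
qed

text \<open>
  Multiplication by \<open>a + i b\<close> on \<open>\<complex>\<^sup>n\<close>, with \<open>a \<noteq> 0\<close>, is the composition of
  \<open>(x, y) \<mapsto> (a x - b y, y)\<close> and \<open>(x', y) \<mapsto> (x', (b / a) x' + (a\<^sup>2 + b\<^sup>2) / a y)\<close>. Each is affine with a scalar factor in one
  of the two blocks, so that the formula follows from Fubini's theorem.
\<close>
lemma nn_integral_complex_linear:
  fixes f :: "('a::euclidean_space) \<times> 'a \<Rightarrow> ennreal"
  assumes f [measurable]: "f \<in> borel_measurable borel" and a: "a \<noteq> 0"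
  shows "(\<integral>\<^sup>+\<zeta>. f \<zeta> \<partial>lborel) =
    ennreal ((a\<^sup>2 + b\<^sup>2) ^ DIM('a)) * (\<integral>\<^sup>+\<zeta>. f (a *\<^sub>R \<zeta> + b *\<^sub>R rot \<zeta>) \<partial>lborel)"
proof -
  define d where "d = (a\<^sup>2 + b\<^sup>2) / a"
  have "a\<^sup>2 + b\<^sup>2 \<noteq> 0" using a by (simp add: sum_power2_eq_zero_iff)
  then have d: "d \<noteq> 0" using a by (simp add: d_def)
  have ab: "b * (b / a) + a = d" using a by (simp add: d_def power2_eq_square field_simps)
  have m: "(\<lambda>p. f (g p, h p)) \<in> borel_measurable M" if [measurable]: "g \<in> borel_measurable M" "h \<in> borel_measurable M"
    for g h and M :: "'b measure"
    by (rule measurable_compose[OF _ f]) (rule borel_measurable_continuous_Pair[OF that], intro continuous_intros)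
  note m [measurable (raw)]
  have "(\<integral>\<^sup>+\<zeta>. f \<zeta> \<partial>lborel) = (\<integral>\<^sup>+x. \<integral>\<^sup>+y. f (x, y) \<partial>lborel \<partial>lborel)"
    by (rule nn_integral_lborel_prod(1)[OF f])
  also have "\<dots> = (\<integral>\<^sup>+x. ennreal (\<bar>d\<bar> ^ DIM('a)) * (\<integral>\<^sup>+y. f (x, (b / a) *\<^sub>R x + d *\<^sub>R y) \<partial>lborel) \<partial>lborel)"
    by (intro nn_integral_cong nn_integral_affine d) measurable
  also have "\<dots> = ennreal (\<bar>d\<bar> ^ DIM('a)) * (\<integral>\<^sup>+x. (\<integral>\<^sup>+y. f (x, (b / a) *\<^sub>R x + d *\<^sub>R y) \<partial>lborel) \<partial>lborel)"
    by (rule nn_integral_cmult) measurable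
  also have "(\<integral>\<^sup>+x. (\<integral>\<^sup>+y. f (x, (b / a) *\<^sub>R x + d *\<^sub>R y) \<partial>lborel) \<partial>lborel)
      = (\<integral>\<^sup>+y. (\<integral>\<^sup>+x. f (x, (b / a) *\<^sub>R x + d *\<^sub>R y) \<partial>lborel) \<partial>lborel)"
    by (rule lborel_pair.Fubini'[symmetric]) measurable
  also have "\<dots> = (\<integral>\<^sup>+y. ennreal (\<bar>a\<bar> ^ DIM('a)) * (\<integral>\<^sup>+x. f (- b *\<^sub>R y + a *\<^sub>R x, (b / a) *\<^sub>R (- b *\<^sub>R y + a *\<^sub>R x) + d *\<^sub>R y) \<partial>lborel) \<partial>lborel)"
    by (intro nn_integral_cong nn_integral_affine a) measurable
  also have "\<dots> = ennreal (\<bar>a\<bar> ^ DIM('a)) * (\<integral>\<^sup>+y. (\<integral>\<^sup>+x. f (- b *\<^sub>R y + a *\<^sub>R x, (b / a) *\<^sub>R (- b *\<^sub>R y + a *\<^sub>R x) + d *\<^sub>R y) \<partial>lborel) \<partial>lborel)"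
    by (rule nn_integral_cmult) measurable
  also have "(\<integral>\<^sup>+y. (\<integral>\<^sup>+x. f (- b *\<^sub>R y + a *\<^sub>R x, (b / a) *\<^sub>R (- b *\<^sub>R y + a *\<^sub>R x) + d *\<^sub>R y) \<partial>lborel) \<partial>lborel)
     = (\<integral>\<^sup>+y. (\<integral>\<^sup>+x. f (a *\<^sub>R (x, y) + b *\<^sub>R rot (x, y)) \<partial>lborel) \<partial>lborel)"
  proof (intro nn_integral_cong)
    fix x y :: 'a
    have "(b / a) *\<^sub>R (- b *\<^sub>R y + a *\<^sub>R x) + d *\<^sub>R y = b *\<^sub>R x + (d - b * (b / a)) *\<^sub>R y"
      using a by (simp add: scaleR_diff_right scaleR_diff_left mult.commute)
    also have "d - b * (b / a) = a" using ab by simp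
    finally show "f (- b *\<^sub>R y + a *\<^sub>R x, (b / a) *\<^sub>R (- b *\<^sub>R y + a *\<^sub>R x) + d *\<^sub>R y) = f (a *\<^sub>R (x, y) + b *\<^sub>R rot (x, y))"
      by (simp add: rot_def add.commute)
  qed
  also have "\<dots> = (\<integral>\<^sup>+\<zeta>. f (a *\<^sub>R \<zeta> + b *\<^sub>R rot \<zeta>) \<partial>lborel)"
    by (rule nn_integral_lborel_prod(2)[symmetric]) measurable
  also have "ennreal (\<bar>d\<bar> ^ DIM('a)) * (ennreal (\<bar>a\<bar> ^ DIM('a)) * (\<integral>\<^sup>+\<zeta>. f (a *\<^sub>R \<zeta> + b *\<^sub>R rot \<zeta>) \<partial>lborel))
     = ennreal ((a\<^sup>2 + b\<^sup>2) ^ DIM('a)) * (\<integral>\<^sup>+\<zeta>. f (a *\<^sub>R \<zeta> + b *\<^sub>R rot \<zeta>) \<partial>lborel)"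
  proof -
    have "\<bar>d\<bar> ^ DIM('a) * \<bar>a\<bar> ^ DIM('a) = (a\<^sup>2 + b\<^sup>2) ^ DIM('a)"
      using a unfolding power_mult_distrib[symmetric] abs_mult[symmetric] by (simp add: d_def)
    then show ?thesis by (simp add: mult.assoc[symmetric] ennreal_mult[symmetric])
  qed
  finally show ?thesis .
qed

definition angle_density :: "real \<Rightarrow> real" where
  "angle_density \<theta> = (if \<bar>\<theta>\<bar> < 2 * pi then jac \<theta> / hsinc \<theta> ^ 4 else 0)"

lemma angle_density_measurable [measurable]: "angle_density \<in> borel_measurable borel"
  unfolding angle_density_def[abs_def] by measurable

lemma angle_density_nonneg: "0 \<le> angle_density \<theta>"
  using jac_pos[of \<theta>] hsinc_pos[of \<theta>]
  by (auto simp: angle_density_def intro!: divide_nonneg_nonneg)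

text \<open>The one-dimensional substitution \<open>z = r height \<theta>\<close>, with \<open>r\<close> a squared chord length.\<close>
lemma lborel_height:
  assumes r: "0 < r"
  shows "lborel = distr (density lborel (\<lambda>\<theta>. ennreal (r * angle_density \<theta>))) borel (\<lambda>\<theta>. r * height \<theta>)"
proof (rule lborel_eqI)
  fix l u :: real assume lu: "\<And>b. b \<in> Basis \<Longrightarrow> l \<bullet> b \<le> u \<bullet> b"
  then have le: "l \<le> u" by simp
  define A B where "A = angle (l / r)" and "B = angle (u / r)"
  have AB: "A \<le> B" using angle_less_iff[of "u / r" "l / r"] le r
    unfolding A_def B_def by (meson divide_less_cancel not_le)
  have range: "\<bar>A\<bar> < 2 * pi" "\<bar>B\<bar> < 2 * pi" by (simp_all add: A_def B_def abs_angle)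
  have hA: "r * height A = l" "r * height B = u" using r by (simp_all add: A_def B_def height_angle)
  have eq: "ennreal (r * angle_density \<theta>) * indicator ((\<lambda>\<theta>. r * height \<theta>) -` box l u) \<theta>
      = ennreal (r * angle_density \<theta>) * indicator {A<..<B} \<theta>" for \<theta>
  proof (cases "\<bar>\<theta>\<bar> < 2 * pi")
    case True
    have "l < r * height \<theta> \<longleftrightarrow> A < \<theta>" "r * height \<theta> < u \<longleftrightarrow> \<theta> < B"
      using height_less_iff[OF range(1) True] height_less_iff[OF True range(2)] r
      unfolding hA[symmetric] by simp_all
    then show ?thesis by (simp add: indicator_def)
  qed (simp add: angle_density_def)
  have "emeasure (distr (density lborel (\<lambda>\<theta>. ennreal (r * angle_density \<theta>))) borel (\<lambda>\<theta>. r * height \<theta>)) (box l u)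
     = (\<integral>\<^sup>+\<theta>. ennreal (r * angle_density \<theta>) * indicator {A<..<B} \<theta> \<partial>lborel)"
  proof -
    have "(\<lambda>\<theta>. r * height \<theta>) \<in> borel_measurable borel" by measurable
    then have "(\<lambda>\<theta>. r * height \<theta>) -` box l u \<in> sets borel"
      by (rule measurable_sets_borel) simp
    then show ?thesis by (simp add: emeasure_distr emeasure_density eq del: box_real)
  qed
  also have "\<dots> = (\<integral>\<^sup>+\<theta>. ennreal (r * angle_density \<theta>) * indicator {A..B} \<theta> \<partial>lborel)"
  proof (rule nn_integral_cong_AE)
    have "AE \<theta> in lborel. \<theta> \<noteq> A" "AE \<theta> in lborel. \<theta> \<noteq> B" by (simp_all add: AE_lborel_singleton)
    then show "AE \<theta> in lborel. ennreal (r * angle_density \<theta>) * indicator {A<..<B} \<theta>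
       = ennreal (r * angle_density \<theta>) * indicator {A..B} \<theta>"
      by eventually_elim (auto simp: indicator_def)
  qed
  also have "\<dots> = r * height B - r * height A"
  proof (rule nn_integral_FTC_Icc[OF _ _ _ AB])
    fix \<theta> assume "\<theta> \<in> {A..B}"
    then have R: "\<bar>\<theta>\<bar> < 2 * pi" using range by auto
    show "((\<lambda>\<theta>. r * height \<theta>) has_real_derivative r * angle_density \<theta>) (at \<theta>)"
      using DERIV_cmult[OF DERIV_height[OF R], of r] R by (simp add: angle_density_def)
    show "0 \<le> r * angle_density \<theta>" using r angle_density_nonneg by simp
  qed measurable
  finally show "emeasure (distr (density lborel (\<lambda>\<theta>. ennreal (r * angle_density \<theta>))) borel (\<lambda>\<theta>. r * height \<theta>)) (box l u)
     = ennreal (\<Prod>b\<in>Basis. (u - l) \<bullet> b)"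
    by (simp add: hA)
qed simp

definition exp_jacobian :: "'n::finite heis \<Rightarrow> real" where
  "exp_jacobian p = (if \<bar>hz p\<bar> < 2 * pi
     then (norm (hproj p))\<^sup>2 * (jac (hz p) * hsinc (hz p) ^ (2 * CARD('n) - 2)) else 0)"

lemma exp_jacobian_measurable [measurable]: "exp_jacobian \<in> borel_measurable borel"
  unfolding exp_jacobian_def[abs_def] by measurable

lemma exp_jacobian_nonneg: "0 \<le> exp_jacobian p"
  using jac_pos[of "hz p"] hsinc_pos[of "hz p"] by (auto simp: exp_jacobian_def intro!: mult_nonneg_nonneg)

lemma geo_measurable [measurable (raw)]:
  assumes [measurable]: "f \<in> borel_measurable M"
  shows "(\<lambda>x. geo x\<^sub>0 (f x) 1) \<in> borel_measurable M"
  unfolding geo_def circ_arc_1 arc_height_def by measurable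

lemma heis_log_measurable [measurable]: "heis_log x\<^sub>0 \<in> borel_measurable borel"
  unfolding heis_log_def[abs_def] Let_def rel_chord_def rel_height_def by measurable

lemma geo_0_hpoint:
  "geo 0 (hpoint h \<theta>) 1 = hpoint (circ_arc h \<theta> 1) (arc_height h \<theta> 1)"
  by (simp add: geo_def)

text \<open>This discards the angles \<open>\<plusminus>\<pi>\<close>, where the factorization of the complex multiplication fails.\<close>
lemma chord_re_nonzero_AE: "AE \<theta> in lborel. \<bar>\<theta>\<bar> < 2 * pi \<longrightarrow> chord_re \<theta> \<noteq> 0"
proof -
  have "AE \<theta> in lborel. \<theta> \<noteq> pi" "AE \<theta> in lborel. \<theta> \<noteq> - pi" by (simp_all add: AE_lborel_singleton)
  then show ?thesis
  proof eventually_elim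
    case (elim \<theta>)
    show ?case
    proof
      assume R: "\<bar>\<theta>\<bar> < 2 * pi"
      have "sin \<theta> \<noteq> 0" if "\<theta> \<noteq> 0"
      proof
        assume "sin \<theta> = 0"
        then obtain i :: int where i: "\<theta> = of_int i * pi" by (auto simp: sin_zero_iff_int2)
        have "\<bar>real_of_int i\<bar> < 2" using R unfolding i abs_mult by simp
        then have "i = 0 \<or> i = 1 \<or> i = -1" by linarith
        then show False using elim i that by auto
      qed
      then show "chord_re \<theta> \<noteq> 0" by (simp add: chord_re_def)
    qed
  qed
qed

text \<open>
  Substitute \<open>z = |\<zeta>|\<^sup>2 height \<theta>\<close> for fixed \<open>\<zeta> \<noteq> 0\<close>, exchange the order of integration, and
  substitute \<open>\<zeta> = circ_arc h \<theta> 1\<close> for fixed \<open>\<theta>\<close>. The second step contributes \<open>hsinc\<close> to the power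
  \<open>2n\<close>, and \<open>|\<zeta>|\<^sup>2 = hsinc\<^sup>2 |h|\<^sup>2\<close>; together with the denominator of \<open>angle_density\<close> this leaves the
  power \<open>2n - 2\<close>.
\<close>
lemma nn_integral_exp_origin:
  fixes f :: "'n::finite heis \<Rightarrow> ennreal"
  assumes f [measurable]: "f \<in> borel_measurable borel"
  shows "(\<integral>\<^sup>+x. f x \<partial>lborel) = (\<integral>\<^sup>+p. ennreal (exp_jacobian p) * f (geo 0 p 1) \<partial>lborel)"
proof -
  let ?n = "CARD('n)"
  define g where "g \<zeta> \<theta> = ennreal ((norm \<zeta>)\<^sup>2) * f (hpoint \<zeta> ((norm \<zeta>)\<^sup>2 * height \<theta>))" for \<zeta> :: "(real ^ 'n) \<times> (real ^ 'n)" and \<theta>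
  have [measurable]: "(\<lambda>\<zeta>. g \<zeta> \<theta>) \<in> borel_measurable borel" for \<theta>
    unfolding g_def by measurable
  have [measurable]: "(\<lambda>x. g (fst x) (snd x)) \<in> borel_measurable (borel \<Otimes>\<^sub>M borel)"
    unfolding g_def by measurable
  have "(\<integral>\<^sup>+x. f x \<partial>lborel) = (\<integral>\<^sup>+\<zeta>. \<integral>\<^sup>+z. f (hpoint \<zeta> z) \<partial>lborel \<partial>lborel)"
    by (rule nn_integral_heis(1)[OF f])
  also have "\<dots> = (\<integral>\<^sup>+\<zeta>. \<integral>\<^sup>+\<theta>. ennreal (angle_density \<theta>) * g \<zeta> \<theta> \<partial>lborel \<partial>lborel)"
  proof (rule nn_integral_cong_AE)
    have "AE \<zeta> in lborel. (\<zeta> :: (real ^ 'n) \<times> (real ^ 'n)) \<noteq> 0" by (rule AE_lborel_singleton)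
    then show "AE \<zeta> in lborel. (\<integral>\<^sup>+z. f (hpoint \<zeta> z) \<partial>lborel) = (\<integral>\<^sup>+\<theta>. ennreal (angle_density \<theta>) * g \<zeta> \<theta> \<partial>lborel)"
    proof eventually_elim
      case (elim \<zeta>)
      then have r: "0 < (norm \<zeta>)\<^sup>2" by simp
      have "(\<integral>\<^sup>+z. f (hpoint \<zeta> z) \<partial>lborel)
         = (\<integral>\<^sup>+\<theta>. ennreal ((norm \<zeta>)\<^sup>2 * angle_density \<theta>) * f (hpoint \<zeta> ((norm \<zeta>)\<^sup>2 * height \<theta>)) \<partial>lborel)"
        by (subst lborel_height[OF r]) (simp add: nn_integral_distr nn_integral_density)
      then show ?case
        by (simp add: g_def ennreal_mult angle_density_nonneg mult_ac)
    qed
  qed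
  also have "\<dots> = (\<integral>\<^sup>+\<theta>. \<integral>\<^sup>+\<zeta>. ennreal (angle_density \<theta>) * g \<zeta> \<theta> \<partial>lborel \<partial>lborel)"
    by (rule lborel_pair.Fubini'[symmetric]) measurable
  also have "\<dots> = (\<integral>\<^sup>+\<theta>. \<integral>\<^sup>+h. ennreal (exp_jacobian (hpoint h \<theta>)) * f (geo 0 (hpoint h \<theta>) 1) \<partial>lborel \<partial>lborel)"
  proof (rule nn_integral_cong_AE)
    from chord_re_nonzero_AE
    show "AE \<theta> in lborel. (\<integral>\<^sup>+\<zeta>. ennreal (angle_density \<theta>) * g \<zeta> \<theta> \<partial>lborel)
       = (\<integral>\<^sup>+h. ennreal (exp_jacobian (hpoint h \<theta>)) * f (geo 0 (hpoint h \<theta>) 1) \<partial>lborel)"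
    proof eventually_elim
      case (elim \<theta>)
      show ?case
      proof (cases "\<bar>\<theta>\<bar> < 2 * pi")
        case True
        let ?d = "((chord_re \<theta>)\<^sup>2 + (chord_im \<theta>)\<^sup>2) ^ DIM(real ^ 'n)"
        have d: "?d = hsinc \<theta> ^ (2 * ?n)" by (simp add: chord_sum_squares power_mult[symmetric])
        have pos: "0 < hsinc \<theta>" "0 < jac \<theta>" using True by (auto intro: hsinc_pos jac_pos)
        have "(\<integral>\<^sup>+\<zeta>. ennreal (angle_density \<theta>) * g \<zeta> \<theta> \<partial>lborel)
            = ennreal ?d * (\<integral>\<^sup>+h. ennreal (angle_density \<theta>) * g (circ_arc h \<theta> 1) \<theta> \<partial>lborel)"
          unfolding circ_arc_1 using elim True
          by (intro nn_integral_complex_linear) auto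
        also have "\<dots> = (\<integral>\<^sup>+h. ennreal ?d * (ennreal (angle_density \<theta>) * g (circ_arc h \<theta> 1) \<theta>) \<partial>lborel)"
          by (rule nn_integral_cmult[symmetric]) (unfold circ_arc_1, measurable)
        also have "\<dots> = (\<integral>\<^sup>+h. ennreal (exp_jacobian (hpoint h \<theta>)) * f (geo 0 (hpoint h \<theta>) 1) \<partial>lborel)"
        proof (rule nn_integral_cong)
          fix h :: "(real ^ 'n) \<times> (real ^ 'n)"
          have "0 < ?n" by simp
          then have "2 * ?n = (2 * ?n - 2) + 2" by arith
          then have e: "hsinc \<theta> ^ (2 * ?n) = hsinc \<theta> ^ (2 * ?n - 2) * (hsinc \<theta>)\<^sup>2"
            by (metis power_add)
          have "hsinc \<theta> ^ (2 * ?n) * (jac \<theta> / hsinc \<theta> ^ 4 * ((hsinc \<theta>)\<^sup>2 * (norm h)\<^sup>2))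
              = (norm h)\<^sup>2 * (jac \<theta> * hsinc \<theta> ^ (2 * ?n - 2))"
            unfolding e using pos by (simp add: field_simps power2_eq_square power4_eq_xxxx)
          then have "?d * (angle_density \<theta> * (norm (circ_arc h \<theta> 1))\<^sup>2) = exp_jacobian (hpoint h \<theta>)"
            unfolding d using True by (simp add: angle_density_def norm_circ_arc exp_jacobian_def)
          moreover have "f (hpoint (circ_arc h \<theta> 1) ((norm (circ_arc h \<theta> 1))\<^sup>2 * height \<theta>)) = f (geo 0 (hpoint h \<theta>) 1)"
            unfolding geo_0_hpoint arc_height_1[OF True] ..
          ultimately show "ennreal ?d * (ennreal (angle_density \<theta>) * g (circ_arc h \<theta> 1) \<theta>)
              = ennreal (exp_jacobian (hpoint h \<theta>)) * f (geo 0 (hpoint h \<theta>) 1)"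
            unfolding g_def mult.assoc[symmetric] by (simp add: ennreal_mult[symmetric] angle_density_nonneg)
        qed
        finally show ?thesis .
      qed (simp add: angle_density_def exp_jacobian_def)
    qed
  qed
  also have "\<dots> = (\<integral>\<^sup>+p. ennreal (exp_jacobian p) * f (geo 0 p 1) \<partial>lborel)"
    by (rule nn_integral_heis(2)[symmetric]) measurable
  finally show ?thesis .
qed

definition left_translate :: "'n::finite heis \<Rightarrow> 'n heis \<Rightarrow> 'n heis" where
  "left_translate a q = hpoint (hproj a + hproj q) (hz a + hz q + inner (rot (hproj a)) (hproj q) / 2)"

lemma geo_left_translate: "geo x\<^sub>0 p s = left_translate x\<^sub>0 (geo 0 p s)"
  by (simp add: geo_def left_translate_def)

lemma left_translate_measurable [measurable]: "left_translate a \<in> borel_measurable borel"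
  unfolding left_translate_def[abs_def] by measurable

lemma nn_integral_left_translate:
  fixes f :: "'n::finite heis \<Rightarrow> ennreal"
  assumes f [measurable]: "f \<in> borel_measurable borel"
  shows "(\<integral>\<^sup>+x. f (left_translate a x) \<partial>lborel) = (\<integral>\<^sup>+x. f x \<partial>lborel)"
proof -
  have "(\<integral>\<^sup>+x. f (left_translate a x) \<partial>lborel)
    = (\<integral>\<^sup>+\<zeta>. \<integral>\<^sup>+z. f (hpoint (hproj a + \<zeta>) ((hz a + inner (rot (hproj a)) \<zeta> / 2) + z)) \<partial>lborel \<partial>lborel)"
    by (subst nn_integral_heis(1)) (simp_all add: left_translate_def algebra_simps)
  also have "\<dots> = (\<integral>\<^sup>+\<zeta>. \<integral>\<^sup>+z. f (hpoint (hproj a + \<zeta>) z) \<partial>lborel \<partial>lborel)"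
    by (intro nn_integral_cong nn_integral_translate) measurable
  also have "\<dots> = (\<integral>\<^sup>+\<zeta>. \<integral>\<^sup>+z. f (hpoint \<zeta> z) \<partial>lborel \<partial>lborel)"
    by (rule nn_integral_translate) measurable
  also have "\<dots> = (\<integral>\<^sup>+x. f x \<partial>lborel)" by (rule nn_integral_heis(1)[OF f, symmetric])
  finally show ?thesis .
qed

theorem nn_integral_exp:
  fixes f :: "'n::finite heis \<Rightarrow> ennreal"
  assumes f [measurable]: "f \<in> borel_measurable borel"
  shows "(\<integral>\<^sup>+x. f x \<partial>lborel) = (\<integral>\<^sup>+p. ennreal (exp_jacobian p) * f (geo x\<^sub>0 p 1) \<partial>lborel)"
  unfolding nn_integral_left_translate[OF f, of x\<^sub>0, symmetric] geo_left_translate[of x\<^sub>0]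
  by (rule nn_integral_exp_origin) measurable


section \<open>Volume contraction\<close>
abbreviation (input) heis_contraction_image :: "'n::finite heis \<Rightarrow> real \<Rightarrow> 'n heis set \<Rightarrow> 'n heis set" where
  "heis_contraction_image \<equiv> contraction_image heis_horizontal heis_metric"

text \<open>
  The quotient of the Jacobians of the exponential map at \<open>s p\<close> and at \<open>p\<close>, times \<open>s\<^bsup>2n + 1\<^esup>\<close> for the
  dilation of the covectors. The factor \<open>|h|\<^sup>2\<close> of the Jacobian raises the exponent to \<open>2n + 3\<close>.
\<close>
definition distortion :: "nat \<Rightarrow> real \<Rightarrow> real \<Rightarrow> real" where
  "distortion n s \<theta> = s ^ (2 * n + 3) * jac (s * \<theta>) * hsinc (s * \<theta>) ^ (2 * n - 2)
     / (jac \<theta> * hsinc \<theta> ^ (2 * n - 2))"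

lemma distortion_measurable [measurable]: "distortion n s \<in> borel_measurable borel"
  unfolding distortion_def[abs_def] by measurable

lemma distortion_ge:
  assumes "\<bar>\<theta>\<bar> < 2 * pi" "0 \<le> s" "s \<le> 1"
  shows "s ^ (2 * n + 3) \<le> distortion n s \<theta>"
proof -
  have pos: "0 < jac \<theta> * hsinc \<theta> ^ (2 * n - 2)"
    using jac_pos[OF assms(1)] hsinc_pos[OF assms(1)] by simp
  have "jac \<theta> * hsinc \<theta> ^ (2 * n - 2) \<le> jac (s * \<theta>) * hsinc (s * \<theta>) ^ (2 * n - 2)"
    using jac_pos[OF assms(1)] hsinc_pos[OF assms(1)] jac_contract[OF assms] hsinc_contract[OF assms]
    by (intro mult_mono power_mono) auto
  then have "s ^ (2 * n + 3) * (jac \<theta> * hsinc \<theta> ^ (2 * n - 2))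
      \<le> s ^ (2 * n + 3) * (jac (s * \<theta>) * hsinc (s * \<theta>) ^ (2 * n - 2))"
    using assms(2) by (intro mult_left_mono) auto
  then show ?thesis
    using pos by (simp add: distortion_def pos_le_divide_eq mult.assoc)
qed

lemma exp_jacobian_scale:
  fixes p :: "'n::finite heis"
  assumes "\<bar>hz p\<bar> < 2 * pi" "0 \<le> s" "s \<le> 1"
  shows "s ^ (2 * CARD('n) + 1) * exp_jacobian (s *\<^sub>R p) = exp_jacobian p * distortion CARD('n) s (hz p)"
proof -
  have pos: "jac (hz p) \<noteq> 0" "hsinc (hz p) \<noteq> 0"
    using jac_pos[OF assms(1)] hsinc_pos[OF assms(1)] by simp_all
  have "s ^ (2 * CARD('n) + 3) = s ^ (2 * CARD('n) + 1) * s\<^sup>2"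
    by (simp add: power_add power2_eq_square eval_nat_numeral)
  then show ?thesis
    using assms(1) contract_less_two_pi[OF assms] pos
    by (simp add: exp_jacobian_def distortion_def power_mult_distrib)
qed

lemma exp_jacobian_support:
  "exp_jacobian p \<noteq> 0 \<Longrightarrow> \<bar>hz p\<bar> < 2 * pi \<and> hproj p \<noteq> 0"
  by (auto simp: exp_jacobian_def split: if_splits)

text \<open>On the support of the Jacobian the exponential map avoids the vertical line through \<open>x\<^sub>0\<close>.\<close>
lemma vertical_axis_null: "AE x in lborel. hproj x \<noteq> hproj (x\<^sub>0 :: 'n::finite heis)"
proof -
  have S [measurable]: "{x :: 'n heis. hproj x = hproj x\<^sub>0} \<in> sets borel" by measurable
  have "emeasure lborel {x. hproj x = hproj x\<^sub>0} = (\<integral>\<^sup>+x. indicator {x. hproj x = hproj x\<^sub>0} x \<partial>lborel)"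
    by simp
  also have "\<dots> = (\<integral>\<^sup>+p. ennreal (exp_jacobian p) * indicator {x. hproj x = hproj x\<^sub>0} (geo x\<^sub>0 p 1) \<partial>lborel)"
    by (rule nn_integral_exp) measurable
  also have "\<dots> = (\<integral>\<^sup>+p. 0 \<partial>(lborel :: 'n heis measure))"
  proof (rule nn_integral_cong)
    fix p :: "'n heis"
    show "ennreal (exp_jacobian p) * indicator {x. hproj x = hproj x\<^sub>0} (geo x\<^sub>0 p 1) = 0"
      using exp_jacobian_support[of p] hproj_geo_eq_iff[of p x\<^sub>0]
      by (cases "exp_jacobian p = 0") (auto simp: indicator_def)
  qed
  finally have "{x. hproj x = hproj x\<^sub>0} \<in> null_sets lborel" by (simp add: null_sets_def)
  then show ?thesis by (rule AE_I') auto
qed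

text \<open>
  The image under contraction of the points of \<open>U\<close> off the vertical line, described through the
  inverse of the contraction map. In this form it is visibly a Borel set.
\<close>
definition generic_image :: "'n::finite heis \<Rightarrow> real \<Rightarrow> 'n heis set \<Rightarrow> 'n heis set" where
  "generic_image x\<^sub>0 s U = {q. hproj q \<noteq> hproj x\<^sub>0 \<and> \<bar>hz (heis_log x\<^sub>0 q)\<bar> < s * (2 * pi)
      \<and> geo x\<^sub>0 ((1 / s) *\<^sub>R heis_log x\<^sub>0 q) 1 \<in> U}"

lemma generic_image_measurable [measurable]:
  assumes [measurable]: "U \<in> sets borel" shows "generic_image x\<^sub>0 s U \<in> sets borel"
  unfolding generic_image_def by measurable

lemma geo_in_generic_image_iff:
  assumes s: "0 < s" "s \<le> 1" and p: "\<bar>hz (s *\<^sub>R p)\<bar> < 2 * pi" "hproj p \<noteq> 0"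
  shows "geo x\<^sub>0 (s *\<^sub>R p) 1 \<in> generic_image x\<^sub>0 s U \<longleftrightarrow> \<bar>hz p\<bar> < 2 * pi \<and> geo x\<^sub>0 p 1 \<in> U"
proof -
  have nz: "hproj (s *\<^sub>R p) \<noteq> 0" using s p by simp
  have "\<bar>hz (s *\<^sub>R p)\<bar> < s * (2 * pi) \<longleftrightarrow> \<bar>hz p\<bar> < 2 * pi" using s by (simp add: abs_mult)
  then show ?thesis
    using heis_log_geo[OF p(1) nz, of x\<^sub>0] hproj_geo_eq_iff[OF p(1), of x\<^sub>0] nz s
    by (simp add: generic_image_def del: hproj_simps hz_simps)
qed

lemma contraction_generic:
  assumes t: "0 \<le> t" "t < 1"
  shows "contraction heis_horizontal heis_metric x\<^sub>0 t ` (U \<inter> {x. hproj x \<noteq> hproj x\<^sub>0}) = generic_image x\<^sub>0 (1 - t) U"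
proof (intro set_eqI iffI)
  have s: "0 < 1 - t" "1 - t \<le> 1" using t by auto
  have nz: "hproj (heis_log x\<^sub>0 x) \<noteq> 0" if "hproj x \<noteq> hproj x\<^sub>0" for x
    using hproj_geo_eq_iff[OF abs_hz_heis_log, of x\<^sub>0 x\<^sub>0 x] geo_heis_log[OF that] that by simp
  fix q
  {
    assume "q \<in> contraction heis_horizontal heis_metric x\<^sub>0 t ` (U \<inter> {x. hproj x \<noteq> hproj x\<^sub>0})"
    then obtain x where x: "x \<in> U" "hproj x \<noteq> hproj x\<^sub>0"
      and q: "q = geo x\<^sub>0 ((1 - t) *\<^sub>R heis_log x\<^sub>0 x) 1"
      using contraction_eq[of _ x\<^sub>0 t] t by (fastforce simp del: split_paired_All split_paired_Ex)
    have "\<bar>hz ((1 - t) *\<^sub>R heis_log x\<^sub>0 x)\<bar> < 2 * pi"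
      using contract_less_two_pi[OF abs_hz_heis_log, of "1 - t" x\<^sub>0 x] s by simp
    then show "q \<in> generic_image x\<^sub>0 (1 - t) U"
      unfolding q using geo_in_generic_image_iff[OF s _ nz[OF x(2)]] x geo_heis_log[OF x(2)] abs_hz_heis_log by metis
  next
    assume q: "q \<in> generic_image x\<^sub>0 (1 - t) U"
    define p where "p = (1 / (1 - t)) *\<^sub>R heis_log x\<^sub>0 q"
    have sp: "(1 - t) *\<^sub>R p = heis_log x\<^sub>0 q" using s by (simp add: p_def)
    have qn: "hproj q \<noteq> hproj x\<^sub>0" and U: "geo x\<^sub>0 p 1 \<in> U"
      using q by (auto simp: generic_image_def p_def)
    have "\<bar>hz p\<bar> = \<bar>hz (heis_log x\<^sub>0 q)\<bar> / (1 - t)" using s by (simp add: p_def abs_mult)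
    then have R: "\<bar>hz p\<bar> < 2 * pi"
      using q s by (simp add: generic_image_def pos_divide_less_eq mult.commute)
    have pn: "hproj p \<noteq> 0" using nz[OF qn] s by (simp add: p_def)
    have "contraction heis_horizontal heis_metric x\<^sub>0 t (geo x\<^sub>0 p 1) = q"
      using contraction_eq[of "geo x\<^sub>0 p 1" x\<^sub>0 t] hproj_geo_eq_iff[OF R] heis_log_geo[OF R pn] pn t
      by (simp add: sp geo_heis_log[OF qn])
    then show "q \<in> contraction heis_horizontal heis_metric x\<^sub>0 t ` (U \<inter> {x. hproj x \<noteq> hproj x\<^sub>0})"
      using U hproj_geo_eq_iff[OF R] pn by (intro image_eqI[of _ _ "geo x\<^sub>0 p 1"]) auto
  }
qed

lemma DIM_heis: "DIM('n::finite heis) = 2 * CARD('n) + 1"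
  by simp

text \<open>
  Pass to exponential coordinates, rescale the covectors by \<open>s\<close> and return. Covectors with angle at
  least \<open>2\<pi>\<close> may acquire a positive Jacobian by rescaling. They do not contribute, as points of the
  contracted set have angles below \<open>2\<pi> s\<close>.
\<close>
lemma emeasure_generic_image:
  fixes U :: "'n::finite heis set"
  assumes s: "0 < s" "s \<le> 1" and U [measurable]: "U \<in> sets borel"
  shows "emeasure lborel (generic_image x\<^sub>0 s U)
    = (\<integral>\<^sup>+x. ennreal (distortion CARD('n) s (hz (heis_log x\<^sub>0 x))) * indicator U x \<partial>lborel)"
proof -
  let ?T = "generic_image x\<^sub>0 s U"
  have "emeasure lborel ?T = (\<integral>\<^sup>+x. indicator ?T x \<partial>lborel)" by simp
  also have "\<dots> = (\<integral>\<^sup>+p. ennreal (exp_jacobian p) * indicator ?T (geo x\<^sub>0 p 1) \<partial>lborel)"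
    by (rule nn_integral_exp) measurable
  also have "\<dots> = ennreal (\<bar>s\<bar> ^ DIM('n heis)) *
      (\<integral>\<^sup>+p. ennreal (exp_jacobian (0 + s *\<^sub>R p)) * indicator ?T (geo x\<^sub>0 (0 + s *\<^sub>R p) 1) \<partial>lborel)"
  proof (rule nn_integral_affine)
    show "s \<noteq> 0" using s by simp
  qed measurable
  also have "\<dots> = (\<integral>\<^sup>+p. ennreal (s ^ (2 * CARD('n) + 1)) *
      (ennreal (exp_jacobian (s *\<^sub>R p)) * indicator ?T (geo x\<^sub>0 (s *\<^sub>R p) 1)) \<partial>lborel)"
    unfolding DIM_heis using s by (subst nn_integral_cmult) auto
  also have "\<dots> = (\<integral>\<^sup>+p. ennreal (exp_jacobian p) *
      (ennreal (distortion CARD('n) s (hz (heis_log x\<^sub>0 (geo x\<^sub>0 p 1)))) * indicator U (geo x\<^sub>0 p 1)) \<partial>lborel)"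
  proof (rule nn_integral_cong)
    fix p :: "'n heis"
    consider "exp_jacobian (s *\<^sub>R p) = 0" "exp_jacobian p = 0"
      | "hproj p \<noteq> 0" "\<bar>hz (s *\<^sub>R p)\<bar> < 2 * pi" "\<not> \<bar>hz p\<bar> < 2 * pi"
      | "hproj p \<noteq> 0" "\<bar>hz p\<bar> < 2 * pi"
      by (cases "hproj p = 0"; cases "\<bar>hz p\<bar> < 2 * pi"; cases "\<bar>hz (s *\<^sub>R p)\<bar> < 2 * pi")
        (auto simp: exp_jacobian_def)
    then show "ennreal (s ^ (2 * CARD('n) + 1)) *
        (ennreal (exp_jacobian (s *\<^sub>R p)) * indicator ?T (geo x\<^sub>0 (s *\<^sub>R p) 1))
      = ennreal (exp_jacobian p) *
        (ennreal (distortion CARD('n) s (hz (heis_log x\<^sub>0 (geo x\<^sub>0 p 1)))) * indicator U (geo x\<^sub>0 p 1))"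
    proof cases
      case 2
      then have "exp_jacobian p = 0" "geo x\<^sub>0 (s *\<^sub>R p) 1 \<notin> ?T"
        using geo_in_generic_image_iff[OF s 2(2,1)] by (simp_all add: exp_jacobian_def)
      then show ?thesis by simp
    next
      case 3
      have R: "\<bar>hz (s *\<^sub>R p)\<bar> < 2 * pi" using contract_less_two_pi[OF 3(2), of s] s by simp
      have "(indicator ?T (geo x\<^sub>0 (s *\<^sub>R p) 1) :: ennreal) = indicator U (geo x\<^sub>0 p 1)"
        using geo_in_generic_image_iff[OF s R 3(1)] 3(2) by (simp add: indicator_def)
      moreover have "0 \<le> distortion CARD('n) s (hz p)"
        using distortion_ge[OF 3(2), of s "CARD('n)"] s by (meson order_trans zero_le_power less_imp_le)
      then have "ennreal (s ^ (2 * CARD('n) + 1)) * ennreal (exp_jacobian (s *\<^sub>R p))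
          = ennreal (exp_jacobian p) * ennreal (distortion CARD('n) s (hz p))"
        using arg_cong[OF exp_jacobian_scale[OF 3(2), of s], of ennreal] s
        by (simp only: ennreal_mult ennreal_mult'' exp_jacobian_nonneg zero_le_power less_imp_le)
      ultimately show ?thesis unfolding heis_log_geo[OF 3(2,1)] by (simp add: mult.assoc[symmetric])
    qed simp
  qed
  also have "\<dots> = (\<integral>\<^sup>+x. ennreal (distortion CARD('n) s (hz (heis_log x\<^sub>0 x))) * indicator U x \<partial>lborel)"
    by (rule nn_integral_exp[symmetric]) measurable
  finally show ?thesis .
qed

text \<open>
  The vertical line meets the domain of the contraction map only in \<open>x\<^sub>0\<close>, which is fixed. For
  \<open>t = 1\<close> the image is contained in \<open>{x\<^sub>0}\<close> and the distortion vanishes.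
\<close>
theorem contraction_volume:
  fixes U :: "'n::finite heis set"
  assumes U: "U \<in> sets borel" and t: "t \<in> {0..1}"
  shows "heis_contraction_image x\<^sub>0 t U \<in> sets lebesgue"
    and "emeasure lebesgue (heis_contraction_image x\<^sub>0 t U)
      = (\<integral>\<^sup>+x. ennreal (distortion CARD('n) (1 - t) (hz (heis_log x\<^sub>0 x))) * indicator U x \<partial>lborel)"
proof -
  let ?c = "contraction heis_horizontal heis_metric x\<^sub>0 t"
  let ?G = "{x. hproj x \<noteq> hproj x\<^sub>0}"
  let ?C = "heis_contraction_image x\<^sub>0 t U"
  have C: "?C = ?c ` (U \<inter> ?G) \<union> ?c ` (U \<inter> {x\<^sub>0})"
    unfolding contraction_image_def contraction_dom_eq by auto
  have base: "?c ` (U \<inter> {x\<^sub>0}) \<subseteq> {x\<^sub>0}"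
    using contraction_basepoint[OF t, of x\<^sub>0] by (simp add: image_subset_iff)
  then have base_null: "?c ` (U \<inter> {x\<^sub>0}) \<in> null_sets lborel"
    by (cases "x\<^sub>0 \<in> U") (auto simp: null_sets_def)
  have "?C \<in> sets borel \<and> emeasure lborel ?C
      = (\<integral>\<^sup>+x. ennreal (distortion CARD('n) (1 - t) (hz (heis_log x\<^sub>0 x))) * indicator U x \<partial>lborel)"
  proof (cases "t = 1")
    case True
    have "?c ` (U \<inter> ?G) \<subseteq> {x\<^sub>0}" using contraction_eq[of _ x\<^sub>0 1] True by auto
    then have "?C \<subseteq> {x\<^sub>0}" using base C by auto
    then have "?C = {} \<or> ?C = {x\<^sub>0}" by auto
    then have "?C \<in> sets borel" "emeasure lborel ?C = 0" by auto
    moreover have "distortion CARD('n) 0 \<theta> = 0" for \<theta>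
      by (simp add: distortion_def power_0_left)
    ultimately show ?thesis using True by simp
  next
    case False
    then have s: "0 < 1 - t" "1 - t \<le> 1" using t by auto
    have T: "?c ` (U \<inter> ?G) = generic_image x\<^sub>0 (1 - t) U" using s by (intro contraction_generic) auto
    have "generic_image x\<^sub>0 (1 - t) U \<in> sets lborel" using U by simp
    then show ?thesis
      unfolding C T emeasure_generic_image[OF s U, symmetric] using base_null
      by (auto simp: emeasure_Un_null_set null_sets_def)
  qed
  then show "?C \<in> sets lebesgue" "emeasure lebesgue ?C
      = (\<integral>\<^sup>+x. ennreal (distortion CARD('n) (1 - t) (hz (heis_log x\<^sub>0 x))) * indicator U x \<partial>lborel)"
    by auto
qed

lemma distortion_M1_M2:
  fixes x x\<^sub>0 :: "'n::finite heis"
  assumes "hproj x \<noteq> hproj x\<^sub>0"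
  shows "(1 - t) ^ (2 * CARD('n) + 3) * M1 (kk1 x\<^sub>0 x) t * M2 (kk2 x\<^sub>0 x) t ^ (2 * CARD('n) - 2)
      / (M1 (kk1 x\<^sub>0 x) 0 * M2 (kk2 x\<^sub>0 x) 0 ^ (2 * CARD('n) - 2))
    = distortion CARD('n) (1 - t) (hz (heis_log x\<^sub>0 x))"
proof -
  let ?p = "heis_log x\<^sub>0 x"
  have "hproj ?p \<noteq> 0"
    using hproj_geo_eq_iff[OF abs_hz_heis_log, of x\<^sub>0 x\<^sub>0 x] geo_heis_log[OF assms] assms by simp
  then have "v0_deriv (ff x\<^sub>0) x = - hz ?p"
    using v0_deriv_ff[OF abs_hz_heis_log, of x\<^sub>0 x x\<^sub>0] by (simp add: geo_heis_log[OF assms])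
  then have kk: "kk1 x\<^sub>0 x = (hz ?p)\<^sup>2" "kk2 x\<^sub>0 x = (hz ?p)\<^sup>2 / 4"
    by (simp_all add: kk1_def kk2_def)
  show ?thesis
    unfolding kk M1_square M2_square by (simp add: distortion_def mult.commute[of "1 - t"])
qed

lemma contraction_volume_ge:
  fixes U :: "'n::finite heis set"
  assumes U [measurable]: "U \<in> sets borel" and t: "t \<in> {0..1}"
  shows "ennreal ((1 - t) ^ (2 * CARD('n) + 3)) * emeasure lebesgue U
    \<le> emeasure lebesgue (heis_contraction_image x\<^sub>0 t U)"
proof -
  have "ennreal ((1 - t) ^ (2 * CARD('n) + 3)) * emeasure lebesgue U
      = (\<integral>\<^sup>+x. ennreal ((1 - t) ^ (2 * CARD('n) + 3)) * indicator U x \<partial>lborel)"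
    by (simp add: nn_integral_cmult_indicator)
  also have "\<dots> \<le> (\<integral>\<^sup>+x. ennreal (distortion CARD('n) (1 - t) (hz (heis_log x\<^sub>0 x))) * indicator U x \<partial>lborel)"
    using t by (intro nn_integral_mono mult_right_mono ennreal_leI distortion_ge abs_hz_heis_log) auto
  also have "\<dots> = emeasure lebesgue (heis_contraction_image x\<^sub>0 t U)"
    by (rule contraction_volume(2)[OF U t, symmetric])
  finally show ?thesis .
qed

text \<open>
  Off the vertical line, which is a null set, the integrand is the distortion. For vanishing
  curvature parameters the weight in \<open>MCP\<close> is the constant \<open>(1 - t)\<^bsup>2n + 3\<^esup>\<close>, so that both contraction
  properties reduce to the lower bound of the distortion.
\<close>
theorem proposition1:
  "(\<forall>(x\<^sub>0 :: 'n::finite heis). \<forall>U\<in>sets borel. \<forall>t\<in>{0..1}.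
      contraction_image heis_horizontal heis_metric x\<^sub>0 t U \<in> sets lebesgue \<and>
      emeasure lebesgue (contraction_image heis_horizontal heis_metric x\<^sub>0 t U) =
        (\<integral>\<^sup>+x\<in>U. ennreal
            ((1 - t) ^ (2 * CARD('n) + 3) * M1 (kk1 x\<^sub>0 x) t
                * M2 (kk2 x\<^sub>0 x) t ^ (2 * CARD('n) - 2)
             / (M1 (kk1 x\<^sub>0 x) 0 * M2 (kk2 x\<^sub>0 x) 0 ^ (2 * CARD('n) - 2))) \<partial>lebesgue))
   \<and> MCP (heis_horizontal :: 'n heis distribution) heis_metric lebesgue 0 0 (2 * CARD('n) + 1)
   \<and> MCP0 (heis_horizontal :: 'n heis distribution) heis_metric lebesgue (real (2 * CARD('n) + 3))"
proof (intro conjI allI ballI)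
  fix x\<^sub>0 :: "'n heis" and U :: "'n heis set" and t :: real
  assume U: "U \<in> sets borel" and t: "t \<in> {0..1}"
  show "heis_contraction_image x\<^sub>0 t U \<in> sets lebesgue"
    by (rule contraction_volume(1)[OF U t])
  show "emeasure lebesgue (heis_contraction_image x\<^sub>0 t U) =
        (\<integral>\<^sup>+x\<in>U. ennreal
            ((1 - t) ^ (2 * CARD('n) + 3) * M1 (kk1 x\<^sub>0 x) t
                * M2 (kk2 x\<^sub>0 x) t ^ (2 * CARD('n) - 2)
             / (M1 (kk1 x\<^sub>0 x) 0 * M2 (kk2 x\<^sub>0 x) 0 ^ (2 * CARD('n) - 2))) \<partial>lebesgue)"
    unfolding contraction_volume(2)[OF U t] nn_integral_completion
  proof (rule nn_integral_cong_AE)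
    show "AE x in lborel. ennreal (distortion CARD('n) (1 - t) (hz (heis_log x\<^sub>0 x))) * indicator U x
       = ennreal ((1 - t) ^ (2 * CARD('n) + 3) * M1 (kk1 x\<^sub>0 x) t
                * M2 (kk2 x\<^sub>0 x) t ^ (2 * CARD('n) - 2)
             / (M1 (kk1 x\<^sub>0 x) 0 * M2 (kk2 x\<^sub>0 x) 0 ^ (2 * CARD('n) - 2))) * indicator U x"
      using vertical_axis_null[of x\<^sub>0] by eventually_elim (subst distortion_M1_M2, simp_all)
  qed
next
  show "MCP (heis_horizontal :: 'n heis distribution) heis_metric lebesgue 0 0 (2 * CARD('n) + 1)"
    unfolding MCP_def
  proof (intro allI ballI)
    fix x\<^sub>0 :: "'n heis" and U :: "'n heis set" and t :: real
    assume U: "U \<in> sets borel" and t: "t \<in> {0..1}"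
    have "(\<integral>\<^sup>+x\<in>U. ennreal ((1 - t) ^ (2 * CARD('n) + 1 + 2) * M1 (0 * (d_CC x x\<^sub>0)\<^sup>2) t
                * M2 (0 * (d_CC x x\<^sub>0)\<^sup>2) t powi (int (2 * CARD('n) + 1) - 3)
             / (M1 (0 * (d_CC x x\<^sub>0)\<^sup>2) 0 * M2 (0 * (d_CC x x\<^sub>0)\<^sup>2) 0 powi (int (2 * CARD('n) + 1) - 3))) \<partial>lebesgue)
       = (\<integral>\<^sup>+x\<in>U. ennreal ((1 - t) ^ (2 * CARD('n) + 3)) \<partial>lebesgue)"
      by (simp add: M1_def M2_def DD_def eval_nat_numeral)
    also have "\<dots> = ennreal ((1 - t) ^ (2 * CARD('n) + 3)) * emeasure lebesgue U"
      using U by (simp add: nn_integral_cmult_indicator)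
    also have "\<dots> \<le> emeasure lebesgue (heis_contraction_image x\<^sub>0 t U)"
      by (rule contraction_volume_ge[OF U t])
    finally show "(\<integral>\<^sup>+x\<in>U. ennreal ((1 - t) ^ (2 * CARD('n) + 1 + 2) * M1 (0 * (d_CC x x\<^sub>0)\<^sup>2) t
                * M2 (0 * (d_CC x x\<^sub>0)\<^sup>2) t powi (int (2 * CARD('n) + 1) - 3)
             / (M1 (0 * (d_CC x x\<^sub>0)\<^sup>2) 0 * M2 (0 * (d_CC x x\<^sub>0)\<^sup>2) 0 powi (int (2 * CARD('n) + 1) - 3))) \<partial>lebesgue)
       \<le> emeasure lebesgue (heis_contraction_image x\<^sub>0 t U)" .
  qed
  show "MCP0 (heis_horizontal :: 'n heis distribution) heis_metric lebesgue (real (2 * CARD('n) + 3))"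
    unfolding MCP0_def
  proof (intro allI ballI)
    fix x\<^sub>0 :: "'n heis" and U :: "'n heis set" and t :: real
    assume U: "U \<in> sets borel" and t: "t \<in> {0..1}"
    have "(1 - t) powr real (2 * CARD('n) + 3) = (1 - t) ^ (2 * CARD('n) + 3)"
    proof (cases "t = 1")
      case False
      then have "0 < 1 - t" using t by simp
      then show ?thesis by (rule powr_realpow)
    qed simp
    then show "ennreal ((1 - t) powr real (2 * CARD('n) + 3)) * emeasure lebesgue U
       \<le> emeasure lebesgue (heis_contraction_image x\<^sub>0 t U)"
      using contraction_volume_ge[OF U t] by (simp only:)
  qed
qed

end
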